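(* Let $(M,g)$ be a smooth Riemannian manifold with Levi-Civita connection $\nabla$ and let $\mathcal{D}\subseteq TM$ be a regular distribution. The following conditions are equivalent: \begin{enumerate} \item $\mathcal{D}$ is totally geodesic. \item Every $\nabla^{\mathcal{D}}$-geodesic in $\mathcal{D}$ is a $\nabla$-geodesic. \item The symmetric part $B^s$ of the second fundamental form of $\mathcal{D}$ is identically zero. \item If $X,Y\in\Gamma(\mathcal{D})$, then $\nabla_XY+\nabla_YX\in\Gamma(\mathcal{D})$. \item If $X\in\Gamma(\mathcal{D})$, then $\nabla_XX\in\Gamma(\mathcal{D})$. \end{enumerate}
   Context: All objects are $\mathcal{C}^\infty$. A regular distribution $\mathcal{D}\subseteq TM$ is a smooth subbundle of $TM$ of constant rank, with fibre $\mathcal{D}_p$ at $p$; $\mathcal{D}^{\bot}$ is its $g$-orthogonal complement; $\Gamma(\cdot)$ denotes the module of smooth sections; $\pi^{\mathcal{D}},\pi^{\mathcal{D}^{\bot}}$ are the orthogonal projections of $TM$ onto $\mathcal{D}$ and $\mathcal{D}^{\bot}$. The intrinsic connection is $\nabla^{\mathcal{D}}_XY=\pi^{\mathcal{D}}(\nabla_XY)$ for $X,Y\in\Gamma(\mathcal{D})$; along a curve $\gamma$ with $\dot\gamma(t)\in\mathcal{D}_{\gamma(t)}$ for all $t$, $\nabla^{\mathcal{D}}_{\dot\gamma}\dot\gamma=\pi^{\mathcal{D}}(\nabla_{\dot\gamma}\dot\gamma)$. The second fundamental form is $B(X,Y)=\pi^{\mathcal{D}^{\bot}}(\nabla_XY)$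 for $X,Y\in\Gamma(\mathcal{D})$, and its symmetric part is $B^s(X,Y)=\frac12(B(X,Y)+B(Y,X))$. A smooth curve $\gamma:I\subseteq\mathbb{R}\to M$ ($I$ an interval) is a $\nabla$-geodesic if $\nabla_{\dot\gamma}\dot\gamma=0$; it is a $\nabla^{\mathcal{D}}$-geodesic if $\dot\gamma(t)\in\mathcal{D}_{\gamma(t)}$ for all $t\in I$ and $\nabla^{\mathcal{D}}_{\dot\gamma}\dot\gamma=0$. $\mathcal{D}$ is totally geodesic if every $\nabla$-geodesic with initial condition (initial velocity) in $\mathcal{D}$ is contained in $\mathcal{D}$, i.e. its velocity satisfies $\dot\gamma(t)\in\mathcal{D}_{\gamma(t)}$ for all $t$. *)

theory Defs
  imports "HOL-Analysis.Analysis" "HOL-Library.Function_Algebras"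
begin

section \<open>Functions into a real vector space\<close>

instantiation "fun" :: (type, real_vector) real_vector
begin

definition scaleR_fun :: "real \<Rightarrow> ('a \<Rightarrow> 'b) \<Rightarrow> 'a \<Rightarrow> 'b"
  where "scaleR_fun r f = (\<lambda>x. r *\<^sub>R f x)"

instance
  by standard (auto simp: scaleR_fun_def fun_eq_iff algebra_simps)

end


section \<open>Smooth maps between normed spaces\<close>

text \<open>Derivatives are two-sided, so the domain is always taken to be open.\<close>

primrec Ck_on ::
  "nat \<Rightarrow> ('a::real_normed_vector \<Rightarrow> 'b::real_normed_vector) \<Rightarrow> 'a set \<Rightarrow> bool"
where
  "Ck_on 0 f S \<longleftrightarrow> continuous_on S f"
| "Ck_on (Suc k) f S \<longleftrightarrow> (\<forall>x\<in>S. f differentiable (at x)) \<and>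
     (\<forall>v. Ck_on k (\<lambda>x. frechet_derivative f (at x) v) S)"

definition smooth_on ::
  "('a::real_normed_vector \<Rightarrow> 'b::real_normed_vector) \<Rightarrow> 'a set \<Rightarrow> bool"
  where "smooth_on f S \<longleftrightarrow> (\<forall>k. Ck_on k f S)"


section \<open>Smooth manifolds\<close>

text \<open>A chart is a pair of a domain and a coordinate map. The underlying set of the manifold is
  the whole type \<open>'a\<close>; its smooth structure is the one generated by the atlas \<open>A\<close>, which need
  not be maximal.\<close>

type_synonym ('a, 'e) chart = "'a set \<times> ('a \<Rightarrow> 'e)"

abbreviation cdom :: "('a, 'e) chart \<Rightarrow> 'a set" where "cdom \<equiv> fst"
abbreviation cmap :: "('a, 'e) chart \<Rightarrow> 'a \<Rightarrow> 'e" where "cmap \<equiv> snd"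
abbreviation cinv :: "('a, 'e) chart \<Rightarrow> 'e \<Rightarrow> 'a" where "cinv c \<equiv> inv_into (cdom c) (cmap c)"

definition smooth_manifold ::
  "('a::{t2_space, second_countable_topology}, 'e::euclidean_space) chart set \<Rightarrow> bool"
where
  "smooth_manifold A \<longleftrightarrow>
     (\<forall>c\<in>A. open (cdom c) \<and> open (cmap c ` cdom c) \<and>
        homeomorphism (cdom c) (cmap c ` cdom c) (cmap c) (cinv c)) \<and>
     (\<Union>c\<in>A. cdom c) = UNIV \<and>
     (\<forall>c\<in>A. \<forall>d\<in>A. smooth_on (cmap d \<circ> cinv c) (cmap c ` (cdom c \<inter> cdom d)))"

definition smooth_fun_on ::
  "('a::topological_space, 'e::euclidean_space) chart set \<Rightarrow> 'a set \<Rightarrow> ('a \<Rightarrow> real) \<Rightarrow> bool"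
where
  "smooth_fun_on A U f \<longleftrightarrow> (\<forall>c\<in>A. smooth_on (f \<circ> cinv c) (cmap c ` (U \<inter> cdom c)))"


section \<open>Tangent vectors and vector fields\<close>

text \<open>A tangent vector at \<open>p\<close> is the family of its coordinate vectors in all charts of the atlas
  around \<open>p\<close>, subject to the usual transformation law. Its value is 0 at all other arguments,
  so that equality of tangent vectors is equality of functions.\<close>

type_synonym ('a, 'e) tvec = "('a, 'e) chart \<Rightarrow> 'e"

type_synonym ('a, 'e) vfield = "'a \<Rightarrow> ('a, 'e) tvec"

definition tangent_space ::
  "('a::topological_space, 'e::euclidean_space) chart set \<Rightarrow> 'a \<Rightarrow> ('a, 'e) tvec set"
where
  "tangent_space A p = {v.
     (\<forall>c. \<not> (c \<in> A \<and> p \<in> cdom c) \<longrightarrow> v c = 0) \<and>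
     (\<forall>c\<in>A. \<forall>d\<in>A. p \<in> cdom c \<inter> cdom d \<longrightarrow>
        v d = frechet_derivative (cmap d \<circ> cinv c) (at (cmap c p)) (v c))}"

definition smooth_vfield_on ::
  "('a::topological_space, 'e::euclidean_space) chart set \<Rightarrow> 'a set \<Rightarrow> ('a, 'e) vfield \<Rightarrow> bool"
where
  "smooth_vfield_on A U X \<longleftrightarrow>
     (\<forall>p\<in>U. X p \<in> tangent_space A p) \<and>
     (\<forall>c\<in>A. smooth_on (\<lambda>x. X (cinv c x) c) (cmap c ` (U \<inter> cdom c)))"

abbreviation vfields ::
  "('a::topological_space, 'e::euclidean_space) chart set \<Rightarrow> ('a, 'e) vfield set"
  where "vfields A \<equiv> {X. smooth_vfield_on A UNIV X}"

text \<open>The derivative of \<open>f\<close> in the direction of a tangent vector \<open>v\<close> at \<open>p\<close>; by the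
  transformation law it does not depend on the chart that is chosen.\<close>

definition dir_deriv ::
  "('a::topological_space, 'e::euclidean_space) chart set \<Rightarrow> 'a \<Rightarrow> ('a, 'e) tvec \<Rightarrow>
    ('a \<Rightarrow> real) \<Rightarrow> real"
where
  "dir_deriv A p v f =
     (let c = (SOME c. c \<in> A \<and> p \<in> cdom c)
      in frechet_derivative (f \<circ> cinv c) (at (cmap c p)) (v c))"

text \<open>In a chart, \<open>[X, Y]\<^sup>i = X\<^sup>j \<partial>\<^sub>j Y\<^sup>i - Y\<^sup>j \<partial>\<^sub>j X\<^sup>i\<close>.\<close>

definition lie_bracket ::
  "('a::topological_space, 'e::euclidean_space) chart set \<Rightarrow> ('a, 'e) vfield \<Rightarrow>
    ('a, 'e) vfield \<Rightarrow> ('a, 'e) vfield"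
where
  "lie_bracket A X Y = (\<lambda>p c.
     if c \<in> A \<and> p \<in> cdom c
     then frechet_derivative (\<lambda>x. Y (cinv c x) c) (at (cmap c p)) (X p c)
        - frechet_derivative (\<lambda>x. X (cinv c x) c) (at (cmap c p)) (Y p c)
     else 0)"


section \<open>Riemannian metrics and the Levi-Civita connection\<close>

definition riemannian_metric ::
  "('a::topological_space, 'e::euclidean_space) chart set \<Rightarrow>
    ('a \<Rightarrow> ('a, 'e) tvec \<Rightarrow> ('a, 'e) tvec \<Rightarrow> real) \<Rightarrow> bool"
where
  "riemannian_metric A g \<longleftrightarrow>
     (\<forall>p. \<forall>u\<in>tangent_space A p. \<forall>v\<in>tangent_space A p. \<forall>w\<in>tangent_space A p. \<forall>a b.
        g p (a *\<^sub>R u + b *\<^sub>R v) w = a * g p u w + b * g p v w) \<and>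
     (\<forall>p. \<forall>u\<in>tangent_space A p. \<forall>v\<in>tangent_space A p. g p u v = g p v u) \<and>
     (\<forall>p. \<forall>u\<in>tangent_space A p. u \<noteq> 0 \<longrightarrow> g p u u > 0) \<and>
     (\<forall>U X Y. open U \<and> smooth_vfield_on A U X \<and> smooth_vfield_on A U Y \<longrightarrow>
        smooth_fun_on A U (\<lambda>p. g p (X p) (Y p)))"

definition affine_connection ::
  "('a::topological_space, 'e::euclidean_space) chart set \<Rightarrow>
    (('a, 'e) vfield \<Rightarrow> ('a, 'e) vfield \<Rightarrow> ('a, 'e) vfield) \<Rightarrow> bool"
where
  "affine_connection A nab \<longleftrightarrow>
     (\<forall>X\<in>vfields A. \<forall>Y\<in>vfields A. nab X Y \<in> vfields A) \<and>
     (\<forall>X\<in>vfields A. \<forall>Y\<in>vfields A. \<forall>Z\<in>vfields A.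
        nab (X + Y) Z = nab X Z + nab Y Z \<and>
        nab X (Y + Z) = nab X Y + nab X Z) \<and>
     (\<forall>X\<in>vfields A. \<forall>Y\<in>vfields A. \<forall>f. smooth_fun_on A UNIV f \<longrightarrow>
        nab (\<lambda>p. f p *\<^sub>R X p) Y = (\<lambda>p. f p *\<^sub>R nab X Y p) \<and>
        nab X (\<lambda>p. f p *\<^sub>R Y p) =
          (\<lambda>p. f p *\<^sub>R nab X Y p + dir_deriv A p (X p) f *\<^sub>R Y p))"

definition levi_civita ::
  "('a::topological_space, 'e::euclidean_space) chart set \<Rightarrow>
    ('a \<Rightarrow> ('a, 'e) tvec \<Rightarrow> ('a, 'e) tvec \<Rightarrow> real) \<Rightarrow>
    (('a, 'e) vfield \<Rightarrow> ('a, 'e) vfield \<Rightarrow> ('a, 'e) vfield) \<Rightarrow> bool"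
where
  "levi_civita A g nab \<longleftrightarrow>
     affine_connection A nab \<and>
     (\<forall>X\<in>vfields A. \<forall>Y\<in>vfields A. nab X Y - nab Y X = lie_bracket A X Y) \<and>
     (\<forall>X\<in>vfields A. \<forall>Y\<in>vfields A. \<forall>Z\<in>vfields A. \<forall>p.
        dir_deriv A p (X p) (\<lambda>q. g q (Y q) (Z q)) =
          g p (nab X Y p) (Z p) + g p (Y p) (nab X Z p))"


section \<open>Curves and geodesics\<close>

text \<open>On an interval that is not open, smoothness means that the coordinates of the curve extend
  smoothly beyond the end points.\<close>

definition smooth_curve ::
  "('a::topological_space, 'e::euclidean_space) chart set \<Rightarrow> real set \<Rightarrow> (real \<Rightarrow> 'a) \<Rightarrow> bool"
where
  "smooth_curve A I \<gamma> \<longleftrightarrow>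
     (\<forall>t\<in>I. \<forall>c\<in>A. \<gamma> t \<in> cdom c \<longrightarrow>
        (\<exists>e>0. \<exists>f. smooth_on f (ball t e) \<and>
           (\<forall>s\<in>I \<inter> ball t e. \<gamma> s \<in> cdom c \<and> cmap c (\<gamma> s) = f s)))"

definition velocity ::
  "('a::topological_space, 'e::euclidean_space) chart set \<Rightarrow> real set \<Rightarrow> (real \<Rightarrow> 'a) \<Rightarrow>
    real \<Rightarrow> ('a, 'e) tvec"
where
  "velocity A I \<gamma> t = (\<lambda>c.
     if c \<in> A \<and> \<gamma> t \<in> cdom c
     then vector_derivative (\<lambda>s. cmap c (\<gamma> s)) (at t within I)
     else 0)"

text \<open>The covariant derivative along \<open>\<gamma>\<close> is the operator on vector fields along \<open>\<gamma>\<close> which is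
  additive, obeys the Leibniz rule, and maps \<open>E \<circ> \<gamma>\<close> to \<open>\<nabla>\<^bsub>\<gamma>'\<^esub> E\<close>. Near \<open>t\<close>, every smooth
  \<open>V\<close> along \<open>\<gamma>\<close> is a combination \<open>\<Sum>j<n. f\<^sub>j (E\<^sub>j \<circ> \<gamma>)\<close> with smooth \<open>f\<^sub>j\<close> and vector fields
  \<open>E\<^sub>j\<close> on the manifold (for instance coordinate fields, cut off away from \<open>\<gamma> t\<close>), so these rules
  determine its value; the value does not depend on the combination.\<close>

definition cov_deriv_along ::
  "('a::topological_space, 'e::euclidean_space) chart set \<Rightarrow>
    (('a, 'e) vfield \<Rightarrow> ('a, 'e) vfield \<Rightarrow> ('a, 'e) vfield) \<Rightarrow>
    real set \<Rightarrow> (real \<Rightarrow> 'a) \<Rightarrow> (real \<Rightarrow> ('a, 'e) tvec) \<Rightarrow> real \<Rightarrow> ('a, 'e) tvec"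
where
  "cov_deriv_along A nab I \<gamma> V t = (THE w.
     \<exists>(n::nat) f E X. \<exists>e>0.
       X \<in> vfields A \<and> X (\<gamma> t) = velocity A I \<gamma> t \<and>
       (\<forall>j<n. E j \<in> vfields A \<and> smooth_on (f j) (ball t e)) \<and>
       (\<forall>s\<in>I \<inter> ball t e. V s = (\<Sum>j<n. f j s *\<^sub>R E j (\<gamma> s))) \<and>
       w = (\<Sum>j<n. deriv (f j) t *\<^sub>R E j (\<gamma> t) + f j t *\<^sub>R nab X (E j) (\<gamma> t)))"

definition geodesic ::
  "('a::topological_space, 'e::euclidean_space) chart set \<Rightarrow>
    (('a, 'e) vfield \<Rightarrow> ('a, 'e) vfield \<Rightarrow> ('a, 'e) vfield) \<Rightarrow>
    real set \<Rightarrow> (real \<Rightarrow> 'a) \<Rightarrow> bool"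
where
  "geodesic A nab I \<gamma> \<longleftrightarrow>
     is_interval I \<and> interior I \<noteq> {} \<and> smooth_curve A I \<gamma> \<and>
     (\<forall>t\<in>I. cov_deriv_along A nab I \<gamma> (velocity A I \<gamma>) t = 0)"


section \<open>Distributions\<close>

definition regular_distribution ::
  "('a::topological_space, 'e::euclidean_space) chart set \<Rightarrow> ('a \<Rightarrow> ('a, 'e) tvec set) \<Rightarrow> bool"
where
  "regular_distribution A D \<longleftrightarrow>
     (\<exists>k::nat. \<forall>p. \<exists>U E. open U \<and> p \<in> U \<and>
        (\<forall>i<k. smooth_vfield_on A U (E i)) \<and>
        (\<forall>q\<in>U. inj_on (\<lambda>i. E i q) {..<k} \<and> independent ((\<lambda>i. E i q) ` {..<k}) \<and>
           D q = span ((\<lambda>i. E i q) ` {..<k})))"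

definition sections ::
  "('a::topological_space, 'e::euclidean_space) chart set \<Rightarrow> ('a \<Rightarrow> ('a, 'e) tvec set) \<Rightarrow>
    ('a, 'e) vfield set"
  where "sections A D = {X \<in> vfields A. \<forall>p. X p \<in> D p}"

definition orth_compl ::
  "('a::topological_space, 'e::euclidean_space) chart set \<Rightarrow>
    ('a \<Rightarrow> ('a, 'e) tvec \<Rightarrow> ('a, 'e) tvec \<Rightarrow> real) \<Rightarrow>
    ('a \<Rightarrow> ('a, 'e) tvec set) \<Rightarrow> 'a \<Rightarrow> ('a, 'e) tvec set"
  where "orth_compl A g D p = {v \<in> tangent_space A p. \<forall>u\<in>D p. g p v u = 0}"

definition orth_proj ::
  "('a \<Rightarrow> ('a, 'e) tvec \<Rightarrow> ('a, 'e) tvec \<Rightarrow> real) \<Rightarrow>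
    ('a \<Rightarrow> ('a, 'e::euclidean_space) tvec set) \<Rightarrow> 'a \<Rightarrow> ('a, 'e) tvec \<Rightarrow> ('a, 'e) tvec"
  where "orth_proj g D p v = (THE u. u \<in> D p \<and> (\<forall>w\<in>D p. g p (v - u) w = 0))"

definition second_fund_form ::
  "('a::topological_space, 'e::euclidean_space) chart set \<Rightarrow>
    ('a \<Rightarrow> ('a, 'e) tvec \<Rightarrow> ('a, 'e) tvec \<Rightarrow> real) \<Rightarrow>
    (('a, 'e) vfield \<Rightarrow> ('a, 'e) vfield \<Rightarrow> ('a, 'e) vfield) \<Rightarrow>
    ('a \<Rightarrow> ('a, 'e) tvec set) \<Rightarrow> ('a, 'e) vfield \<Rightarrow> ('a, 'e) vfield \<Rightarrow> ('a, 'e) vfield"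
  where "second_fund_form A g nab D X Y = (\<lambda>p. orth_proj g (orth_compl A g D) p (nab X Y p))"

definition sym_second_fund_form ::
  "('a::topological_space, 'e::euclidean_space) chart set \<Rightarrow>
    ('a \<Rightarrow> ('a, 'e) tvec \<Rightarrow> ('a, 'e) tvec \<Rightarrow> real) \<Rightarrow>
    (('a, 'e) vfield \<Rightarrow> ('a, 'e) vfield \<Rightarrow> ('a, 'e) vfield) \<Rightarrow>
    ('a \<Rightarrow> ('a, 'e) tvec set) \<Rightarrow> ('a, 'e) vfield \<Rightarrow> ('a, 'e) vfield \<Rightarrow> ('a, 'e) vfield"
where
  "sym_second_fund_form A g nab D X Y =
     (1/2) *\<^sub>R (second_fund_form A g nab D X Y + second_fund_form A g nab D Y X)"

definition intrinsic_geodesic ::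
  "('a::topological_space, 'e::euclidean_space) chart set \<Rightarrow>
    ('a \<Rightarrow> ('a, 'e) tvec \<Rightarrow> ('a, 'e) tvec \<Rightarrow> real) \<Rightarrow>
    (('a, 'e) vfield \<Rightarrow> ('a, 'e) vfield \<Rightarrow> ('a, 'e) vfield) \<Rightarrow>
    ('a \<Rightarrow> ('a, 'e) tvec set) \<Rightarrow> real set \<Rightarrow> (real \<Rightarrow> 'a) \<Rightarrow> bool"
where
  "intrinsic_geodesic A g nab D I \<gamma> \<longleftrightarrow>
     is_interval I \<and> interior I \<noteq> {} \<and> smooth_curve A I \<gamma> \<and>
     (\<forall>t\<in>I. velocity A I \<gamma> t \<in> D (\<gamma> t)) \<and>
     (\<forall>t\<in>I. orth_proj g D (\<gamma> t) (cov_deriv_along A nab I \<gamma> (velocity A I \<gamma>) t) = 0)"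

definition totally_geodesic ::
  "('a::topological_space, 'e::euclidean_space) chart set \<Rightarrow>
    (('a, 'e) vfield \<Rightarrow> ('a, 'e) vfield \<Rightarrow> ('a, 'e) vfield) \<Rightarrow>
    ('a \<Rightarrow> ('a, 'e) tvec set) \<Rightarrow> bool"
where
  "totally_geodesic A nab D \<longleftrightarrow>
     (\<forall>I \<gamma>. geodesic A nab I \<gamma> \<longrightarrow>
        (\<forall>t0\<in>I. velocity A I \<gamma> t0 \<in> D (\<gamma> t0) \<longrightarrow>
           (\<forall>t\<in>I. velocity A I \<gamma> t \<in> D (\<gamma> t))))"

end

theory Submission
  imports Defs
begin

text \<open>
  For a section \<open>X\<close> of \<open>D\<close> and a field \<open>Z\<close> normal to \<open>D\<close>, metric compatibility gives
  \<open>g(\<nabla>\<^sub>X X, Z) = - g(X, \<nabla>\<^sub>X Z)\<close>, and along a curve whose velocity \<open>\<gamma>'\<close> stays in \<open>D\<close> it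
  gives \<open>g(\<nabla>\<^bsub>\<gamma>'\<^esub> \<gamma>', Z) = - g(\<gamma>', \<nabla>\<^bsub>\<gamma>'\<^esub> Z)\<close>. So along such a curve the normal part of the
  acceleration is that of \<open>\<nabla>\<^sub>X X\<close> for any section \<open>X\<close> extending \<open>\<gamma>'(t)\<close>. This turns (5) into
  (2), and conversely (1) and (2) into (5), once a geodesic, respectively an intrinsic geodesic,
  with a given initial velocity in \<open>D\<close> exists; both come from one system of ordinary
  differential equations for the coefficients of \<open>\<gamma>'\<close> in an orthogonal frame adapted to \<open>D\<close>.

  For (5) implies (1), let \<open>\<phi>\<^sub>l = g(\<gamma>', E\<^sub>l)\<close> be the normal components of the velocity of a
  geodesic. Then \<open>\<phi>\<^sub>l' = g(\<gamma>', \<nabla>\<^bsub>\<gamma>'\<^esub> E\<^sub>l)\<close> is quadratic in \<open>\<gamma>'\<close>, and by (5) its purely tangential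
  part vanishes, so \<open>|\<phi>'| \<le> C |\<phi>|\<close> locally. By Gronwall the set of times at which \<open>\<gamma>'\<close> lies in
  \<open>D\<close> is open, and it is closed by continuity. The equivalence of (3), (4) and (5) is polarization.
\<close>

section \<open>Calculus of smooth maps\<close>

text \<open>The connection \<open>nab\<close> acts on globally defined fields only, so a local frame
  cannot be differentiated as it stands. Frames are therefore cut off by bump functions into global
  fields that still lie in \<open>D\<close>, or are orthogonal to it, at every point. The product
  \<open>g q (X q) (Z q)\<close> of a section and a normal frame field then vanishes on the whole
  manifold and may be differentiated there. The cutoff destroys unit length, hence orthogonal frames
  instead of orthonormal ones, with coefficients divided by \<open>g q (E j q) (E j q)\<close>; this
  also keeps square roots out.

  The covariant derivative along a curve is a definite description and becomes usable only after a
  uniqueness proof. Pairing a candidate with a global field and differentiating along the curve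
  fixes all its inner products; the same formula later gives the differential equation of the normal
  components.

  Curves live on arbitrary intervals with nonempty interior, end points included. Derivatives are
  taken within the interval and are unique because such an interval has no isolated point.\<close>

lemma frechet_derivative_eqI: "(f has_derivative f') (at x) \<Longrightarrow> frechet_derivative f (at x) = f'"
  by (metis frechet_derivative_at)

lemma frechet_derivative_cong_open:
  assumes "open S" "x \<in> S" "\<And>y. y \<in> S \<Longrightarrow> f y = g y"
  shows "frechet_derivative f (at x) = frechet_derivative g (at x)"
    and "f differentiable (at x) \<longleftrightarrow> g differentiable (at x)"
proof -
  have *: "(f has_derivative d) (at x) \<longleftrightarrow> (g has_derivative d) (at x)" for d
    using assms by (metis has_derivative_transform_within_open)
  show "frechet_derivative f (at x) = frechet_derivative g (at x)"
    unfolding frechet_derivative_def * ..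
  show "f differentiable (at x) \<longleftrightarrow> g differentiable (at x)"
    unfolding differentiable_def * ..
qed

lemma Ck_on_cong:
  assumes "open S" "\<And>y. y \<in> S \<Longrightarrow> f y = g y"
  shows "Ck_on k f S \<longleftrightarrow> Ck_on k g S"
  using assms(2)
proof (induction k arbitrary: f g)
  case 0
  then show ?case by (auto cong: continuous_on_cong)
next
  case (Suc k)
  have "frechet_derivative f (at x) = frechet_derivative g (at x)"
    "f differentiable (at x) \<longleftrightarrow> g differentiable (at x)" if "x \<in> S" for x
    using frechet_derivative_cong_open[OF assms(1) that, of f g] Suc.prems by auto
  then show ?case
    using Suc.IH[of "\<lambda>x. frechet_derivative f (at x) v" "\<lambda>x. frechet_derivative g (at x) v" for v]
    by auto
qed

lemma Ck_on_subset: "Ck_on k f S \<Longrightarrow> T \<subseteq> S \<Longrightarrow> Ck_on k f T"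
  by (induction k arbitrary: f) (auto intro: continuous_on_subset)

lemma Ck_on_local:
  assumes "\<And>x. x \<in> S \<Longrightarrow> \<exists>T. open T \<and> x \<in> T \<and> Ck_on k f T"
  shows "Ck_on k f S"
  using assms
proof (induction k arbitrary: f)
  case 0
  have "continuous (at x) f" if "x \<in> S" for x
    using 0[OF that] by (auto simp: continuous_on_eq_continuous_at)
  then show ?case
    by (auto intro: continuous_at_imp_continuous_on)
next
  case (Suc k)
  show ?case
    using Suc.prems by (fastforce intro: Suc.IH)
qed

text \<open>\<open>frechet_derivative\<close> is a choice operator. Over an open set any exhibited
  derivative may take its place, which spares the later inductions from evaluating it.\<close>

lemma Ck_on_SucI:
  assumes "open S" "\<And>x. x \<in> S \<Longrightarrow> (f has_derivative f' x) (at x)" "\<And>v. Ck_on k (\<lambda>x. f' x v) S"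
  shows "Ck_on (Suc k) f S"
proof -
  have "Ck_on k (\<lambda>x. frechet_derivative f (at x) v) S \<longleftrightarrow> Ck_on k (\<lambda>x. f' x v) S" for v
    by (rule Ck_on_cong[OF assms(1)]) (simp add: frechet_derivative_eqI[OF assms(2)])
  then show ?thesis
    using assms by (auto simp: differentiable_def)
qed

lemma Ck_on_Suc_has_derivative:
  "Ck_on (Suc k) f S \<Longrightarrow> x \<in> S \<Longrightarrow> (f has_derivative frechet_derivative f (at x)) (at x)"
  by (simp add: frechet_derivative_works)

lemma Ck_on_SucD: "Ck_on (Suc k) f S \<Longrightarrow> Ck_on k f S"
proof (induction k arbitrary: f)
  case 0
  then show ?case
    by (auto intro!: continuous_at_imp_continuous_on differentiable_imp_continuous_within)
next
  case (Suc k)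
  then show ?case
    unfolding Ck_on.simps(2)[of "Suc k"] by auto
qed

lemma Ck_on_const: "Ck_on k (\<lambda>x. c) S"
  by (induction k arbitrary: c) (auto simp: frechet_derivative_const)

lemma Ck_on_add:
  assumes "open S"
  shows "Ck_on k f S \<Longrightarrow> Ck_on k g S \<Longrightarrow> Ck_on k (\<lambda>x. f x + g x) S"
proof (induction k arbitrary: f g)
  case 0
  then show ?case by (auto intro: continuous_intros)
next
  case (Suc k)
  show ?case
    by (rule Ck_on_SucI[OF assms])
      (auto intro!: has_derivative_add Ck_on_Suc_has_derivative[OF Suc.prems(1)]
        Ck_on_Suc_has_derivative[OF Suc.prems(2)] Suc.IH simp: Suc.prems[unfolded Ck_on.simps])
qed

lemma Ck_on_sum:
  assumes "open S" "\<And>i. i \<in> I \<Longrightarrow> Ck_on k (f i) S"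
  shows "Ck_on k (\<lambda>x. \<Sum>i\<in>I. f i x) S"
  using assms(2)
  by (induction I rule: infinite_finite_induct) (auto intro!: Ck_on_add Ck_on_const assms(1))

lemma Ck_on_linear:
  assumes "open S" "bounded_linear L"
  shows "Ck_on k f S \<Longrightarrow> Ck_on k (\<lambda>x. L (f x)) S"
proof (induction k arbitrary: f)
  case 0
  then show ?case
    using assms by (auto intro: linear_continuous_on_compose simp: bounded_linear.linear
      bounded_linear.continuous_on)
next
  case (Suc k)
  show ?case
    by (rule Ck_on_SucI[OF assms(1)])
      (auto intro!: bounded_linear.has_derivative[OF assms(2)] 
        Ck_on_Suc_has_derivative[OF Suc.prems] Suc.IH simp: Suc.prems[unfolded Ck_on.simps])
qed

lemma Ck_on_id:
  assumes "open S"
  shows "Ck_on k (\<lambda>x. x) S"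
proof (cases k)
  case (Suc m)
  show ?thesis
    unfolding Suc
    by (rule Ck_on_SucI[OF assms]) (auto intro: has_derivative_ident Ck_on_const)
qed auto

lemma Ck_on_bilinear:
  assumes "open S" "bounded_bilinear B"
  shows "Ck_on k f S \<Longrightarrow> Ck_on k g S \<Longrightarrow> Ck_on k (\<lambda>x. B (f x) (g x)) S"
proof (induction k arbitrary: f g)
  case 0
  then show ?case
    using bounded_bilinear.continuous_on[OF assms(2)] by auto
next
  case (Suc k)
  show ?case
  proof (rule Ck_on_SucI[OF assms(1)])
    fix x assume "x \<in> S"
    then show "((\<lambda>x. B (f x) (g x)) has_derivative
      (\<lambda>v. B (f x) (frechet_derivative g (at x) v) + B (frechet_derivative f (at x) v) (g x))) (at x)"
      by (intro bounded_bilinear.FDERIV[OF assms(2)] Ck_on_Suc_has_derivative[OF Suc.prems(1)]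
        Ck_on_Suc_has_derivative[OF Suc.prems(2)])
  next
    fix v
    show "Ck_on k (\<lambda>x. B (f x) (frechet_derivative g (at x) v) + B (frechet_derivative f (at x) v) (g x)) S"
      by (intro Ck_on_add assms Suc.IH Ck_on_SucD[OF Suc.prems(1)] Ck_on_SucD[OF Suc.prems(2)])
        (use Suc.prems in auto)
  qed
qed

text \<open>\<open>Ck_on\<close> differentiates in a fixed direction, whereas the chain rule
  differentiates \<open>f\<close> in the direction \<open>frechet_derivative g (at x) v\<close>,
  which moves with \<open>x\<close>. Expanding that direction in \<open>Basis\<close> leaves scalar
  functions times derivatives of \<open>f\<close> in constant directions, composed with the same
  \<open>g\<close>; the induction hypothesis, general in \<open>f\<close>, covers these.\<close>

lemma Ck_on_compose:
  fixes f :: "'b::euclidean_space \<Rightarrow> 'c::real_normed_vector"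
  assumes "open S"
  shows "Ck_on k f T \<Longrightarrow> Ck_on k g S \<Longrightarrow> g ` S \<subseteq> T \<Longrightarrow> Ck_on k (\<lambda>x. f (g x)) S"
proof (induction k arbitrary: f)
  case 0
  then show ?case
    by (auto intro: continuous_on_compose2)
next
  case (Suc k)
  let ?D = "\<lambda>x v. \<Sum>b\<in>Basis. (frechet_derivative g (at x) v \<bullet> b) *\<^sub>R frechet_derivative f (at (g x)) b"
  show ?case
  proof (rule Ck_on_SucI[OF assms])
    fix x assume x: "x \<in> S"
    then have gx: "g x \<in> T"
      using Suc.prems by auto
    have lin: "linear (frechet_derivative f (at (g x)))"
      using Suc.prems(1) gx by (auto intro: linear_frechet_derivative)
    have rep: "frechet_derivative f (at (g x)) w = (\<Sum>b\<in>Basis. (w \<bullet> b) *\<^sub>R frechet_derivative f (at (g x)) b)" for w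
      by (subst euclidean_representation[symmetric, of w])
        (simp only: linear_sum[OF lin] linear_cmul[OF lin])
    then have "?D x = (\<lambda>v. frechet_derivative f (at (g x)) (frechet_derivative g (at x) v))"
      by (simp add: fun_eq_iff flip: rep)
    then show "((\<lambda>x. f (g x)) has_derivative ?D x) (at x)"
      using has_derivative_compose[OF Ck_on_Suc_has_derivative[OF Suc.prems(2) x]
        Ck_on_Suc_has_derivative[OF Suc.prems(1) gx]] by simp
  next
    fix v
    have "Ck_on k (\<lambda>x. frechet_derivative f (at (g x)) b) S" for b
      by (rule Suc.IH[OF _ Ck_on_SucD[OF Suc.prems(2)] Suc.prems(3)]) (use Suc.prems in auto)
    moreover have "Ck_on k (\<lambda>x. frechet_derivative g (at x) v \<bullet> b) S" for b
      by (rule Ck_on_linear[OF assms]) (use Suc.prems in \<open>auto intro: bounded_linear_intros\<close>)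
    ultimately show "Ck_on k (\<lambda>x. ?D x v) S"
      by (intro Ck_on_sum assms Ck_on_bilinear[OF _ bounded_bilinear_scaleR])
  qed
qed

lemma Ck_on_inverse:
  fixes f :: "'b::real_normed_vector \<Rightarrow> real"
  assumes "open S" "\<And>x. x \<in> S \<Longrightarrow> f x \<noteq> 0"
  shows "Ck_on k f S \<Longrightarrow> Ck_on k (\<lambda>x. inverse (f x)) S"
proof (induction k)
  case 0
  then show ?case
    using assms by (auto intro!: continuous_intros)
next
  case (Suc k)
  show ?case
  proof (rule Ck_on_SucI[OF assms(1)])
    fix x assume x: "x \<in> S"
    then show "((\<lambda>x. inverse (f x)) has_derivative
        (\<lambda>v. (- 1) * (inverse (f x) * frechet_derivative f (at x) v * inverse (f x)))) (at x)"
      using has_derivative_inverse'[of "f x" ] assms(2)[OF x] Ck_on_Suc_has_derivative[OF Suc.prems x]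
      by (auto intro!: derivative_eq_intros)
  next
    fix v
    \<comment> \<open>The derivative contains \<open>inverse (f x)\<close> itself, so the hypothesis
      is applied to the same \<open>f\<close>, one order lower.\<close>
    note IH = Suc.IH[OF Ck_on_SucD[OF Suc.prems]]
    have "Ck_on k (\<lambda>x. frechet_derivative f (at x) v) S"
      using Suc.prems by simp
    then show "Ck_on k (\<lambda>x. (- 1) * (inverse (f x) * frechet_derivative f (at x) v * inverse (f x))) S"
      by (intro Ck_on_bilinear[OF _ bounded_bilinear_mult] Ck_on_const assms IH)
  qed
qed

text \<open>In one variable the derivative in direction \<open>v\<close> is a multiple of
  \<open>f'\<close>, so one function controls all directions. The functions \<open>flat n\<close>
  and the solutions of differential equations gain their orders of smoothness one at a time this
  way.\<close>

lemma Ck_on_Suc_vector_derivative: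
  fixes f :: "real \<Rightarrow> 'b::real_normed_vector"
  assumes "open S" "\<And>x. x \<in> S \<Longrightarrow> (f has_vector_derivative f' x) (at x)" "Ck_on k f' S"
  shows "Ck_on (Suc k) f S"
  by (rule Ck_on_SucI[OF assms(1) assms(2)[unfolded has_vector_derivative_def]])
    (auto intro!: Ck_on_bilinear[OF assms(1) bounded_bilinear_scaleR] Ck_on_const assms)

section \<open>Smoothness of all orders\<close>

lemma smooth_on_cong: "open S \<Longrightarrow> (\<And>y. y \<in> S \<Longrightarrow> f y = g y) \<Longrightarrow> smooth_on f S \<longleftrightarrow> smooth_on g S"
  unfolding smooth_on_def using Ck_on_cong by blast

lemma smooth_on_subset: "smooth_on f S \<Longrightarrow> T \<subseteq> S \<Longrightarrow> smooth_on f T"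
  unfolding smooth_on_def using Ck_on_subset by blast

lemma smooth_on_local:
  "(\<And>x. x \<in> S \<Longrightarrow> \<exists>T. open T \<and> x \<in> T \<and> smooth_on f T) \<Longrightarrow> smooth_on f S"
  unfolding smooth_on_def by (meson Ck_on_local)

lemma smooth_on_const: "smooth_on (\<lambda>x. c) S"
  unfolding smooth_on_def by (simp add: Ck_on_const)

lemma smooth_on_id: "open S \<Longrightarrow> smooth_on (\<lambda>x. x) S"
  unfolding smooth_on_def by (simp add: Ck_on_id)

lemma smooth_on_add: "open S \<Longrightarrow> smooth_on f S \<Longrightarrow> smooth_on g S \<Longrightarrow> smooth_on (\<lambda>x. f x + g x) S"
  unfolding smooth_on_def by (simp add: Ck_on_add)

lemma smooth_on_sum:
  "open S \<Longrightarrow> (\<And>i. i \<in> I \<Longrightarrow> smooth_on (f i) S) \<Longrightarrow> smooth_on (\<lambda>x. \<Sum>i\<in>I. f i x) S"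
  unfolding smooth_on_def by (simp add: Ck_on_sum)

lemma smooth_on_linear:
  "bounded_linear L \<Longrightarrow> open S \<Longrightarrow> smooth_on f S \<Longrightarrow> smooth_on (\<lambda>x. L (f x)) S"
  unfolding smooth_on_def by (simp add: Ck_on_linear)

lemma smooth_on_bilinear:
  "bounded_bilinear B \<Longrightarrow> open S \<Longrightarrow> smooth_on f S \<Longrightarrow> smooth_on g S \<Longrightarrow> smooth_on (\<lambda>x. B (f x) (g x)) S"
  unfolding smooth_on_def by (simp add: Ck_on_bilinear)

lemmas smooth_on_scaleR = smooth_on_bilinear[OF bounded_bilinear_scaleR]
lemmas smooth_on_mult = smooth_on_bilinear[OF bounded_bilinear_mult]
lemmas smooth_on_inner = smooth_on_bilinear[OF bounded_bilinear_inner]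

lemma smooth_on_compose:
  fixes f :: "'b::euclidean_space \<Rightarrow> 'c::real_normed_vector"
  shows "smooth_on f T \<Longrightarrow> open S \<Longrightarrow> smooth_on g S \<Longrightarrow> g ` S \<subseteq> T \<Longrightarrow> smooth_on (\<lambda>x. f (g x)) S"
  unfolding smooth_on_def using Ck_on_compose by blast

lemma smooth_on_inverse:
  fixes f :: "'b::real_normed_vector \<Rightarrow> real"
  shows "open S \<Longrightarrow> (\<And>x. x \<in> S \<Longrightarrow> f x \<noteq> 0) \<Longrightarrow> smooth_on f S \<Longrightarrow> smooth_on (\<lambda>x. inverse (f x)) S"
  unfolding smooth_on_def by (simp add: Ck_on_inverse)

lemma smooth_on_minus: "open S \<Longrightarrow> smooth_on f S \<Longrightarrow> smooth_on (\<lambda>x. - f x) S"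
  using smooth_on_linear[OF bounded_linear_minus[OF bounded_linear_ident]] by blast

lemma smooth_on_diff: "open S \<Longrightarrow> smooth_on f S \<Longrightarrow> smooth_on g S \<Longrightarrow> smooth_on (\<lambda>x. f x - g x) S"
  using smooth_on_add[of S f "\<lambda>x. - g x"] smooth_on_minus[of S g] by simp

lemma smooth_on_divide:
  fixes f g :: "'b::real_normed_vector \<Rightarrow> real"
  shows "open S \<Longrightarrow> (\<And>x. x \<in> S \<Longrightarrow> g x \<noteq> 0) \<Longrightarrow> smooth_on f S \<Longrightarrow> smooth_on g S \<Longrightarrow>
    smooth_on (\<lambda>x. f x / g x) S"
  unfolding divide_inverse by (intro smooth_on_mult smooth_on_inverse)

lemma smooth_on_Pair:
  fixes f :: "'b::real_normed_vector \<Rightarrow> 'c::real_normed_vector" and g :: "'b \<Rightarrow> 'd::real_normed_vector"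
  assumes "open S" "smooth_on f S" "smooth_on g S"
  shows "smooth_on (\<lambda>x. (f x, g x)) S"
proof -
  have "bounded_linear (\<lambda>y::'c. (y, 0::'d))" "bounded_linear (\<lambda>y::'d. (0::'c, y))"
    by (auto intro!: bounded_linear_Pair bounded_linear_ident bounded_linear_zero)
  then have "smooth_on (\<lambda>x. (f x, 0) + (0, g x)) S"
    by (intro smooth_on_add smooth_on_linear[where L="\<lambda>y. (y, 0)"] smooth_on_linear[where L="\<lambda>y. (0, y)"] assms)
  then show ?thesis
    by simp
qed

lemma smooth_on_has_derivative:
  "smooth_on f S \<Longrightarrow> x \<in> S \<Longrightarrow> (f has_derivative frechet_derivative f (at x)) (at x)"
  unfolding smooth_on_def using Ck_on_Suc_has_derivative by blast

lemma smooth_on_frechet_derivative: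
  "smooth_on f S \<Longrightarrow> smooth_on (\<lambda>x. frechet_derivative f (at x) v) S"
  unfolding smooth_on_def by (metis Ck_on.simps(2))

lemma smooth_on_continuous_on: "smooth_on f S \<Longrightarrow> continuous_on S f"
  unfolding smooth_on_def by (metis Ck_on.simps(1))

lemma smooth_on_has_vector_derivative:
  assumes "smooth_on f S" "x \<in> S"
  shows "(f has_vector_derivative frechet_derivative f (at x) 1) (at x)"
proof -
  note der = smooth_on_has_derivative[OF assms]
  have "frechet_derivative f (at x) v = v *\<^sub>R frechet_derivative f (at x) 1" for v
    using linear_cmul[OF has_derivative_linear[OF der], of v 1] by simp
  then have "frechet_derivative f (at x) = (\<lambda>v. v *\<^sub>R frechet_derivative f (at x) 1)"
    by blast
  then show ?thesis
    unfolding has_vector_derivative_def using der by simp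
qed

section \<open>A smooth function vanishing exactly on a half line\<close>

lemma exp_inverse_limit: "((\<lambda>x::real. inverse x ^ n * exp (- inverse x)) \<longlongrightarrow> 0) (at_right 0)"
proof -
  have "((\<lambda>y::real. y ^ n / exp y) \<longlongrightarrow> 0) at_top"
    by (rule tendsto_power_div_exp_0)
  then have "((\<lambda>x::real. inverse x ^ n / exp (inverse x)) \<longlongrightarrow> 0) (at_right 0)"
    by (rule filterlim_compose[OF _ filterlim_inverse_at_top_right])
  then show ?thesis
    by (simp add: exp_minus divide_inverse)
qed

text \<open>\<open>flat 0\<close> is the classical exp(-1/x) extended by 0. Powers of 1/x are
  included because differentiation leads out of \<open>flat 0\<close> but not out of the family, so
  one induction treats all members.\<close>

definition flat :: "nat \<Rightarrow> real \<Rightarrow> real"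
  where "flat n x = (if x > 0 then inverse x ^ n * exp (- inverse x) else 0)"

lemma flat_tendsto_0: "(flat n \<longlongrightarrow> 0) (at 0)"
proof -
  have "(flat n \<longlongrightarrow> 0) (at_right 0)"
    by (rule Lim_transform_eventually[OF exp_inverse_limit[of n]])
      (auto simp: flat_def eventually_at_right_less eventually_at_filter)
  moreover have "(flat n \<longlongrightarrow> 0) (at_left 0)"
    by (rule Lim_transform_eventually[OF tendsto_const])
      (auto simp: flat_def eventually_at_filter)
  ultimately show ?thesis
    by (simp add: filterlim_split_at)
qed

lemma flat_has_derivative:
  "(flat n has_real_derivative (flat (n + 2) x - real n * flat (n + 1) x)) (at x)"
proof (cases x "0::real" rule: linorder_cases)
  case less
  have "(flat n has_real_derivative 0) (at x)"
    by (rule has_field_derivative_transform_within_open[of "\<lambda>x. 0" _ _ "{..<0}"])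
      (use less in \<open>auto simp: flat_def\<close>)
  then show ?thesis
    using less by (simp add: flat_def)
next
  case equal
  \<comment> \<open>The difference quotient at 0 is again a member of the family, and every member
    tends to 0 there.\<close>
  have "flat n y / y = flat (n + 1) y" for y
    by (simp add: flat_def field_simps)
  then have "((\<lambda>y. (flat n y - flat n 0) / (y - 0)) \<longlongrightarrow> 0) (at 0)"
    using flat_tendsto_0[of "n + 1"] by (simp add: flat_def[of n 0])
  then show ?thesis
    using equal by (simp add: has_field_derivative_iff flat_def)
next
  case greater
  note d = DERIV_inverse[of x]
  have pow: "((\<lambda>x. inverse x ^ n) has_real_derivative - (real n * inverse x ^ (n + 1))) (at x)"
    using DERIV_power[OF d, of n] greater by (cases n) (simp_all add: algebra_simps)
  have ex: "((\<lambda>x. exp (- inverse x)) has_real_derivative exp (- inverse x) * inverse x ^ 2) (at x)"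
    using DERIV_chain2[OF DERIV_exp DERIV_minus[OF d]] greater
    by (simp add: power2_eq_square[of "inverse x"] del: power_inverse)
  have "((\<lambda>x. inverse x ^ n * exp (- inverse x)) has_real_derivative
      (inverse x ^ (n + 2) * exp (- inverse x) - real n * (inverse x ^ (n + 1) * exp (- inverse x)))) (at x)"
    by (rule DERIV_cong[OF DERIV_mult[OF pow ex]]) (simp add: algebra_simps power_add power2_eq_square)
  then have "(flat n has_real_derivative
      (inverse x ^ (n + 2) * exp (- inverse x) - real n * (inverse x ^ (n + 1) * exp (- inverse x)))) (at x)"
    by (rule has_field_derivative_transform_within_open[of _ _ _ "{0<..}"])
      (use greater in \<open>auto simp: flat_def\<close>)
  then show ?thesis
    using greater by (simp add: flat_def)
qed

lemma Ck_on_flat: "Ck_on k (flat n) UNIV"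
proof (induction k arbitrary: n)
  case 0
  then show ?case
    using DERIV_isCont[OF flat_has_derivative] by (simp add: continuous_at_imp_continuous_on)
next
  case (Suc k)
  have "Ck_on k (\<lambda>x. flat (n + 2) x + (- real n) * flat (n + 1) x) UNIV"
    by (intro Ck_on_add Ck_on_bilinear[OF _ bounded_bilinear_mult] Ck_on_const Suc open_UNIV)
  then show ?case
    using flat_has_derivative
    by (intro Ck_on_Suc_vector_derivative[of _ _ "\<lambda>x. flat (n + 2) x - real n * flat (n + 1) x"])
      (auto simp: has_real_derivative_iff_has_vector_derivative)
qed

lemma smooth_bump:
  fixes x0 :: "'b::euclidean_space"
  assumes "r > 0"
  obtains f :: "'b \<Rightarrow> real" where "smooth_on f UNIV" "\<And>x. f x > 0 \<longleftrightarrow> x \<in> ball x0 r" "\<And>x. f x \<ge> 0"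
proof
  \<comment> \<open>The squared distance is a polynomial, so the centre, where the norm is not
    differentiable, causes no trouble.\<close>
  let ?f = "\<lambda>x. flat 0 (r\<^sup>2 - (x - x0) \<bullet> (x - x0))"
  show "smooth_on ?f UNIV"
    by (rule smooth_on_compose[of "flat 0" UNIV])
      (auto simp: smooth_on_def[of "flat 0"] Ck_on_flat
        intro!: smooth_on_diff smooth_on_inner smooth_on_const smooth_on_id)
  show "?f x > 0 \<longleftrightarrow> x \<in> ball x0 r" for x
  proof -
    have "(x - x0) \<bullet> (x - x0) < r\<^sup>2 \<longleftrightarrow> norm (x - x0) < r"
      using assms abs_le_square_iff[of r "norm (x - x0)"]
      by (simp add: power2_norm_eq_inner linorder_not_le[symmetric])
    then show ?thesis
      by (auto simp: flat_def dist_norm norm_minus_commute)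
  qed
  show "?f x \<ge> 0" for x
    by (simp add: flat_def)
qed

section \<open>Ordinary differential equations\<close>

text \<open>Supplies both estimates of the existence proof: the contraction constant of the Picard
  operator and the confinement of the solution to a ball.\<close>

lemma norm_le_of_vector_derivative_bound:
  fixes u :: "real \<Rightarrow> 'b::real_normed_vector"
  assumes "\<And>s. s \<in> {-h..h} \<Longrightarrow> (u has_vector_derivative u' s) (at s within {-h..h})"
    and "\<And>s. s \<in> {-h..h} \<Longrightarrow> norm (u' s) \<le> C" "u 0 = 0" "t \<in> {-h..h}"
  shows "norm (u t) \<le> C * h"
proof -
  have h: "0 \<le> h" and C: "0 \<le> C"
    using assms(2)[OF assms(4)] assms(4) norm_ge_zero order_trans by (force, blast)
  have "norm (u t - u 0) \<le> C * norm (t - 0)"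
  proof (rule differentiable_bound[where S = "{-h..h}"])
    show "(u has_derivative (\<lambda>d. d *\<^sub>R u' s)) (at s within {-h..h})" if "s \<in> {-h..h}" for s
      using assms(1)[OF that] by (simp add: has_vector_derivative_def)
    show "onorm (\<lambda>d. d *\<^sub>R u' s) \<le> C" if "s \<in> {-h..h}" for s
      by (rule onorm_bound[OF C]) (simp add: mult.commute[of C] mult_left_mono assms(2)[OF that])
  qed (use assms(4) h in auto)
  also have "\<dots> \<le> C * h"
    using assms(4) C by (intro mult_left_mono) auto
  finally show ?thesis
    by (simp add: assms(3))
qed

text \<open>A Lipschitz bound on the whole space lets the Picard operator act on all bounded
  continuous functions, with no invariant ball to maintain. It contracts by the factor
  \<open>L * h\<close> in the supremum norm.\<close>

lemma picard_lindelof_global: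
  fixes G :: "'b::euclidean_space \<Rightarrow> 'b"
  assumes L: "\<And>x y. dist (G x) (G y) \<le> L * dist x y" "0 \<le> L" and h: "0 < h" "L * h < 1"
  obtains x where "x 0 = x0"
    and "\<And>t. t \<in> {-h..h} \<Longrightarrow> (x has_vector_derivative G (x t)) (at t within {-h..h})"
proof -
  have contG: "continuous_on UNIV G"
    by (rule lipschitz_on_continuous_on[of L]) (use L in \<open>auto simp: lipschitz_on_def\<close>)
  \<comment> \<open>The signed integral of \<open>u\<close> from 0 to \<open>t\<close>, in a form
    that includes negative \<open>t\<close>.\<close>
  define J where "J u t = integral {-h..t} u - integral {-h..0} u" for u :: "real \<Rightarrow> 'b" and t
  \<comment> \<open>Clamping the time to the interval lets the fixed point live in the complete
    space of bounded continuous functions on the whole real line.\<close>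
  define cl where "cl t = max (-h) (min h t)" for t
  have cl: "cl t \<in> {-h..h}" for t
    using h by (auto simp: cl_def)
  have J0: "J u 0 = 0" for u
    by (simp add: J_def)
  have J': "(J u has_vector_derivative u t) (at t within {-h..h})"
    if "continuous_on {-h..h} u" "t \<in> {-h..h}" for u t
    unfolding J_def using integral_has_vector_derivative[OF that]
    by (auto intro!: derivative_eq_intros)
  define T where "T f = (\<lambda>t. x0 + J (\<lambda>s. G (apply_bcontfun f s)) (cl t))" for f :: "real \<Rightarrow>\<^sub>C 'b"
  have contGf: "continuous_on S (\<lambda>s. G (apply_bcontfun f s))" for S and f :: "real \<Rightarrow>\<^sub>C 'b"
    by (rule continuous_on_compose2[OF contG]) auto
  have T: "T f \<in> bcontfun" for f
  proof -
    have J: "continuous_on {-h..h} (\<lambda>t. x0 + J (\<lambda>s. G (apply_bcontfun f s)) t)"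
      using has_vector_derivative_continuous[OF J'[OF contGf]]
      by (intro continuous_intros) (simp add: continuous_on_eq_continuous_within)
    have "continuous_on UNIV cl"
      unfolding cl_def by (intro continuous_intros)
    then have "continuous_on UNIV (T f)"
      unfolding T_def by (rule continuous_on_compose2[OF J]) (use cl in auto)
    moreover have "bounded ((\<lambda>t. x0 + J (\<lambda>s. G (apply_bcontfun f s)) t) ` {-h..h})"
      by (intro compact_imp_bounded compact_continuous_image J compact_Icc)
    then have "bounded (range (T f))"
      by (rule bounded_subset) (use cl in \<open>auto simp: T_def\<close>)
    ultimately show ?thesis
      by (simp add: bcontfun_def)
  qed
  have "\<exists>!f. Bcontfun (T f) = f"
  proof (rule banach_fix_type[of "L * h"], safe)
    show "0 \<le> L * h" "L * h < 1"
      using L h by auto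
    fix f g :: "real \<Rightarrow>\<^sub>C 'b"
    show "dist (Bcontfun (T f)) (Bcontfun (T g)) \<le> L * h * dist f g"
    proof (rule dist_bound)
      fix t
      have "norm (J (\<lambda>s. G (apply_bcontfun f s)) (cl t) - J (\<lambda>s. G (apply_bcontfun g s)) (cl t))
        \<le> (L * dist f g) * h"
      proof (rule norm_le_of_vector_derivative_bound)
        fix s assume s: "s \<in> {-h..h}"
        show "((\<lambda>t. J (\<lambda>s. G (apply_bcontfun f s)) t - J (\<lambda>s. G (apply_bcontfun g s)) t)
          has_vector_derivative (G (apply_bcontfun f s) - G (apply_bcontfun g s))) (at s within {-h..h})"
          by (intro has_vector_derivative_diff J' contGf s)
        have "norm (G (apply_bcontfun f s) - G (apply_bcontfun g s)) \<le> L * dist (apply_bcontfun f s) (apply_bcontfun g s)"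
          using L(1) by (simp add: dist_norm)
        also have "\<dots> \<le> L * dist f g"
          by (intro mult_left_mono dist_bounded L)
        finally show "norm (G (apply_bcontfun f s) - G (apply_bcontfun g s)) \<le> L * dist f g" .
      qed (use cl J0 in auto)
      then show "dist (apply_bcontfun (Bcontfun (T f)) t) (apply_bcontfun (Bcontfun (T g)) t) \<le> L * h * dist f g"
        by (simp add: Bcontfun_inverse T dist_norm, simp add: T_def mult_ac)
    qed
  qed
  then obtain f where "Bcontfun (T f) = f"
    by blast
  then have f: "apply_bcontfun f = T f"
    by (metis Bcontfun_inverse T)
  show ?thesis
  proof
    have "cl 0 = 0"
      using h by (simp add: cl_def)
    then show "apply_bcontfun f 0 = x0"
      by (subst f) (simp add: T_def J0)
    fix t assume t: "t \<in> {-h..h}"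
    have "((\<lambda>t. x0 + J (\<lambda>s. G (apply_bcontfun f s)) t) has_vector_derivative G (apply_bcontfun f t))
        (at t within {-h..h})"
      using J'[OF contGf t, of f] by (auto intro!: derivative_eq_intros)
    then show "(apply_bcontfun f has_vector_derivative G (apply_bcontfun f t)) (at t within {-h..h})"
      by (rule has_vector_derivative_transform[OF t, rotated]) (subst f, simp add: T_def cl_def)
  qed
qed

text \<open>The partial derivatives are bounded on a compact ball, the sum of their bounds dominates
  the operator norm, and the ball is convex, so the mean value inequality applies.\<close>

lemma smooth_on_locally_lipschitz:
  fixes F :: "'b::euclidean_space \<Rightarrow> 'c::real_normed_vector"
  assumes "open S" "x0 \<in> S" "smooth_on F S"
  obtains r L where "r > 0" "cball x0 r \<subseteq> S" "L \<ge> 0"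
    "\<And>x y. x \<in> cball x0 r \<Longrightarrow> y \<in> cball x0 r \<Longrightarrow> dist (F x) (F y) \<le> L * dist x y"
proof -
  obtain r where r: "r > 0" "cball x0 r \<subseteq> S"
    using assms(1,2) open_contains_cball by blast
  have "\<exists>B. \<forall>x\<in>cball x0 r. norm (frechet_derivative F (at x) b) \<le> B" for b
  proof -
    have "continuous_on (cball x0 r) (\<lambda>x. frechet_derivative F (at x) b)"
      using assms(3) r smooth_on_continuous_on smooth_on_frechet_derivative continuous_on_subset by blast
    then have "bounded ((\<lambda>x. frechet_derivative F (at x) b) ` cball x0 r)"
      by (intro compact_imp_bounded compact_continuous_image) auto
    then show ?thesis
      by (auto simp: bounded_iff)
  qed
  then obtain B where B: "\<And>b x. x \<in> cball x0 r \<Longrightarrow> norm (frechet_derivative F (at x) b) \<le> B b"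
    by metis
  define L where "L = (\<Sum>b\<in>Basis. B b)"
  have "norm (F x - F y) \<le> L * norm (x - y)" if "x \<in> cball x0 r" "y \<in> cball x0 r" for x y
  proof (rule differentiable_bound[OF convex_cball])
    fix z assume z: "z \<in> cball x0 r"
    then have der: "(F has_derivative frechet_derivative F (at z)) (at z)"
      using smooth_on_has_derivative[OF assms(3)] r by auto
    then show "(F has_derivative frechet_derivative F (at z)) (at z within cball x0 r)"
      by (rule has_derivative_at_withinI)
    show "onorm (frechet_derivative F (at z)) \<le> L"
      unfolding L_def
      by (intro onorm_componentwise_le sum_mono has_derivative_bounded_linear[OF der] B z)
  qed (use that in auto)
  moreover have "L \<ge> 0"
  proof -
    have "0 \<le> B b" for b
      using order_trans[OF norm_ge_zero B[of x0 b]] r by simp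
    then show ?thesis
      by (simp add: L_def sum_nonneg)
  qed
  ultimately show ?thesis
    using r that by (simp add: dist_norm)
qed

text \<open>Composing \<open>F\<close> with the nearest-point projection onto a ball, which is
  1-Lipschitz, makes it globally Lipschitz without changing it on the ball. The time
  \<open>h\<close> is too short for the solution to leave the ball, so it solves the original
  equation.\<close>

theorem smooth_ode_solution:
  fixes F :: "'b::euclidean_space \<Rightarrow> 'b"
  assumes "open S" "x0 \<in> S" "smooth_on F S"
  obtains h x where "h > 0" "x 0 = x0" "smooth_on x {-h<..<h}"
    "\<And>t. t \<in> {-h<..<h} \<Longrightarrow> x t \<in> S"
    "\<And>t. t \<in> {-h<..<h} \<Longrightarrow> (x has_vector_derivative F (x t)) (at t)"
proof -
  obtain r L where r: "r > 0" "cball x0 r \<subseteq> S" and L: "L \<ge> 0"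
    "\<And>x y. x \<in> cball x0 r \<Longrightarrow> y \<in> cball x0 r \<Longrightarrow> dist (F x) (F y) \<le> L * dist x y"
    using smooth_on_locally_lipschitz[OF assms] by blast
  define P where "P = closest_point (cball x0 r)"
  have P: "P x \<in> cball x0 r" for x
    unfolding P_def using r by (intro closest_point_in_set) auto
  \<comment> \<open>Bounds the norm of \<open>F\<close> on the ball, and with it the speed of the
    solution.\<close>
  define M where "M = norm (F x0) + L * r"
  have lip: "dist (F (P x)) (F (P y)) \<le> L * dist x y" for x y
  proof -
    have "dist (F (P x)) (F (P y)) \<le> L * dist (P x) (P y)"
      by (intro L P)
    also have "\<dots> \<le> L * dist x y"
      unfolding P_def using r by (intro mult_left_mono closest_point_lipschitz L) auto
    finally show ?thesis .
  qed
  have bd: "norm (F (P x)) \<le> M" for x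
  proof -
    have "dist (F (P x)) (F x0) \<le> L * dist (P x) x0"
      using r by (intro L P) auto
    also have "\<dots> \<le> L * r"
      using P[of x] by (intro mult_left_mono L) (auto simp: dist_commute)
    finally show ?thesis
      unfolding M_def using norm_triangle_sub[of "F (P x)" "F x0"] by (simp add: dist_norm)
  qed
  have "M \<ge> 0"
    using bd norm_ge_zero order_trans by blast
  \<comment> \<open>The first entry gives \<open>L * h < 1\<close>; the second keeps the distance
    travelled, at most \<open>M * h\<close>, within \<open>r\<close>. The added 1 keeps the
    denominators positive.\<close>
  define h where "h = min (1 / (2 * (L + 1))) (r / (M + 1))"
  have h: "h > 0" "L * h < 1" "M * h \<le> r"
  proof -
    show "h > 0"
      using L(1) r(1) \<open>M \<ge> 0\<close> by (simp add: h_def)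
    have "L * h \<le> L * (1 / (2 * (L + 1)))"
      by (intro mult_left_mono L) (simp add: h_def)
    also have "\<dots> < 1"
      using L(1) by (simp add: field_simps)
    finally show "L * h < 1" .
    have "M * h \<le> M * (r / (M + 1))"
      by (intro mult_left_mono \<open>M \<ge> 0\<close>) (simp add: h_def)
    also have "\<dots> \<le> r"
      using \<open>M \<ge> 0\<close> r(1) by (simp add: field_simps)
    finally show "M * h \<le> r" .
  qed
  obtain x where x0: "x 0 = x0"
    and x': "\<And>t. t \<in> {-h..h} \<Longrightarrow> (x has_vector_derivative F (P (x t))) (at t within {-h..h})"
    using picard_lindelof_global[of "\<lambda>x. F (P x)" L h x0] lip L(1) h by blast
  have xball: "x t \<in> cball x0 r" if "t \<in> {-h..h}" for t
  proof -
    have "norm (x t - x0) \<le> M * h"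
      by (rule norm_le_of_vector_derivative_bound[where u = "\<lambda>t. x t - x0" and u' = "\<lambda>t. F (P (x t))"])
        (use x' bd x0 that in \<open>auto intro!: derivative_eq_intros\<close>)
    then show ?thesis
      using h(3) by (simp add: dist_norm norm_minus_commute)
  qed
  have sol: "(x has_vector_derivative F (x t)) (at t)" if t: "t \<in> {-h<..<h}" for t
  proof -
    have "P (x t) = x t"
      unfolding P_def by (rule closest_point_self) (use xball t in auto)
    then have "(x has_vector_derivative F (x t)) (at t within {-h..h})"
      using x'[of t] t by auto
    moreover have "t \<in> interior {-h..h}"
      using t by simp
    ultimately show ?thesis
      by (metis at_within_interior)
  qed
  have inS: "x t \<in> S" if "t \<in> {-h<..<h}" for t
    using xball[of t] that r by auto
  \<comment> \<open>Bootstrapping: as long as \<open>x\<close> is of order \<open>k\<close>, so is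
    its derivative \<open>F (x t)\<close>, and \<open>x\<close> gains an order.\<close>
  have "Ck_on k x {-h<..<h}" for k
  proof (induction k)
    case 0
    then show ?case
      using has_vector_derivative_continuous[OF sol] by (simp add: continuous_at_imp_continuous_on)
  next
    case (Suc k)
    have "Ck_on k (\<lambda>t. F (x t)) {-h<..<h}"
      by (rule Ck_on_compose[OF _ _ Suc]) (use assms inS in \<open>auto simp: smooth_on_def\<close>)
    then show ?case
      using sol by (intro Ck_on_Suc_vector_derivative[of _ _ "\<lambda>t. F (x t)"]) auto
  qed
  then show ?thesis
    using that h x0 inS sol unfolding smooth_on_def by blast
qed

text \<open>The sum of squares \<open>N\<close> replaces the sum of absolute values because it is
  differentiable. From \<open>\<bar>N' r\<bar> \<le> K * N r\<close> it follows that
  \<open>N r * exp (- (K * r))\<close> decreases and \<open>N r * exp (K * r)\<close> increases, and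
  since \<open>N\<close> is nonnegative and vanishes at \<open>t\<close>, it vanishes on both sides
  of \<open>t\<close>.\<close>

lemma gronwall_vanishing:
  fixes \<phi> \<phi>' :: "'i \<Rightarrow> real \<Rightarrow> real"
  assumes J: "is_interval J" "t \<in> J" and L: "finite L"
    and der: "\<And>l s. l \<in> L \<Longrightarrow> s \<in> J \<Longrightarrow> (\<phi> l has_real_derivative \<phi>' l s) (at s within J)"
    and bd: "\<And>l s. l \<in> L \<Longrightarrow> s \<in> J \<Longrightarrow> \<bar>\<phi>' l s\<bar> \<le> C * (\<Sum>i\<in>L. \<bar>\<phi> i s\<bar>)"
    and zero: "\<And>l. l \<in> L \<Longrightarrow> \<phi> l t = 0" and s: "s \<in> J" and l: "l \<in> L"
  shows "\<phi> l s = 0"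
proof -
  define N where "N r = (\<Sum>l\<in>L. (\<phi> l r)\<^sup>2)" for r
  define N' where "N' r = (\<Sum>l\<in>L. 2 * \<phi> l r * \<phi>' l r)" for r
  \<comment> \<open>The 2 comes from differentiating squares and \<open>card L\<close> from the
    Cauchy-Schwarz bound for the squared sum of the \<open>\<bar>\<phi> i r\<bar>\<close>; the
    absolute value makes \<open>K\<close> nonnegative.\<close>
  define K where "K = 2 * \<bar>C\<bar> * real (card L)"
  have N: "(N has_real_derivative N' r) (at r within J)" if "r \<in> J" for r
    unfolding N_def N'_def
    by (intro DERIV_sum) (use der that in \<open>auto intro!: derivative_eq_intros\<close>)
  have N'_le: "\<bar>N' r\<bar> \<le> K * N r" if "r \<in> J" for r
  proof -
    let ?S = "\<Sum>i\<in>L. \<bar>\<phi> i r\<bar>"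
    have S0: "0 \<le> ?S"
      by (simp add: sum_nonneg)
    have "\<bar>N' r\<bar> \<le> (\<Sum>l\<in>L. 2 * \<bar>\<phi> l r\<bar> * \<bar>\<phi>' l r\<bar>)"
      unfolding N'_def by (rule order_trans[OF sum_abs]) (simp add: abs_mult)
    also have "\<dots> \<le> (\<Sum>l\<in>L. 2 * \<bar>\<phi> l r\<bar> * (\<bar>C\<bar> * ?S))"
    proof (intro sum_mono mult_left_mono)
      fix l assume "l \<in> L"
      then have "\<bar>\<phi>' l r\<bar> \<le> C * ?S"
        using bd that by blast
      also have "\<dots> \<le> \<bar>C\<bar> * ?S"
        using S0 by (intro mult_right_mono) auto
      finally show "\<bar>\<phi>' l r\<bar> \<le> \<bar>C\<bar> * ?S" .
    qed auto
    also have "\<dots> = 2 * \<bar>C\<bar> * ?S\<^sup>2"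
      by (simp add: power2_eq_square sum_distrib_left sum_distrib_right mult_ac)
    also have "\<dots> \<le> 2 * \<bar>C\<bar> * (real (card L) * N r)"
      using sum_squared_le_sum_of_squares[of "\<lambda>i. \<bar>\<phi> i r\<bar>" L] L
      by (intro mult_left_mono) (simp_all add: N_def mult.commute)
    finally show ?thesis
      by (simp add: K_def mult_ac)
  qed
  \<comment> \<open>End points of \<open>J\<close> carry one-sided derivatives only; derivatives
    inside and continuity up to the ends are enough for monotonicity.\<close>
  have mono: "u b \<le> u a" if ab: "a \<in> J" "b \<in> J" "a \<le> b"
    and u: "\<And>r. r \<in> J \<Longrightarrow> (u has_real_derivative u' r) (at r within J) \<and> u' r \<le> 0"
    for u u' :: "real \<Rightarrow> real" and a b
  proof -
    have sub: "{a..b} \<subseteq> J"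
      using mem_is_interval_1_I[OF J(1) ab(1,2)] by auto
    show ?thesis
    proof (rule DERIV_nonpos_imp_decreasing_open[OF ab(3)])
      fix r assume r: "a < r" "r < b"
      have "{a<..<b} \<subseteq> interior J"
        using sub by (intro interior_maximal) auto
      then have "at r within J = at r"
        using r by (intro at_within_interior) auto
      moreover have "r \<in> J"
        using r sub by auto
      ultimately show "\<exists>y. DERIV u r :> y \<and> y \<le> 0"
        using u[of r] by auto
    next
      have "continuous_on J u"
        using DERIV_continuous[OF conjunct1[OF u]] by (simp add: continuous_on_eq_continuous_within)
      then show "continuous_on {a..b} u"
        using sub continuous_on_subset by blast
    qed
  qed
  have N0: "N t = 0"
    by (simp add: N_def zero)
  have "N s \<le> 0"
  proof (cases "t \<le> s")
    case True
    let ?u = "\<lambda>r. N r * exp (- (K * r))"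
    have "?u s \<le> ?u t"
    proof (rule mono[OF J(2) s True])
      fix r assume r: "r \<in> J"
      have "(?u has_real_derivative (N' r - K * N r) * exp (- (K * r))) (at r within J)"
        by (rule derivative_eq_intros N r refl | simp add: algebra_simps)+
      moreover have "(N' r - K * N r) * exp (- (K * r)) \<le> 0"
        using N'_le[OF r] by (intro mult_nonpos_nonneg) auto
      ultimately show "(?u has_real_derivative (N' r - K * N r) * exp (- (K * r))) (at r within J) \<and>
          (N' r - K * N r) * exp (- (K * r)) \<le> 0"
        by blast
    qed
    then show ?thesis
      using N0 by (simp add: mult_le_0_iff)
  next
    case False
    \<comment> \<open>Before \<open>t\<close> the opposite exponent is used, and the minus sign
      turns the increasing function into one to which \<open>mono\<close> applies.\<close>
    let ?u = "\<lambda>r. - (N r * exp (K * r))"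
    have "?u t \<le> ?u s"
    proof (rule mono[OF s J(2)])
      fix r assume r: "r \<in> J"
      have "(?u has_real_derivative - ((N' r + K * N r) * exp (K * r))) (at r within J)"
        by (rule derivative_eq_intros N r refl | simp add: algebra_simps)+
      moreover have "- ((N' r + K * N r) * exp (K * r)) \<le> 0"
        using N'_le[OF r] by (simp add: mult_nonneg_nonneg)
      ultimately show "(?u has_real_derivative - ((N' r + K * N r) * exp (K * r))) (at r within J) \<and>
          - ((N' r + K * N r) * exp (K * r)) \<le> 0"
        by blast
    qed (use False in auto)
    then show ?thesis
      using N0 by (simp add: mult_le_0_iff)
  qed
  then have "N s = 0"
    using sum_nonneg[of L "\<lambda>l. (\<phi> l s)\<^sup>2"] by (simp add: N_def)
  then show ?thesis
    using l L by (simp add: N_def sum_nonneg_eq_0_iff)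
qed

section \<open>Charts, tangent vectors and smooth fields\<close>

locale manifold =
  fixes A :: "('a::{t2_space, second_countable_topology}, 'e::euclidean_space) chart set"
  assumes smooth_manifold: "smooth_manifold A"
begin

lemma open_cdom: "c \<in> A \<Longrightarrow> open (cdom c)"
  and homeomorphism_chart: "c \<in> A \<Longrightarrow> homeomorphism (cdom c) (cmap c ` cdom c) (cmap c) (cinv c)"
  and open_chart_range: "c \<in> A \<Longrightarrow> open (cmap c ` cdom c)"
  and smooth_transition:
    "c \<in> A \<Longrightarrow> d \<in> A \<Longrightarrow> smooth_on (\<lambda>x. cmap d (cinv c x)) (cmap c ` (cdom c \<inter> cdom d))"
  using smooth_manifold unfolding smooth_manifold_def comp_def by auto

lemma chart_exists:
  obtains c where "c \<in> A" "p \<in> cdom c"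
  using smooth_manifold unfolding smooth_manifold_def by blast

lemma cinv_cmap [simp]: "c \<in> A \<Longrightarrow> p \<in> cdom c \<Longrightarrow> cinv c (cmap c p) = p"
  using homeomorphism_chart[of c] by (simp add: homeomorphism_def)

lemma cmap_cinv: "c \<in> A \<Longrightarrow> x \<in> cmap c ` cdom c \<Longrightarrow> cmap c (cinv c x) = x"
  by auto

lemma cinv_in_cdom: "c \<in> A \<Longrightarrow> x \<in> cmap c ` cdom c \<Longrightarrow> cinv c x \<in> cdom c"
  by auto

lemma continuous_on_cmap: "c \<in> A \<Longrightarrow> continuous_on (cdom c) (cmap c)"
  and continuous_on_cinv: "c \<in> A \<Longrightarrow> continuous_on (cmap c ` cdom c) (cinv c)"
  using homeomorphism_chart[of c] by (auto simp: homeomorphism_def)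

lemma in_chart_image_iff:
  "c \<in> A \<Longrightarrow> x \<in> cmap c ` (U \<inter> cdom c) \<longleftrightarrow> x \<in> cmap c ` cdom c \<and> cinv c x \<in> U"
  by auto

lemma open_chart_image:
  assumes "c \<in> A" "open U"
  shows "open (cmap c ` (U \<inter> cdom c))"
proof -
  have "cmap c ` (U \<inter> cdom c) = cmap c ` cdom c \<inter> cinv c -` U"
    using in_chart_image_iff[OF assms(1)] by blast
  then show ?thesis
    using continuous_open_preimage[OF continuous_on_cinv[OF assms(1)] open_chart_range[OF assms(1)] assms(2)]
    by simp
qed

text \<open>The Jacobian at \<open>p\<close> of the change of coordinates from \<open>c\<close> to
  \<open>d\<close>, which is the linear map in the transformation law of
  \<open>tangent_space\<close>.\<close>

definition transition :: "('a, 'e) chart \<Rightarrow> ('a, 'e) chart \<Rightarrow> 'a \<Rightarrow> 'e \<Rightarrow> 'e"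
  where "transition c d p = frechet_derivative (cmap d \<circ> cinv c) (at (cmap c p))"

lemma has_derivative_transition:
  assumes "c \<in> A" "d \<in> A" "p \<in> cdom c" "p \<in> cdom d"
  shows "((\<lambda>x. cmap d (cinv c x)) has_derivative transition c d p) (at (cmap c p))"
  unfolding transition_def comp_def
  by (rule smooth_on_has_derivative[OF smooth_transition[OF assms(1,2)]]) (use assms in auto)

lemma linear_transition:
  "c \<in> A \<Longrightarrow> d \<in> A \<Longrightarrow> p \<in> cdom c \<Longrightarrow> p \<in> cdom d \<Longrightarrow> linear (transition c d p)"
  using has_derivative_transition has_derivative_linear by blast

lemma transition_self:
  assumes "c \<in> A" "p \<in> cdom c"
  shows "transition c c p v = v"
proof -
  have "((\<lambda>x. cmap c (cinv c x)) has_derivative (\<lambda>v. v)) (at (cmap c p))"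
    by (rule has_derivative_transform_within_open[OF has_derivative_ident open_chart_range[OF assms(1)]])
      (use assms cmap_cinv in auto)
  then show ?thesis
    unfolding transition_def comp_def by (simp add: frechet_derivative_eqI)
qed

text \<open>The cocycle rule, from the chain rule on the overlap of the charts. It is the reason why
  \<open>lift\<close> produces tangent vectors.\<close>

lemma transition_transition:
  assumes "c \<in> A" "d \<in> A" "e \<in> A" "p \<in> cdom c" "p \<in> cdom d" "p \<in> cdom e"
  shows "transition d e p (transition c d p v) = transition c e p v"
proof -
  have "((\<lambda>x. cmap e (cinv d (cmap d (cinv c x)))) has_derivative (\<lambda>v. transition d e p (transition c d p v)))
      (at (cmap c p))"
    by (rule has_derivative_compose[OF has_derivative_transition[OF assms(1,2,4,5)]])
      (use has_derivative_transition[OF assms(2,3,5,6)] assms in simp)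
  then have "((\<lambda>x. cmap e (cinv c x)) has_derivative (\<lambda>v. transition d e p (transition c d p v))) (at (cmap c p))"
    by (rule has_derivative_transform_within_open[OF _ open_chart_image[OF assms(1) open_cdom[OF assms(2)]]])
      (use assms in auto)
  then show ?thesis
    unfolding transition_def[of c e] comp_def by (simp add: frechet_derivative_eqI)
qed

lemma tangent_space_transition:
  assumes "v \<in> tangent_space A p" "c \<in> A" "d \<in> A" "p \<in> cdom c" "p \<in> cdom d"
  shows "v d = transition c d p (v c)"
  using assms unfolding tangent_space_def transition_def by blast

lemma tangent_space_outside: "v \<in> tangent_space A p \<Longrightarrow> \<not> (c \<in> A \<and> p \<in> cdom c) \<Longrightarrow> v c = 0"
  unfolding tangent_space_def by blast

lemma tangent_spaceI:
  assumes "\<And>c. \<not> (c \<in> A \<and> p \<in> cdom c) \<Longrightarrow> v c = 0"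
    and "\<And>c d. c \<in> A \<Longrightarrow> d \<in> A \<Longrightarrow> p \<in> cdom c \<Longrightarrow> p \<in> cdom d \<Longrightarrow> v d = transition c d p (v c)"
  shows "v \<in> tangent_space A p"
  using assms unfolding tangent_space_def transition_def by blast

lemma tangent_space_eqI:
  assumes "v \<in> tangent_space A p" "w \<in> tangent_space A p" "c \<in> A" "p \<in> cdom c" "v c = w c"
  shows "v = w"
proof
  fix d
  show "v d = w d"
  proof (cases "d \<in> A \<and> p \<in> cdom d")
    case True
    then show ?thesis
      using assms tangent_space_transition by metis
  next
    case False
    then show ?thesis
      using assms(1,2) tangent_space_outside by metis
  qed
qed

lemma subspace_tangent_space: "subspace (tangent_space A p)"
proof (rule subspaceI)
  note lin = linear_transition
  show "0 \<in> tangent_space A p"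
    by (rule tangent_spaceI) (simp_all add: linear_0[OF lin])
  fix v assume v: "v \<in> tangent_space A p"
  show "a *\<^sub>R v \<in> tangent_space A p" for a
  proof (rule tangent_spaceI)
    show "(a *\<^sub>R v) d = transition c d p ((a *\<^sub>R v) c)"
      if cd: "c \<in> A" "d \<in> A" "p \<in> cdom c" "p \<in> cdom d" for c d
      by (simp only: scaleR_fun_def linear_cmul[OF lin[OF cd]] tangent_space_transition[OF v cd])
  qed (simp add: scaleR_fun_def tangent_space_outside[OF v])
  fix w assume w: "w \<in> tangent_space A p"
  show "v + w \<in> tangent_space A p"
  proof (rule tangent_spaceI)
    show "(v + w) d = transition c d p ((v + w) c)"
      if cd: "c \<in> A" "d \<in> A" "p \<in> cdom c" "p \<in> cdom d" for c d
      by (simp only: plus_fun_apply linear_add[OF lin[OF cd]] tangent_space_transition[OF v cd]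
        tangent_space_transition[OF w cd])
  qed (simp add: tangent_space_outside[OF v] tangent_space_outside[OF w])
qed

text \<open>Inverse to reading off the component in the chart \<open>c\<close>. For fixed
  \<open>u\<close> in \<open>Basis\<close> and varying \<open>p\<close> it is a coordinate field of
  \<open>c\<close>.\<close>

definition lift :: "('a, 'e) chart \<Rightarrow> 'a \<Rightarrow> 'e \<Rightarrow> ('a, 'e) tvec"
  where "lift c p u = (\<lambda>d. if d \<in> A \<and> p \<in> cdom d then transition c d p u else 0)"

lemma lift_tangent: "c \<in> A \<Longrightarrow> p \<in> cdom c \<Longrightarrow> lift c p u \<in> tangent_space A p"
  by (rule tangent_spaceI) (auto simp: lift_def transition_transition)

lemma lift_component [simp]: "c \<in> A \<Longrightarrow> p \<in> cdom c \<Longrightarrow> lift c p u c = u"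
  by (simp add: lift_def transition_self)

lemma lift_of_component: "v \<in> tangent_space A p \<Longrightarrow> c \<in> A \<Longrightarrow> p \<in> cdom c \<Longrightarrow> lift c p (v c) = v"
  by (rule tangent_space_eqI[of _ p _ c]) (auto intro: lift_tangent)

lemma sum_fun_apply: "(\<Sum>i\<in>I. f i) x = (\<Sum>i\<in>I. f i x)" for f :: "'i \<Rightarrow> 'x \<Rightarrow> 'y::comm_monoid_add"
  by (induction I rule: infinite_finite_induct) auto

lemma lift_sum_Basis:
  assumes "c \<in> A" "p \<in> cdom c"
  shows "lift c p u = (\<Sum>b\<in>Basis. (u \<bullet> b) *\<^sub>R lift c p b)"
proof (rule tangent_space_eqI[OF lift_tangent[OF assms] _ assms])
  show "(\<Sum>b\<in>Basis. (u \<bullet> b) *\<^sub>R lift c p b) \<in> tangent_space A p"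
    by (intro subspace_sum subspace_scale subspace_tangent_space lift_tangent assms)
  show "lift c p u c = (\<Sum>b\<in>Basis. (u \<bullet> b) *\<^sub>R lift c p b) c"
    using assms by (simp add: sum_fun_apply scaleR_fun_def euclidean_representation)
qed

subsection \<open>Smooth functions\<close>

lemma smooth_fun_onD: "smooth_fun_on A U f \<Longrightarrow> c \<in> A \<Longrightarrow> smooth_on (\<lambda>x. f (cinv c x)) (cmap c ` (U \<inter> cdom c))"
  unfolding smooth_fun_on_def comp_def by blast

lemma smooth_fun_on_subset: "smooth_fun_on A U f \<Longrightarrow> V \<subseteq> U \<Longrightarrow> smooth_fun_on A V f"
  unfolding smooth_fun_on_def by (blast intro: smooth_on_subset)

lemma smooth_fun_on_cong:
  assumes "open U" "\<And>p. p \<in> U \<Longrightarrow> f p = h p" "smooth_fun_on A U f"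
  shows "smooth_fun_on A U h"
  unfolding smooth_fun_on_def comp_def
proof
  fix c assume c: "c \<in> A"
  show "smooth_on (\<lambda>x. h (cinv c x)) (cmap c ` (U \<inter> cdom c))"
    by (rule iffD1[OF smooth_on_cong[OF open_chart_image[OF c assms(1)]] smooth_fun_onD[OF assms(3) c]])
      (use assms(2) c in auto)
qed

lemma smooth_fun_on_local:
  assumes "\<And>p. p \<in> U \<Longrightarrow> \<exists>V. open V \<and> p \<in> V \<and> smooth_fun_on A V f"
  shows "smooth_fun_on A U f"
  unfolding smooth_fun_on_def comp_def
proof
  fix c assume c: "c \<in> A"
  show "smooth_on (\<lambda>x. f (cinv c x)) (cmap c ` (U \<inter> cdom c))"
  proof (rule smooth_on_local)
    fix x assume "x \<in> cmap c ` (U \<inter> cdom c)"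
    then obtain p where p: "p \<in> U" "p \<in> cdom c" "x = cmap c p"
      by auto
    then obtain V where "open V" "p \<in> V" "smooth_fun_on A V f"
      using assms by blast
    then show "\<exists>T. open T \<and> x \<in> T \<and> smooth_on (\<lambda>x. f (cinv c x)) T"
      using p open_chart_image[OF c] smooth_fun_onD[OF _ c] by (intro exI[of _ "cmap c ` (V \<inter> cdom c)"]) simp
  qed
qed

lemma smooth_fun_on_chartI:
  assumes "c \<in> A" "open U" "U \<subseteq> cdom c" "smooth_on h (cmap c ` U)"
  shows "smooth_fun_on A U (\<lambda>p. h (cmap c p))"
  unfolding smooth_fun_on_def comp_def
proof
  fix d assume d: "d \<in> A"
  show "smooth_on (\<lambda>x. h (cmap c (cinv d x))) (cmap d ` (U \<inter> cdom d))"
    by (rule smooth_on_compose[OF assms(4) open_chart_image[OF d assms(2)]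
      smooth_on_subset[OF smooth_transition[OF d assms(1)]]])
      (use d assms in auto)
qed

lemma smooth_fun_on_const: "smooth_fun_on A U (\<lambda>p. k)"
  unfolding smooth_fun_on_def comp_def by (simp add: smooth_on_const)

lemma smooth_fun_on_mult:
  "open U \<Longrightarrow> smooth_fun_on A U f \<Longrightarrow> smooth_fun_on A U h \<Longrightarrow> smooth_fun_on A U (\<lambda>p. f p * h p)"
  unfolding smooth_fun_on_def comp_def by (auto intro: smooth_on_mult open_chart_image)

lemma smooth_fun_on_divide:
  assumes "open U" "smooth_fun_on A U f" "smooth_fun_on A U h" "\<And>p. p \<in> U \<Longrightarrow> h p \<noteq> 0"
  shows "smooth_fun_on A U (\<lambda>p. f p / h p)"
  unfolding smooth_fun_on_def comp_def
proof
  fix c assume c: "c \<in> A"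
  show "smooth_on (\<lambda>x. f (cinv c x) / h (cinv c x)) (cmap c ` (U \<inter> cdom c))"
    by (rule smooth_on_divide) (use assms c open_chart_image smooth_fun_onD in auto)
qed

lemma smooth_fun_on_continuous_on:
  assumes "open U" "smooth_fun_on A U f"
  shows "continuous_on U f"
proof -
  have "continuous (at p) f" if p: "p \<in> U" for p
  proof -
    obtain c where c: "c \<in> A" "p \<in> cdom c"
      by (rule chart_exists)
    have "continuous_on (U \<inter> cdom c) (\<lambda>q. f (cinv c (cmap c q)))"
      by (rule continuous_on_compose2[OF smooth_on_continuous_on[OF smooth_fun_onD[OF assms(2) c(1)]]])
        (use continuous_on_subset[OF continuous_on_cmap[OF c(1)]] in auto)
    then have "continuous_on (U \<inter> cdom c) f"
      by (rule continuous_on_eq) (use c in auto)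
    then show ?thesis
      using p c open_cdom assms(1) by (simp add: continuous_on_eq_continuous_at open_Int)
  qed
  then show ?thesis
    by (simp add: continuous_at_imp_continuous_on)
qed

subsection \<open>Smooth vector fields\<close>

lemma smooth_vfield_on_tangent: "smooth_vfield_on A U X \<Longrightarrow> p \<in> U \<Longrightarrow> X p \<in> tangent_space A p"
  unfolding smooth_vfield_on_def by blast

lemma smooth_vfield_onD:
  "smooth_vfield_on A U X \<Longrightarrow> c \<in> A \<Longrightarrow> smooth_on (\<lambda>x. X (cinv c x) c) (cmap c ` (U \<inter> cdom c))"
  unfolding smooth_vfield_on_def by blast

lemma smooth_vfield_on_subset: "smooth_vfield_on A U X \<Longrightarrow> V \<subseteq> U \<Longrightarrow> smooth_vfield_on A V X"
  unfolding smooth_vfield_on_def by (blast intro: smooth_on_subset)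

lemma smooth_vfield_on_cong:
  assumes "open U" "\<And>p. p \<in> U \<Longrightarrow> X p = Y p" "smooth_vfield_on A U X"
  shows "smooth_vfield_on A U Y"
proof -
  have "smooth_on (\<lambda>x. Y (cinv c x) c) (cmap c ` (U \<inter> cdom c))" if c: "c \<in> A" for c
    by (rule iffD1[OF smooth_on_cong[OF open_chart_image[OF c assms(1)]] smooth_vfield_onD[OF assms(3) c]])
      (use assms(2) c in auto)
  then show ?thesis
    using smooth_vfield_on_tangent[OF assms(3)] assms(2) unfolding smooth_vfield_on_def by metis
qed

lemma smooth_vfield_on_local:
  assumes "\<And>p. p \<in> U \<Longrightarrow> \<exists>V. open V \<and> p \<in> V \<and> smooth_vfield_on A V X"
  shows "smooth_vfield_on A U X"
  unfolding smooth_vfield_on_def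
proof (intro conjI ballI)
  show "X p \<in> tangent_space A p" if "p \<in> U" for p
    using assms[OF that] smooth_vfield_on_tangent by blast
  fix c assume c: "c \<in> A"
  show "smooth_on (\<lambda>x. X (cinv c x) c) (cmap c ` (U \<inter> cdom c))"
  proof (rule smooth_on_local)
    fix x assume "x \<in> cmap c ` (U \<inter> cdom c)"
    then obtain p where p: "p \<in> U" "p \<in> cdom c" "x = cmap c p"
      by auto
    then obtain V where "open V" "p \<in> V" "smooth_vfield_on A V X"
      using assms by blast
    then show "\<exists>T. open T \<and> x \<in> T \<and> smooth_on (\<lambda>x. X (cinv c x) c) T"
      using p open_chart_image[OF c] smooth_vfield_onD[OF _ c] by (intro exI[of _ "cmap c ` (V \<inter> cdom c)"]) simp
  qed
qed

lemma smooth_vfield_on_zero: "smooth_vfield_on A U 0"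
  using subspace_0[OF subspace_tangent_space]
  by (auto simp: smooth_vfield_on_def zero_fun_def smooth_on_const)

lemma smooth_vfield_on_add:
  assumes "open U" "smooth_vfield_on A U X" "smooth_vfield_on A U Y"
  shows "smooth_vfield_on A U (X + Y)"
  using assms unfolding smooth_vfield_on_def
  by (auto intro!: smooth_on_add open_chart_image subspace_add[OF subspace_tangent_space])

lemma smooth_vfield_on_scale:
  assumes "open U" "smooth_fun_on A U f" "smooth_vfield_on A U X"
  shows "smooth_vfield_on A U (\<lambda>p. f p *\<^sub>R X p)"
  using assms unfolding smooth_vfield_on_def
  by (auto simp: scaleR_fun_def smooth_fun_on_def comp_def
    intro!: smooth_on_scaleR open_chart_image subspace_scale[OF subspace_tangent_space, unfolded scaleR_fun_def])

lemma smooth_vfield_on_sum: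
  assumes "open U" "\<And>i. i \<in> I \<Longrightarrow> smooth_vfield_on A U (X i)"
  shows "smooth_vfield_on A U (\<Sum>i\<in>I. X i)"
  using assms(2)
  by (induction I rule: infinite_finite_induct)
    (auto intro!: smooth_vfield_on_add smooth_vfield_on_zero assms(1) simp flip: zero_fun_def)

text \<open>In another chart the component is the Jacobian applied to a vector that varies with the
  point. As in the chain rule, expansion in \<open>Basis\<close> reduces this to smooth scalars
  times Jacobian columns.\<close>

lemma smooth_vfield_on_chartI:
  assumes "c \<in> A" "open U" "U \<subseteq> cdom c" "smooth_on \<xi> (cmap c ` U)"
  shows "smooth_vfield_on A U (\<lambda>p. lift c p (\<xi> (cmap c p)))"
  unfolding smooth_vfield_on_def
proof (intro conjI ballI)
  show "lift c p (\<xi> (cmap c p)) \<in> tangent_space A p" if "p \<in> U" for p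
    using that assms lift_tangent by blast
  fix d assume d: "d \<in> A"
  let ?V = "cmap d ` (U \<inter> cdom d)" and ?T = "\<lambda>y. cmap c (cinv d y)"
  let ?D = "\<lambda>b x. frechet_derivative (\<lambda>x. cmap d (cinv c x)) (at x) b"
  have V: "open ?V"
    by (rule open_chart_image[OF d assms(2)])
  have T: "smooth_on ?T ?V"
    by (rule smooth_on_subset[OF smooth_transition[OF d assms(1)]]) (use assms in auto)
  have "smooth_on (\<lambda>y. \<Sum>b\<in>Basis. (\<xi> (?T y) \<bullet> b) *\<^sub>R ?D b (?T y)) ?V"
  proof (intro smooth_on_sum smooth_on_scaleR smooth_on_inner smooth_on_const V)
    show "smooth_on (\<lambda>y. \<xi> (?T y)) ?V"
      by (rule smooth_on_compose[OF assms(4) V T]) (use assms d in auto)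
    fix b :: 'e
    show "smooth_on (\<lambda>y. ?D b (?T y)) ?V"
      by (rule smooth_on_compose[OF smooth_on_frechet_derivative[OF smooth_transition[OF assms(1) d]] V T])
        (use assms d in auto)
  qed
  moreover have "lift c (cinv d y) (\<xi> (?T y)) d = (\<Sum>b\<in>Basis. (\<xi> (?T y) \<bullet> b) *\<^sub>R ?D b (?T y))"
    if "y \<in> ?V" for y
  proof -
    have q: "cinv d y \<in> cdom c" "cinv d y \<in> cdom d"
      using that d assms by auto
    have lin: "linear (transition c d (cinv d y))"
      using q d assms by (intro linear_transition)
    have "lift c (cinv d y) w d = (\<Sum>b\<in>Basis. (w \<bullet> b) *\<^sub>R transition c d (cinv d y) b)" for w
      unfolding lift_def using q d
      by (subst euclidean_representation[symmetric, of w]) (simp add: linear_sum[OF lin] linear_cmul[OF lin])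
    then show ?thesis
      by (simp add: transition_def comp_def)
  qed
  ultimately show "smooth_on (\<lambda>y. lift c (cinv d y) (\<xi> (?T y)) d) ?V"
    using smooth_on_cong[OF V] by (metis (no_types, lifting))
qed

subsection \<open>Cutting off\<close>

text \<open>The closed set \<open>K\<close> is exported together with \<open>\<phi>\<close> because
  products with \<open>\<phi>\<close> are glued along the open cover by \<open>U\<close> and
  \<open>- K\<close>.\<close>

lemma bump_exists:
  assumes "open U" "p \<in> U"
  obtains \<phi> :: "'a \<Rightarrow> real" and K where "smooth_fun_on A UNIV \<phi>" "\<phi> p > 0" "\<And>q. \<phi> q \<ge> 0"
    "closed K" "K \<subseteq> U" "\<And>q. q \<notin> K \<Longrightarrow> \<phi> q = 0"
proof -
  obtain c where c: "c \<in> A" "p \<in> cdom c"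
    by (rule chart_exists)
  have "open (cmap c ` (U \<inter> cdom c))" "cmap c p \<in> cmap c ` (U \<inter> cdom c)"
    using c assms open_chart_image by auto
  then obtain r where r: "r > 0" "cball (cmap c p) r \<subseteq> cmap c ` (U \<inter> cdom c)"
    using open_contains_cball by blast
  obtain f :: "'e \<Rightarrow> real" where f: "smooth_on f UNIV" "\<And>x. f x > 0 \<longleftrightarrow> x \<in> ball (cmap c p) r" "\<And>x. f x \<ge> 0"
    using smooth_bump[OF r(1), of "cmap c p"] by blast
  define K where "K = cinv c ` cball (cmap c p) r"
  define \<phi> where "\<phi> q = (if q \<in> cdom c then f (cmap c q) else 0)" for q
  have "compact K"
    unfolding K_def using r(2)
    by (intro compact_continuous_image continuous_on_subset[OF continuous_on_cinv[OF c(1)]]) auto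
  \<comment> \<open>Here the Hausdorff property enters: \<open>K\<close> is the image of a closed
    ball of the chart, and it has to be closed in the whole manifold.\<close>
  then have K: "closed K"
    by (rule compact_imp_closed)
  have KU: "K \<subseteq> U \<inter> cdom c"
    unfolding K_def using r(2) in_chart_image_iff[OF c(1)] cinv_in_cdom[OF c(1)] by blast
  have 0: "\<phi> q = 0" if "q \<notin> K" for q
  proof (rule ccontr)
    assume "\<phi> q \<noteq> 0"
    then have "q \<in> cdom c" "f (cmap c q) > 0"
      using f(3)[of "cmap c q"] by (auto simp: \<phi>_def less_le split: if_splits)
    then have "cmap c q \<in> cball (cmap c p) r" "q = cinv c (cmap c q)"
      using f(2) c by auto
    then show False
      using that unfolding K_def by blast
  qed
  have "smooth_fun_on A UNIV \<phi>"
  proof (rule smooth_fun_on_local)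
    fix q
    show "\<exists>V. open V \<and> q \<in> V \<and> smooth_fun_on A V \<phi>"
    proof (cases "q \<in> K")
      case True
      have "smooth_fun_on A (cdom c) (\<lambda>q. f (cmap c q))"
        using c f(1) open_cdom by (intro smooth_fun_on_chartI) (auto intro: smooth_on_subset)
      then have "smooth_fun_on A (cdom c) \<phi>"
        by (rule smooth_fun_on_cong[rotated 2]) (use c open_cdom in \<open>auto simp: \<phi>_def\<close>)
      then show ?thesis
        using True KU c open_cdom by blast
    next
      case False
      have "smooth_fun_on A (- K) \<phi>"
        by (rule smooth_fun_on_cong[OF _ _ smooth_fun_on_const[of _ 0]]) (use K 0 in auto)
      then show ?thesis
        using False K by (intro exI[of _ "- K"]) auto
    qed
  qed
  moreover have "\<phi> p > 0"
    using f(2) r c by (simp add: \<phi>_def)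
  moreover have "\<phi> q \<ge> 0" for q
    using f(3) by (simp add: \<phi>_def)
  ultimately show ?thesis
    using that K KU 0 by blast
qed

text \<open>On \<open>U\<close> the function is a product of smooth functions, on \<open>- K\<close>
  it is 0, and these two open sets cover the manifold.\<close>

lemma smooth_fun_on_cutoff:
  assumes "open U" "closed K" "K \<subseteq> U" "\<And>q. q \<notin> K \<Longrightarrow> \<phi> q = 0"
    and "smooth_fun_on A UNIV \<phi>" "smooth_fun_on A U h"
  shows "smooth_fun_on A UNIV (\<lambda>q. if q \<in> U then \<phi> q * h q else 0)" (is "smooth_fun_on A UNIV ?k")
proof (rule smooth_fun_on_local)
  fix q
  have "smooth_fun_on A U (\<lambda>q. \<phi> q * h q)"
    by (intro smooth_fun_on_mult smooth_fun_on_subset[OF assms(5)] assms) auto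
  then have "smooth_fun_on A U ?k"
    by (rule smooth_fun_on_cong[rotated 2]) (use assms in auto)
  moreover have "smooth_fun_on A (- K) ?k"
    by (rule smooth_fun_on_cong[OF _ _ smooth_fun_on_const[of _ 0]]) (use assms in auto)
  moreover have "q \<in> U \<or> q \<in> - K"
    using assms(3) by blast
  ultimately show "\<exists>V. open V \<and> q \<in> V \<and> smooth_fun_on A V ?k"
    using assms(1) open_Compl[OF assms(2)] by blast
qed

lemma smooth_vfield_on_cutoff:
  assumes "open U" "closed K" "K \<subseteq> U" "\<And>q. q \<notin> K \<Longrightarrow> \<phi> q = 0"
    and "smooth_fun_on A UNIV \<phi>" "smooth_vfield_on A U X"
  shows "(\<lambda>q. if q \<in> U then \<phi> q *\<^sub>R X q else 0) \<in> vfields A" (is "?k \<in> _")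
proof -
  have "smooth_vfield_on A UNIV ?k"
  proof (rule smooth_vfield_on_local)
    fix q
    have "smooth_vfield_on A U (\<lambda>q. \<phi> q *\<^sub>R X q)"
      by (intro smooth_vfield_on_scale smooth_fun_on_subset[OF assms(5)] assms) auto
    then have "smooth_vfield_on A U ?k"
      by (rule smooth_vfield_on_cong[rotated 2]) (use assms in auto)
    moreover have "smooth_vfield_on A (- K) ?k"
      by (rule smooth_vfield_on_cong[OF _ _ smooth_vfield_on_zero])
        (use assms in \<open>auto simp: zero_fun_def scaleR_fun_def\<close>)
    moreover have "q \<in> U \<or> q \<in> - K"
      using assms(3) by blast
    ultimately show "\<exists>V. open V \<and> q \<in> V \<and> smooth_vfield_on A V ?k"
      using assms(1) open_Compl[OF assms(2)] by blast
  qed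
  then show ?thesis
    by simp
qed

lemma vfields_tangent: "X \<in> vfields A \<Longrightarrow> X p \<in> tangent_space A p"
  by (simp add: smooth_vfield_on_tangent)

lemma vfields_add: "X \<in> vfields A \<Longrightarrow> Y \<in> vfields A \<Longrightarrow> X + Y \<in> vfields A"
  by (simp add: smooth_vfield_on_add)

lemma vfields_scale: "smooth_fun_on A UNIV f \<Longrightarrow> X \<in> vfields A \<Longrightarrow> (\<lambda>p. f p *\<^sub>R X p) \<in> vfields A"
  by (simp add: smooth_vfield_on_scale)

lemma vfields_scaleR: "X \<in> vfields A \<Longrightarrow> a *\<^sub>R X \<in> vfields A"
  using vfields_scale[of "\<lambda>_. a" X] smooth_fun_on_const by (simp add: scaleR_fun_def)

lemma vfields_sum: "(\<And>i. i \<in> I \<Longrightarrow> X i \<in> vfields A) \<Longrightarrow> (\<Sum>i\<in>I. X i) \<in> vfields A"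
  by (simp add: smooth_vfield_on_sum)

subsection \<open>Directional derivatives and curves\<close>

lemma smooth_fun_on_has_derivative:
  assumes "smooth_fun_on A U f" "p \<in> U" "c \<in> A" "p \<in> cdom c"
  shows "((\<lambda>x. f (cinv c x)) has_derivative frechet_derivative (f \<circ> cinv c) (at (cmap c p))) (at (cmap c p))"
  unfolding comp_def using smooth_on_has_derivative[OF smooth_fun_onD[OF assms(1,3)]] assms by blast

text \<open>\<open>dir_deriv\<close> picks its chart by choice. The chain rule for the change of
  charts cancels against the transformation law of \<open>v\<close>, so every chart gives the same
  value.\<close>

lemma dir_deriv_eq:
  assumes "open U" "smooth_fun_on A U f" "p \<in> U" "v \<in> tangent_space A p" "c \<in> A" "p \<in> cdom c"
  shows "dir_deriv A p v f = frechet_derivative (f \<circ> cinv c) (at (cmap c p)) (v c)"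
proof -
  define d where "d = (SOME c. c \<in> A \<and> p \<in> cdom c)"
  have "d \<in> A \<and> p \<in> cdom d"
    unfolding d_def by (rule someI[of _ c]) (use assms in blast)
  then have d: "d \<in> A" "p \<in> cdom d"
    by auto
  let ?f = "\<lambda>c. frechet_derivative (f \<circ> cinv c) (at (cmap c p))"
  have "((\<lambda>x. f (cinv d (cmap d (cinv c x)))) has_derivative (\<lambda>v. ?f d (transition c d p v))) (at (cmap c p))"
    by (rule has_derivative_compose[OF has_derivative_transition[OF assms(5) d(1) assms(6) d(2)]])
      (use smooth_fun_on_has_derivative[OF assms(2,3) d] cinv_cmap[OF assms(5,6)] in \<open>simp add: comp_def\<close>)
  then have "((\<lambda>x. f (cinv c x)) has_derivative (\<lambda>v. ?f d (transition c d p v))) (at (cmap c p))"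
    by (rule has_derivative_transform_within_open[OF _ open_chart_image[OF assms(5) open_cdom[OF d(1)]]])
      (use assms d in auto)
  then have "?f c = (\<lambda>v. ?f d (transition c d p v))"
    unfolding comp_def by (simp add: frechet_derivative_eqI)
  then have "?f c (v c) = ?f d (v d)"
    using tangent_space_transition[OF assms(4,5) d(1) assms(6) d(2)] by simp
  then show ?thesis
    by (simp add: dir_deriv_def Let_def d_def)
qed

text \<open>The conditions shared by \<open>geodesic\<close> and
  \<open>intrinsic_geodesic\<close>.\<close>

definition curve :: "real set \<Rightarrow> (real \<Rightarrow> 'a) \<Rightarrow> bool"
  where "curve I \<gamma> \<longleftrightarrow> is_interval I \<and> interior I \<noteq> {} \<and> smooth_curve A I \<gamma>"

text \<open>A connected set with more than one point has no isolated point. The uniqueness of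
  derivatives within \<open>I\<close>, at end points too, rests on this.\<close>

lemma curve_at_within_neq_bot:
  assumes "curve I \<gamma>" "t \<in> I"
  shows "at t within I \<noteq> bot"
proof -
  have "connected I"
    using assms by (simp add: curve_def is_interval_connected)
  moreover have "I \<noteq> {x}" for x
    using assms by (auto simp: curve_def)
  ultimately show ?thesis
    using connected_imp_perfect[of I t] assms(2) by (auto simp: trivial_limit_within)
qed

text \<open>The smooth extension \<open>f\<close> beyond the end points turns derivatives within
  \<open>I\<close> into ordinary ones. The coordinates of the velocity thus agree with a function
  that is smooth on a full ball around \<open>t\<close>.\<close>

lemma curve_coordinates:
  assumes "curve I \<gamma>" "t \<in> I" "c \<in> A" "\<gamma> t \<in> cdom c"
  obtains e f where "e > 0" "smooth_on f (ball t e)"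
    "\<And>s. s \<in> I \<inter> ball t e \<Longrightarrow> \<gamma> s \<in> cdom c \<and> cmap c (\<gamma> s) = f s \<and>
      ((\<lambda>s. cmap c (\<gamma> s)) has_vector_derivative velocity A I \<gamma> s c) (at s within I) \<and>
      velocity A I \<gamma> s c = frechet_derivative f (at s) 1"
proof -
  obtain e f where ef: "e > 0" "smooth_on f (ball t e)"
    "\<And>s. s \<in> I \<inter> ball t e \<Longrightarrow> \<gamma> s \<in> cdom c \<and> cmap c (\<gamma> s) = f s"
    using assms unfolding curve_def smooth_curve_def by meson
  have "((\<lambda>s. cmap c (\<gamma> s)) has_vector_derivative velocity A I \<gamma> s c) (at s within I) \<and>
      velocity A I \<gamma> s c = frechet_derivative f (at s) 1" if s: "s \<in> I \<inter> ball t e" for s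
  proof -
    have "(f has_vector_derivative frechet_derivative f (at s) 1) (at s within I)"
      by (rule has_vector_derivative_at_within[OF smooth_on_has_vector_derivative[OF ef(2)]]) (use s in auto)
    moreover obtain r where r: "r > 0" "ball s r \<subseteq> ball t e"
      using s open_ball openE by blast
    ultimately have 1: "((\<lambda>s. cmap c (\<gamma> s)) has_vector_derivative frechet_derivative f (at s) 1) (at s within I)"
      using s ef(3) by (elim has_vector_derivative_transform_within[OF _ r(1)]) (auto simp: dist_commute subset_iff)
    then have "velocity A I \<gamma> s c = frechet_derivative f (at s) 1"
      unfolding velocity_def
      using ef(3)[OF s] assms(3) s vector_derivative_within[OF curve_at_within_neq_bot[OF assms(1)] 1] by simp
    then show ?thesis
      using 1 by simp
  qed
  then show ?thesis
    using that ef by blast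
qed

lemma curve_has_vector_derivative:
  assumes "curve I \<gamma>" "t \<in> I" "c \<in> A" "\<gamma> t \<in> cdom c"
  shows "((\<lambda>s. cmap c (\<gamma> s)) has_vector_derivative velocity A I \<gamma> t c) (at t within I)"
  using curve_coordinates[OF assms] assms(2) by (metis IntI centre_in_ball)

lemma curve_continuous_on:
  assumes "curve I \<gamma>"
  shows "continuous_on I \<gamma>"
proof -
  have "continuous (at t within I) \<gamma>" if t: "t \<in> I" for t
  proof -
    obtain c where c: "c \<in> A" "\<gamma> t \<in> cdom c"
      by (rule chart_exists)
    obtain e f where ef: "e > 0" "smooth_on f (ball t e)"
      "\<And>s. s \<in> I \<inter> ball t e \<Longrightarrow> \<gamma> s \<in> cdom c \<and> cmap c (\<gamma> s) = f s"
      using curve_coordinates[OF assms t c] by metis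
    have "continuous_on (I \<inter> ball t e) (\<lambda>s. cinv c (f s))"
      by (rule continuous_on_compose2[OF continuous_on_cinv[OF c(1)]
            continuous_on_subset[OF smooth_on_continuous_on[OF ef(2)]]])
        (use ef(3) in \<open>force+\<close>)
    then have "continuous_on (I \<inter> ball t e) \<gamma>"
      by (rule continuous_on_eq) (use ef(3) c in \<open>metis cinv_cmap\<close>)
    then have "continuous (at t within (I \<inter> ball t e)) \<gamma>"
      using t ef(1) by (simp add: continuous_on_eq_continuous_within)
    moreover have "at t within (I \<inter> ball t e) = at t within I"
      by (rule at_within_nhd[of _ "ball t e"]) (use ef(1) in auto)
    ultimately show ?thesis
      by (simp add: continuous_within)
  qed
  then show ?thesis
    by (simp add: continuous_on_eq_continuous_within)
qed

lemma velocity_tangent: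
  assumes "curve I \<gamma>" "t \<in> I"
  shows "velocity A I \<gamma> t \<in> tangent_space A (\<gamma> t)"
proof -
  have "velocity A I \<gamma> t d = transition c d (\<gamma> t) (velocity A I \<gamma> t c)"
    if cd: "c \<in> A" "d \<in> A" "\<gamma> t \<in> cdom c" "\<gamma> t \<in> cdom d" for c d
  proof -
    obtain e f where ef: "e > 0" "smooth_on f (ball t e)"
      "\<And>s. s \<in> I \<inter> ball t e \<Longrightarrow> \<gamma> s \<in> cdom c \<and> cmap c (\<gamma> s) = f s"
      using curve_coordinates[OF assms cd(1,3)] by metis
    note 1 = curve_has_vector_derivative[OF assms cd(1,3)]
    have "((\<lambda>s. cmap d (cinv c (cmap c (\<gamma> s)))) has_derivative
        (\<lambda>h. transition c d (\<gamma> t) (h *\<^sub>R velocity A I \<gamma> t c))) (at t within I)"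
      by (rule has_derivative_compose[OF 1[unfolded has_vector_derivative_def]])
        (use has_derivative_transition[OF cd] in simp)
    then have "((\<lambda>s. cmap d (cinv c (cmap c (\<gamma> s)))) has_vector_derivative
        transition c d (\<gamma> t) (velocity A I \<gamma> t c)) (at t within I)"
      by (simp add: has_vector_derivative_def linear_cmul[OF linear_transition[OF cd]])
    then have "((\<lambda>s. cmap d (\<gamma> s)) has_vector_derivative
        transition c d (\<gamma> t) (velocity A I \<gamma> t c)) (at t within I)"
    proof (rule has_vector_derivative_transform_within[OF _ ef(1) assms(2)])
      show "cmap d (cinv c (cmap c (\<gamma> s))) = cmap d (\<gamma> s)" if "s \<in> I" "dist s t < e" for s
        using ef(3)[of s] that cinv_cmap[OF cd(1), of "\<gamma> s"] by (simp add: dist_commute)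
    qed
    then show ?thesis
      using vector_derivative_within[OF curve_at_within_neq_bot[OF assms]] cd
      by (auto simp: velocity_def)
  qed
  then show ?thesis
    by (rule tangent_spaceI[rotated]) (auto simp: velocity_def)
qed

lemma curve_chain_rule:
  assumes "curve I \<gamma>" "t \<in> I" "open U" "smooth_fun_on A U h" "\<gamma> t \<in> U"
  shows "((\<lambda>s. h (\<gamma> s)) has_real_derivative dir_deriv A (\<gamma> t) (velocity A I \<gamma> t) h) (at t within I)"
proof -
  obtain c where c: "c \<in> A" "\<gamma> t \<in> cdom c"
    by (rule chart_exists)
  obtain e f where ef: "e > 0" "smooth_on f (ball t e)"
    "\<And>s. s \<in> I \<inter> ball t e \<Longrightarrow> \<gamma> s \<in> cdom c \<and> cmap c (\<gamma> s) = f s"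
    using curve_coordinates[OF assms(1,2) c] by metis
  note 1 = curve_has_vector_derivative[OF assms(1,2) c]
  note 2 = smooth_fun_on_has_derivative[OF assms(4,5) c]
  let ?d = "frechet_derivative (h \<circ> cinv c) (at (cmap c (\<gamma> t)))"
  have "((\<lambda>s. h (cinv c (cmap c (\<gamma> s)))) has_derivative
      (\<lambda>r. ?d (r *\<^sub>R velocity A I \<gamma> t c))) (at t within I)"
    by (rule has_derivative_compose[OF 1[unfolded has_vector_derivative_def] 2])
  then have "((\<lambda>s. h (\<gamma> s)) has_derivative (\<lambda>r. ?d (r *\<^sub>R velocity A I \<gamma> t c))) (at t within I)"
  proof (rule has_derivative_transform_within[OF _ ef(1) assms(2)])
    show "h (cinv c (cmap c (\<gamma> s))) = h (\<gamma> s)" if "s \<in> I" "dist s t < e" for s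
      using ef(3)[of s] that cinv_cmap[OF c(1), of "\<gamma> s"] by (simp add: dist_commute)
  qed
  moreover have "?d (velocity A I \<gamma> t c) = dir_deriv A (\<gamma> t) (velocity A I \<gamma> t) h"
    using dir_deriv_eq[OF assms(3-5) velocity_tangent[OF assms(1,2)] c] by simp
  ultimately show ?thesis
    by (simp add: has_field_derivative_def linear_cmul[OF has_derivative_linear[OF 2]] mult_commute_abs)
qed

text \<open>The ball is shrunk until the extension \<open>f\<close> itself, and not only the curve,
  stays over \<open>U\<close>; this is what allows composing functions on \<open>U\<close> with
  it.\<close>

lemma curve_coordinates_in:
  assumes "curve I \<gamma>" "t \<in> I" "c \<in> A" "\<gamma> t \<in> cdom c" "open U" "\<gamma> t \<in> U"
  obtains e f where "e > 0" "smooth_on f (ball t e)" "f ` ball t e \<subseteq> cmap c ` (U \<inter> cdom c)"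
    "\<And>s. s \<in> I \<inter> ball t e \<Longrightarrow> \<gamma> s \<in> U \<and> \<gamma> s \<in> cdom c \<and> \<gamma> s = cinv c (f s) \<and>
      velocity A I \<gamma> s c = frechet_derivative f (at s) 1"
proof -
  obtain e f where ef: "e > 0" "smooth_on f (ball t e)"
    "\<And>s. s \<in> I \<inter> ball t e \<Longrightarrow> \<gamma> s \<in> cdom c \<and> cmap c (\<gamma> s) = f s \<and>
      velocity A I \<gamma> s c = frechet_derivative f (at s) 1"
    using curve_coordinates[OF assms(1-4)] by metis
  let ?W = "cmap c ` (U \<inter> cdom c)"
  have "open (ball t e \<inter> f -` ?W)"
    by (rule continuous_open_preimage[OF smooth_on_continuous_on[OF ef(2)] open_ball open_chart_image[OF assms(3,5)]])
  moreover have "cmap c (\<gamma> t) \<in> ?W"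
    using assms(4,6) by blast
  then have "t \<in> ball t e \<inter> f -` ?W"
    using ef(1) ef(3)[of t] assms(2) by simp
  ultimately obtain r where r: "r > 0" "ball t r \<subseteq> ball t e \<inter> f -` ?W"
    using openE by blast
  have "\<gamma> s \<in> U \<and> \<gamma> s \<in> cdom c \<and> \<gamma> s = cinv c (f s) \<and>
      velocity A I \<gamma> s c = frechet_derivative f (at s) 1" if s: "s \<in> I \<inter> ball t r" for s
  proof -
    have "\<gamma> s \<in> cdom c" "cmap c (\<gamma> s) = f s" "velocity A I \<gamma> s c = frechet_derivative f (at s) 1"
      using ef(3)[of s] s r by auto
    moreover have "f s \<in> ?W"
      using s r by auto
    ultimately show ?thesis
      using in_chart_image_iff[OF assms(3), of "f s" U] cinv_cmap[OF assms(3), of "\<gamma> s"] by simp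
  qed
  then show ?thesis
    using that[of r f] r smooth_on_subset[OF ef(2)] by blast
qed

lemma chart_curve:
  assumes c: "c \<in> A" and h: "h > 0" "smooth_on x {-h<..<h}" "\<And>t. t \<in> {-h<..<h} \<Longrightarrow> x t \<in> cmap c ` cdom c"
  shows "curve {-h<..<h} (\<lambda>t. cinv c (x t))"
    and "t \<in> {-h<..<h} \<Longrightarrow> (x has_vector_derivative x') (at t) \<Longrightarrow>
      velocity A {-h<..<h} (\<lambda>t. cinv c (x t)) t = lift c (cinv c (x t)) x'"
proof -
  let ?I = "{-h<..<h}" and ?g = "\<lambda>t. cinv c (x t)"
  have "smooth_curve A ?I ?g"
    unfolding smooth_curve_def
  proof (intro ballI impI)
    fix t d assume t: "t \<in> ?I" and d: "d \<in> A" "?g t \<in> cdom d"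
    \<comment> \<open>Smoothness is tested in every chart \<open>d\<close>, so near \<open>t\<close>
      the curve is kept in the overlap of \<open>c\<close> and \<open>d\<close>.\<close>
    let ?W = "cmap c ` (cdom d \<inter> cdom c)"
    have "open (?I \<inter> x -` ?W)"
      using c d open_chart_image open_cdom
      by (intro continuous_open_preimage[OF smooth_on_continuous_on[OF h(2)]]) auto
    moreover have "t \<in> ?I \<inter> x -` ?W"
      using t d h(3) c in_chart_image_iff by blast
    ultimately obtain r where r: "r > 0" "ball t r \<subseteq> ?I \<inter> x -` ?W"
      using openE by blast
    have "smooth_on (\<lambda>s. cmap d (cinv c (x s))) (ball t r)"
      by (rule smooth_on_compose[OF smooth_transition[OF c d(1)] open_ball smooth_on_subset[OF h(2)]])
        (use r in auto)
    moreover have "cinv c (x s) \<in> cdom d" if "s \<in> ball t r" for s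
      using r(2) that in_chart_image_iff[OF c, of "x s" "cdom d"] by blast
    ultimately show "\<exists>e>0. \<exists>f. smooth_on f (ball t e) \<and>
        (\<forall>s\<in>?I \<inter> ball t e. ?g s \<in> cdom d \<and> cmap d (?g s) = f s)"
      using r(1) by blast
  qed
  then show cur: "curve ?I ?g"
    using h(1) by (auto simp: curve_def is_interval_oo)
  assume t: "t \<in> ?I" and x': "(x has_vector_derivative x') (at t)"
  have gt: "?g t \<in> cdom c"
    using h(3)[OF t] c cinv_in_cdom by blast
  show "velocity A ?I ?g t = lift c (?g t) x'"
  proof (rule tangent_space_eqI[OF velocity_tangent[OF cur t] lift_tangent[OF c gt] c gt])
    have "(x has_vector_derivative x') (at t within ?I)"
      using x' by (rule has_vector_derivative_at_within)
    then have "((\<lambda>s. cmap c (?g s)) has_vector_derivative x') (at t within ?I)"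
      by (rule has_vector_derivative_transform[OF t, rotated]) (use h(3) c in \<open>metis cmap_cinv\<close>)
    then show "velocity A ?I ?g t c = lift c (?g t) x' c"
      using vector_derivative_within[OF curve_at_within_neq_bot[OF cur t]] c gt by (auto simp: velocity_def)
  qed
qed

end

section \<open>Finite families of vectors\<close>

lemma span_family:
  fixes F :: "nat \<Rightarrow> 'v::real_vector"
  shows "span (F ` {..<m}) = range (\<lambda>a. \<Sum>i<m. a i *\<^sub>R F i)"
proof
  have "subspace (range (\<lambda>a. \<Sum>i<m. a i *\<^sub>R F i))"
  proof (rule subspaceI)
    show "0 \<in> range (\<lambda>a. \<Sum>i<m. a i *\<^sub>R F i)"
      by (rule range_eqI[of _ _ "\<lambda>_. 0"]) simp
    fix x y c assume "x \<in> range (\<lambda>a. \<Sum>i<m. a i *\<^sub>R F i)"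
    then obtain a where a: "x = (\<Sum>i<m. a i *\<^sub>R F i)"
      by blast
    show "c *\<^sub>R x \<in> range (\<lambda>a. \<Sum>i<m. a i *\<^sub>R F i)"
      by (rule range_eqI[of _ _ "\<lambda>i. c * a i"]) (simp add: a scaleR_sum_right)
    assume "y \<in> range (\<lambda>a. \<Sum>i<m. a i *\<^sub>R F i)"
    then obtain b where b: "y = (\<Sum>i<m. b i *\<^sub>R F i)"
      by blast
    show "x + y \<in> range (\<lambda>a. \<Sum>i<m. a i *\<^sub>R F i)"
      by (rule range_eqI[of _ _ "\<lambda>i. a i + b i"]) (simp add: a b scaleR_left_distrib sum.distrib)
  qed
  moreover have "F j \<in> range (\<lambda>a. \<Sum>i<m. a i *\<^sub>R F i)" if "j < m" for j
    by (rule range_eqI[of _ _ "\<lambda>i. if i = j then 1 else 0"]) (use that in \<open>simp add: if_distrib[of "\<lambda>x. x *\<^sub>R _"] cong: if_cong\<close>)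
  ultimately show "span (F ` {..<m}) \<subseteq> range (\<lambda>a. \<Sum>i<m. a i *\<^sub>R F i)"
    by (intro span_minimal) auto
  show "range (\<lambda>a. \<Sum>i<m. a i *\<^sub>R F i) \<subseteq> span (F ` {..<m})"
    by (rule image_subsetI, rule span_sum, rule span_scale, rule span_base) simp
qed

lemma independent_familyI:
  fixes F :: "nat \<Rightarrow> 'v::real_vector"
  assumes "\<And>a i. (\<Sum>i<m. a i *\<^sub>R F i) = 0 \<Longrightarrow> i < m \<Longrightarrow> a i = 0"
  shows "inj_on F {..<m}" "independent (F ` {..<m})"
proof -
  show inj: "inj_on F {..<m}"
  proof (rule inj_onI, rule ccontr)
    fix i j assume ij: "i \<in> {..<m}" "j \<in> {..<m}" "F i = F j" "i \<noteq> j"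
    let ?a = "\<lambda>l. (if l = i then 1 else 0) - (if l = j then 1 else (0::real))"
    have "(\<Sum>l<m. ?a l *\<^sub>R F l) = F i - F j"
      using ij by (simp add: scaleR_left_diff_distrib sum_subtractf if_distrib[of "\<lambda>x. x *\<^sub>R _"] cong: if_cong)
    then have "?a i = 0"
      using assms[of ?a i] ij by simp
    then show False
      using ij by simp
  qed
  show "independent (F ` {..<m})"
  proof
    assume "dependent (F ` {..<m})"
    then obtain u v where "v \<in> F ` {..<m}" "u v \<noteq> 0" "(\<Sum>v\<in>F ` {..<m}. u v *\<^sub>R v) = 0"
      by (auto simp: dependent_finite)
    then show False
      using assms[of "\<lambda>i. u (F i)"] inj by (auto simp: sum.reindex)
  qed
qed

lemma independent_family_not_in_span:
  fixes F :: "nat \<Rightarrow> 'v::real_vector"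
  assumes "inj_on F {..<k}" "independent (F ` {..<k})" "m < k"
  shows "F m \<notin> span (F ` {..<m})"
proof
  assume "F m \<in> span (F ` {..<m})"
  moreover have "F ` {..<m} \<subseteq> F ` {..<k} - {F m}"
    using assms(1,3) by (auto simp: inj_on_def)
  ultimately have "F m \<in> span (F ` {..<k} - {F m})"
    using span_mono by blast
  then show False
    using assms(2,3) by (auto simp: dependent_def)
qed

section \<open>Orthogonal frames\<close>

locale riemannian = manifold A
  for A :: "('a::{t2_space, second_countable_topology}, 'e::euclidean_space) chart set" +
  fixes g :: "'a \<Rightarrow> ('a, 'e) tvec \<Rightarrow> ('a, 'e) tvec \<Rightarrow> real"
  assumes riemannian_metric: "riemannian_metric A g"
begin

abbreviation T :: "'a \<Rightarrow> ('a, 'e) tvec set" where "T \<equiv> tangent_space A"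

lemmas T_add = subspace_add[OF subspace_tangent_space]
lemmas T_diff = subspace_diff[OF subspace_tangent_space]
lemmas T_scale = subspace_scale[OF subspace_tangent_space]
lemmas T_sum = subspace_sum[OF subspace_tangent_space]
lemmas T_zero [simp] = subspace_0[OF subspace_tangent_space]

lemma g_comb: "u \<in> T p \<Longrightarrow> v \<in> T p \<Longrightarrow> w \<in> T p \<Longrightarrow>
    g p (a *\<^sub>R u + b *\<^sub>R v) w = a * g p u w + b * g p v w"
  using conjunct1[OF riemannian_metric[unfolded riemannian_metric_def]] by blast

lemma g_sym: "u \<in> T p \<Longrightarrow> v \<in> T p \<Longrightarrow> g p u v = g p v u"
  using conjunct1[OF conjunct2[OF riemannian_metric[unfolded riemannian_metric_def]]] by blast

lemma g_pos: "u \<in> T p \<Longrightarrow> u \<noteq> 0 \<Longrightarrow> g p u u > 0"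
  using conjunct1[OF conjunct2[OF conjunct2[OF riemannian_metric[unfolded riemannian_metric_def]]]] by blast

lemma g_smooth: "open U \<Longrightarrow> smooth_vfield_on A U X \<Longrightarrow> smooth_vfield_on A U Y \<Longrightarrow>
    smooth_fun_on A U (\<lambda>p. g p (X p) (Y p))"
  using conjunct2[OF conjunct2[OF conjunct2[OF riemannian_metric[unfolded riemannian_metric_def]]]] by simp

lemma g_add_left: "u \<in> T p \<Longrightarrow> v \<in> T p \<Longrightarrow> w \<in> T p \<Longrightarrow> g p (u + v) w = g p u w + g p v w"
  using g_comb[of u p v w 1 1] by simp

lemma g_scale_left: "u \<in> T p \<Longrightarrow> w \<in> T p \<Longrightarrow> g p (a *\<^sub>R u) w = a * g p u w"
  using g_comb[of u p u w a 0] by simp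

lemma g_zero_left [simp]: "w \<in> T p \<Longrightarrow> g p 0 w = 0"
  using g_scale_left[of w p w 0] by simp

lemma g_diff_left: "u \<in> T p \<Longrightarrow> v \<in> T p \<Longrightarrow> w \<in> T p \<Longrightarrow> g p (u - v) w = g p u w - g p v w"
  using g_comb[of u p v w 1 "-1"] by simp

lemma g_sum_left: "(\<And>i. i \<in> I \<Longrightarrow> F i \<in> T p) \<Longrightarrow> w \<in> T p \<Longrightarrow>
    g p (\<Sum>i\<in>I. a i *\<^sub>R F i) w = (\<Sum>i\<in>I. a i * g p (F i) w)"
  by (induction I rule: infinite_finite_induct) (simp_all add: g_add_left g_scale_left T_sum T_scale)

lemma g_scale_right: "u \<in> T p \<Longrightarrow> w \<in> T p \<Longrightarrow> g p w (a *\<^sub>R u) = a * g p w u"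
  by (simp add: g_scale_left T_scale g_sym[of w])

lemma g_zero_right [simp]: "w \<in> T p \<Longrightarrow> g p w 0 = 0"
  by (simp add: g_sym[of w])

lemma g_sum_right: "(\<And>i. i \<in> I \<Longrightarrow> F i \<in> T p) \<Longrightarrow> w \<in> T p \<Longrightarrow>
    g p w (\<Sum>i\<in>I. a i *\<^sub>R F i) = (\<Sum>i\<in>I. a i * g p w (F i))"
  by (simp add: g_sum_left T_sum T_scale g_sym[of w])

lemma g_self_zero_iff: "u \<in> T p \<Longrightarrow> g p u u = 0 \<longleftrightarrow> u = 0"
  using g_pos[of u p] by force

text \<open>Vectors are nonzero but not normalized: the coefficients in \<open>coef\<close> are then
  quotients of smooth functions, and the property survives multiplication by a positive
  cutoff.\<close>

definition orthogonal_family :: "'a \<Rightarrow> nat \<Rightarrow> (nat \<Rightarrow> ('a, 'e) tvec) \<Rightarrow> bool"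
  where "orthogonal_family q m F \<longleftrightarrow> (\<forall>i<m. F i \<in> T q \<and> F i \<noteq> 0) \<and>
    (\<forall>i<m. \<forall>j<m. i \<noteq> j \<longrightarrow> g q (F i) (F j) = 0)"

definition coef :: "'a \<Rightarrow> (nat \<Rightarrow> ('a, 'e) tvec) \<Rightarrow> ('a, 'e) tvec \<Rightarrow> nat \<Rightarrow> real"
  where "coef q F v i = g q v (F i) / g q (F i) (F i)"

lemma orthogonal_family_inner:
  assumes "orthogonal_family q m F" "j < m"
  shows "g q (\<Sum>i<m. a i *\<^sub>R F i) (F j) = a j * g q (F j) (F j)"
proof -
  have "g q (\<Sum>i<m. a i *\<^sub>R F i) (F j) = (\<Sum>i<m. a i * g q (F i) (F j))"
    using assms by (intro g_sum_left) (auto simp: orthogonal_family_def)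
  also have "\<dots> = (\<Sum>i<m. if i = j then a j * g q (F j) (F j) else 0)"
    using assms by (intro sum.cong) (auto simp: orthogonal_family_def)
  finally show ?thesis
    using assms(2) by simp
qed

lemma orthogonal_family_pos:
  "orthogonal_family q m F \<Longrightarrow> j < m \<Longrightarrow> g q (F j) (F j) > 0"
  by (simp add: orthogonal_family_def g_pos)

lemma orthogonal_family_trivial:
  assumes "orthogonal_family q m F" "(\<Sum>i<m. a i *\<^sub>R F i) = 0" "j < m"
  shows "a j = 0"
  using orthogonal_family_inner[OF assms(1,3), of a] orthogonal_family_pos[OF assms(1,3)] assms
  by (simp add: orthogonal_family_def)

lemma orthogonal_family_expansion:
  assumes "orthogonal_family q m F" "v \<in> span (F ` {..<m})"
  shows "v = (\<Sum>i<m. coef q F v i *\<^sub>R F i)"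
proof -
  obtain a where a: "v = (\<Sum>i<m. a i *\<^sub>R F i)"
    using assms(2) by (auto simp: span_family)
  have "coef q F v j = a j" if "j < m" for j
    using orthogonal_family_inner[OF assms(1) that, of a] orthogonal_family_pos[OF assms(1) that]
    by (simp add: coef_def a)
  then show ?thesis
    using a by simp
qed

lemma orthogonal_family_span_le: "orthogonal_family q m F \<Longrightarrow> span (F ` {..<m}) \<subseteq> T q"
  by (rule span_minimal[OF _ subspace_tangent_space]) (auto simp: orthogonal_family_def)

lemma component_sum: "(\<Sum>i\<in>I. a i *\<^sub>R F i) c = (\<Sum>i\<in>I. a i *\<^sub>R F i c)"
  for F :: "nat \<Rightarrow> ('a, 'e) tvec"
  by (simp add: sum_fun_apply scaleR_fun_def)

text \<open>Tangent vectors live in a function space that carries no dimension theory of use here.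
  Taking the component in one chart is injective on the tangent space and moves the counting to
  \<open>'e\<close>.\<close>

lemma orthogonal_family_dim:
  assumes "orthogonal_family q m F"
  shows "m \<le> DIM('e)" and "m = DIM('e) \<Longrightarrow> span (F ` {..<m}) = T q"
proof -
  obtain c where c: "c \<in> A" "q \<in> cdom c"
    by (rule chart_exists)
  let ?G = "\<lambda>i. F i c"
  have FT: "F i \<in> T q" if "i < m" for i
    using assms that by (simp add: orthogonal_family_def)
  have triv: "a i = 0" if "(\<Sum>i<m. a i *\<^sub>R ?G i) = 0" "i < m" for a i
  proof (rule orthogonal_family_trivial[OF assms _ that(2)])
    show "(\<Sum>i<m. a i *\<^sub>R F i) = 0"
      by (rule tangent_space_eqI[OF _ T_zero c]) (use that(1) FT in \<open>auto intro!: T_sum T_scale simp: component_sum\<close>)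
  qed
  have ind: "inj_on ?G {..<m}" "independent (?G ` {..<m})"
    by (rule independent_familyI, erule (1) triv)+
  have card: "card (?G ` {..<m}) = m"
    using card_image[OF ind(1)] by simp
  then show "m \<le> DIM('e)"
    using independent_bound[OF ind(2)] by simp
  assume m: "m = DIM('e)"
  have "T q \<subseteq> span (F ` {..<m})"
  proof
    fix v assume v: "v \<in> T q"
    have "UNIV \<subseteq> span (?G ` {..<m})"
      by (rule card_ge_dim_independent[OF _ ind(2)]) (use card m in auto)
    then obtain a where a: "v c = (\<Sum>i<m. a i *\<^sub>R ?G i)"
      by (auto simp: span_family)
    have "v = (\<Sum>i<m. a i *\<^sub>R F i)"
      by (rule tangent_space_eqI[OF v _ c]) (use a FT in \<open>auto intro!: T_sum T_scale simp: component_sum\<close>)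
    then show "v \<in> span (F ` {..<m})"
      by (auto simp: span_family)
  qed
  then show "span (F ` {..<m}) = T q"
    using orthogonal_family_span_le[OF assms] by blast
qed

section \<open>Gram-Schmidt orthogonalization of vector fields\<close>

definition orthogonal_frame :: "'a set \<Rightarrow> nat \<Rightarrow> (nat \<Rightarrow> ('a, 'e) vfield) \<Rightarrow> bool"
  where "orthogonal_frame U m E \<longleftrightarrow> open U \<and> (\<forall>j<m. smooth_vfield_on A U (E j)) \<and>
    (\<forall>q\<in>U. orthogonal_family q m (\<lambda>j. E j q))"

lemma orthogonal_frame_subset:
  "orthogonal_frame U m E \<Longrightarrow> open V \<Longrightarrow> V \<subseteq> U \<Longrightarrow> orthogonal_frame V m E"
  unfolding orthogonal_frame_def using smooth_vfield_on_subset by blast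

text \<open>\<open>Y\<close> is \<open>X\<close> minus its projection onto the span of the frame. It
  is nonzero at \<open>p\<close> because \<open>X p\<close> lies outside that span, and it stays
  nonzero on a neighbourhood by continuity of \<open>g q (Y q) (Y q)\<close>; this is the reason for
  shrinking \<open>U\<close>.\<close>

lemma gram_schmidt_step:
  assumes fr: "orthogonal_frame U m E" and X: "smooth_vfield_on A U X" and p: "p \<in> U"
    and new: "X p \<notin> span ((\<lambda>j. E j p) ` {..<m})"
  obtains V Y where "p \<in> V" "V \<subseteq> U" "orthogonal_frame V (Suc m) (E(m := Y))"
    "\<And>q. q \<in> V \<Longrightarrow> span ((\<lambda>j. (E(m := Y)) j q) ` {..<Suc m}) =
      span (insert (X q) ((\<lambda>j. E j q) ` {..<m}))"
proof -
  have U: "open U" and E: "\<And>j. j < m \<Longrightarrow> smooth_vfield_on A U (E j)"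
    and orth: "\<And>q. q \<in> U \<Longrightarrow> orthogonal_family q m (\<lambda>j. E j q)"
    using fr by (auto simp: orthogonal_frame_def)
  define a where "a q j = coef q (\<lambda>j. E j q) (X q) j" for q j
  define Y where "Y = X + (\<Sum>j<m. (\<lambda>q. (- 1 * a q j) *\<^sub>R E j q))"
  have Y_eq: "Y q = X q - (\<Sum>j<m. a q j *\<^sub>R E j q)" for q
    by (simp add: Y_def sum_fun_apply sum_negf)
  have a: "smooth_fun_on A U (\<lambda>q. a q j)" if "j < m" for j
    unfolding a_def coef_def
    by (intro smooth_fun_on_divide g_smooth U X E that)
      (use orthogonal_family_pos[OF orth that] in force)
  have Y: "smooth_vfield_on A U Y"
    unfolding Y_def
    by (intro smooth_vfield_on_add smooth_vfield_on_sum smooth_vfield_on_scale smooth_fun_on_mult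
      smooth_fun_on_const U X E a) auto
  have XT: "X q \<in> T q" and YT: "Y q \<in> T q" if "q \<in> U" for q
    using X Y smooth_vfield_on_tangent that by blast+
  have ET: "E j q \<in> T q" if "j < m" "q \<in> U" for j q
    using E smooth_vfield_on_tangent that by blast
  have Y_orth: "g q (Y q) (E j q) = 0" if "j < m" "q \<in> U" for j q
  proof -
    have "g q (Y q) (E j q) = g q (X q) (E j q) - a q j * g q (E j q) (E j q)"
      unfolding Y_eq using that orthogonal_family_inner[OF orth[OF that(2)] that(1)]
      by (subst g_diff_left) (auto intro!: T_sum T_scale XT ET)
    then show ?thesis
      using orthogonal_family_pos[OF orth[OF that(2)] that(1)] by (simp add: a_def coef_def)
  qed
  have in_span: "(\<Sum>j<m. a q j *\<^sub>R E j q) \<in> span ((\<lambda>j. E j q) ` {..<m})" for q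
    by (auto simp: span_family)
  have "Y p \<noteq> 0"
    using new in_span[of p] by (auto simp: Y_eq)
  define V where "V = U \<inter> (\<lambda>q. g q (Y q) (Y q)) -` (- {0})"
  have "open V"
    unfolding V_def
    by (intro continuous_open_preimage smooth_fun_on_continuous_on g_smooth U Y) auto
  have pV: "p \<in> V" "V \<subseteq> U"
    using p \<open>Y p \<noteq> 0\<close> g_self_zero_iff[OF YT[OF p]] by (auto simp: V_def)
  have Y0: "Y q \<noteq> 0" if "q \<in> V" for q
    using that g_self_zero_iff[OF YT] by (auto simp: V_def)
  have "orthogonal_family q (Suc m) (\<lambda>j. (E(m := Y)) j q)" if "q \<in> V" for q
    using orth[of q] Y0[OF that] YT[of q] Y_orth[of _ q] g_sym[OF YT ET, of q _ ] that pV(2)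
    by (auto simp: orthogonal_family_def less_Suc_eq subset_iff)
  moreover have "smooth_vfield_on A V ((E(m := Y)) j)" if "j < Suc m" for j
    using that E Y pV(2) by (auto simp: less_Suc_eq intro: smooth_vfield_on_subset)
  ultimately have "orthogonal_frame V (Suc m) (E(m := Y))"
    using \<open>open V\<close> unfolding orthogonal_frame_def by blast
  moreover have "span ((\<lambda>j. (E(m := Y)) j q) ` {..<Suc m}) =
      span (insert (X q) ((\<lambda>j. E j q) ` {..<m}))" if "q \<in> V" for q
  proof -
    have "(\<lambda>j. (E(m := Y)) j q) ` {..<Suc m} = insert (Y q) ((\<lambda>j. E j q) ` {..<m})"
      by (auto simp: lessThan_Suc)
    moreover have "Y q - X q \<in> span ((\<lambda>j. E j q) ` {..<m})"
      using span_neg[OF in_span[of q]] by (simp add: Y_eq)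
    ultimately show ?thesis
      by (simp add: eq_span_insert_eq)
  qed
  ultimately show ?thesis
    using that pV by blast
qed

lemma gram_schmidt:
  assumes "open U" "p \<in> U" "\<And>j. j < k \<Longrightarrow> smooth_vfield_on A U (X j)"
    and "\<And>q. q \<in> U \<Longrightarrow> inj_on (\<lambda>j. X j q) {..<k} \<and> independent ((\<lambda>j. X j q) ` {..<k})"
  shows "m \<le> k \<Longrightarrow> \<exists>V E. p \<in> V \<and> V \<subseteq> U \<and> orthogonal_frame V m E \<and>
    (\<forall>q\<in>V. span ((\<lambda>j. E j q) ` {..<m}) = span ((\<lambda>j. X j q) ` {..<m}))"
proof (induction m)
  case 0
  then show ?case
    using assms(1,2) by (intro exI[of _ U]) (auto simp: orthogonal_frame_def orthogonal_family_def)
next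
  case (Suc m)
  then obtain V E where V: "p \<in> V" "V \<subseteq> U" "orthogonal_frame V m E"
    "\<And>q. q \<in> V \<Longrightarrow> span ((\<lambda>j. E j q) ` {..<m}) = span ((\<lambda>j. X j q) ` {..<m})"
    by auto
  have "X m p \<notin> span ((\<lambda>j. E j p) ` {..<m})"
    using independent_family_not_in_span[of "\<lambda>j. X j p" k m] assms(4)[OF assms(2)] V(4)[OF V(1)] Suc.prems
    by simp
  moreover have "smooth_vfield_on A V (X m)"
    using assms(3)[of m] Suc.prems V(2) smooth_vfield_on_subset by auto
  ultimately obtain W Y where W: "p \<in> W" "W \<subseteq> V" "orthogonal_frame W (Suc m) (E(m := Y))"
    "\<And>q. q \<in> W \<Longrightarrow> span ((\<lambda>j. (E(m := Y)) j q) ` {..<Suc m}) = span (insert (X m q) ((\<lambda>j. E j q) ` {..<m}))"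
    using gram_schmidt_step[OF V(3) _ V(1), of "X m"] by metis
  have sp: "span ((\<lambda>j. (E(m := Y)) j q) ` {..<Suc m}) = span ((\<lambda>j. X j q) ` {..<Suc m})" if "q \<in> W" for q
  proof -
    have "span (insert (X m q) ((\<lambda>j. E j q) ` {..<m})) = span (insert (X m q) ((\<lambda>j. X j q) ` {..<m}))"
      using V(4)[of q] that W(2) by (auto simp: span_insert)
    then show ?thesis
      using W(4)[OF that] by (simp add: lessThan_Suc)
  qed
  show ?case
    using W(1-3) V(2) sp by blast
qed

text \<open>While fewer than \<open>DIM('e)\<close> fields are present, some coordinate field
  \<open>lift c q b\<close> lies outside their span at \<open>p\<close>, by counting dimensions in
  the chart component. The Gram-Schmidt step then adds one field.\<close>

lemma orthogonal_frame_extend: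
  assumes "orthogonal_frame U k E" "p \<in> U"
  shows "k \<le> m \<Longrightarrow> m \<le> DIM('e) \<Longrightarrow> \<exists>V F. p \<in> V \<and> V \<subseteq> U \<and> orthogonal_frame V m F \<and> (\<forall>j<k. F j = E j)"
proof (induction m rule: dec_induct)
  case base
  then show ?case
    using assms by blast
next
  case (step m)
  then obtain V F where V: "p \<in> V" "V \<subseteq> U" "orthogonal_frame V m F" "\<And>j. j < k \<Longrightarrow> F j = E j"
    by auto
  obtain c where c: "c \<in> A" "p \<in> cdom c"
    by (rule chart_exists)
  have "\<exists>b\<in>Basis. lift c p b \<notin> span ((\<lambda>j. F j p) ` {..<m})"
  proof (rule ccontr)
    assume "\<not> ?thesis"
    then have "(\<Sum>b\<in>Basis. (u \<bullet> b) *\<^sub>R lift c p b) \<in> span ((\<lambda>j. F j p) ` {..<m})" for u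
      by (intro span_sum span_scale) auto
    then have *: "lift c p u \<in> span ((\<lambda>j. F j p) ` {..<m})" for u
      by (metis lift_sum_Basis[OF c])
    have "u \<in> span ((\<lambda>j. F j p c) ` {..<m})" for u
    proof -
      obtain a where "lift c p u = (\<Sum>i<m. a i *\<^sub>R F i p)"
        using *[of u] by (auto simp: span_family)
      then have "u = (\<Sum>i<m. a i *\<^sub>R F i p c)"
        using lift_component[OF c, of u] component_sum by simp
      then show ?thesis
        by (auto simp: span_family)
    qed
    then have "dim (UNIV :: 'e set) \<le> card ((\<lambda>j. F j p c) ` {..<m})"
      by (intro dim_le_card) auto
    also have "\<dots> \<le> m"
      using card_image_le[of "{..<m}"] by force
    finally show False
      using step by simp
  qed
  then obtain b where b: "lift c p b \<notin> span ((\<lambda>j. F j p) ` {..<m})"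
    by blast
  have VC: "open (V \<inter> cdom c)"
    using V(3) open_cdom[OF c(1)] by (auto simp: orthogonal_frame_def)
  have X: "smooth_vfield_on A (V \<inter> cdom c) (\<lambda>q. lift c q b)"
    by (rule smooth_vfield_on_chartI[where \<xi> = "\<lambda>_. b", OF c(1) VC _ smooth_on_const]) simp
  have fr: "orthogonal_frame (V \<inter> cdom c) m F"
    by (rule orthogonal_frame_subset[OF V(3) VC]) simp
  have pV: "p \<in> V \<inter> cdom c"
    using V(1) c(2) by simp
  obtain W Y where W: "p \<in> W" "W \<subseteq> V \<inter> cdom c" "orthogonal_frame W (Suc m) (F(m := Y))"
    using gram_schmidt_step[OF fr X pV b] by metis
  have "\<forall>j<k. (F(m := Y)) j = E j"
    using V(4) step(1) by simp
  then show ?case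
    using W V(2) by blast
qed

text \<open>The fields of an adapted frame are global; the frame property holds only over \<open>U\<close>, and
  elsewhere the fields may vanish.\<close>

definition adapted_frame :: "('a \<Rightarrow> ('a, 'e) tvec set) \<Rightarrow> nat \<Rightarrow> 'a set \<Rightarrow> (nat \<Rightarrow> ('a, 'e) vfield) \<Rightarrow> bool"
  where "adapted_frame D k U E \<longleftrightarrow> open U \<and> k \<le> DIM('e) \<and> (\<forall>j<DIM('e). E j \<in> vfields A) \<and>
    (\<forall>j<k. \<forall>q. E j q \<in> D q) \<and>
    (\<forall>j. k \<le> j \<and> j < DIM('e) \<longrightarrow> (\<forall>q. \<forall>u\<in>D q. g q u (E j q) = 0)) \<and>
    (\<forall>q\<in>U. orthogonal_family q DIM('e) (\<lambda>j. E j q) \<and> D q = span ((\<lambda>j. E j q) ` {..<k}))"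

lemma regular_distribution_subspace:
  assumes "regular_distribution A D"
  shows "subspace (D q)" "D q \<subseteq> T q"
proof -
  from assms[unfolded regular_distribution_def] obtain k :: nat where
    k: "\<forall>p. \<exists>U E. open U \<and> p \<in> U \<and> (\<forall>i<k. smooth_vfield_on A U (E i)) \<and>
        (\<forall>q\<in>U. inj_on (\<lambda>i. E i q) {..<k} \<and> independent ((\<lambda>i. E i q) ` {..<k}) \<and>
           D q = span ((\<lambda>i. E i q) ` {..<k}))" ..
  from k[rule_format, of q] obtain U E where U: "q \<in> U" "\<And>i. i < k \<Longrightarrow> smooth_vfield_on A U (E i)"
    "D q = span ((\<lambda>i. E i q) ` {..<k})"
    by blast
  show "subspace (D q)"
    by (simp add: U)
  show "D q \<subseteq> T q"
    unfolding U(3) using smooth_vfield_on_tangent U(1,2)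
    by (intro span_minimal[OF _ subspace_tangent_space]) auto
qed

text \<open>Orthogonalize a local frame of \<open>D\<close>, complete it to a frame of the tangent
  spaces, and multiply by a bump function. Where the fields are cut off to 0, they belong to
  \<open>D\<close> and are orthogonal to it, so these two conditions hold everywhere.\<close>

lemma adapted_frame_exists:
  assumes "regular_distribution A D"
  obtains k where "\<And>p. \<exists>U E. p \<in> U \<and> adapted_frame D k U E"
proof -
  from assms[unfolded regular_distribution_def] obtain k :: nat where
    k: "\<forall>p. \<exists>U E. open U \<and> p \<in> U \<and> (\<forall>i<k. smooth_vfield_on A U (E i)) \<and>
        (\<forall>q\<in>U. inj_on (\<lambda>i. E i q) {..<k} \<and> independent ((\<lambda>i. E i q) ` {..<k}) \<and>
           D q = span ((\<lambda>i. E i q) ` {..<k}))" ..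
  have "\<exists>U E. p \<in> U \<and> adapted_frame D k U E" for p
  proof -
    from k[rule_format, of p] obtain U0 E0 where *: "open U0 \<and> p \<in> U0 \<and> (\<forall>i<k. smooth_vfield_on A U0 (E0 i)) \<and>
        (\<forall>q\<in>U0. inj_on (\<lambda>i. E0 i q) {..<k} \<and> independent ((\<lambda>i. E0 i q) ` {..<k}) \<and>
           D q = span ((\<lambda>i. E0 i q) ` {..<k}))"
      by (elim exE)
    have 0: "open U0" "p \<in> U0" "\<And>i. i < k \<Longrightarrow> smooth_vfield_on A U0 (E0 i)"
      "\<And>q. q \<in> U0 \<Longrightarrow> inj_on (\<lambda>i. E0 i q) {..<k} \<and> independent ((\<lambda>i. E0 i q) ` {..<k})"
      "\<And>q. q \<in> U0 \<Longrightarrow> D q = span ((\<lambda>i. E0 i q) ` {..<k})"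
      using * by simp_all
    obtain U1 E1 where 1: "p \<in> U1" "U1 \<subseteq> U0" "orthogonal_frame U1 k E1"
      "\<And>q. q \<in> U1 \<Longrightarrow> span ((\<lambda>j. E1 j q) ` {..<k}) = span ((\<lambda>j. E0 j q) ` {..<k})"
      using gram_schmidt[OF 0(1,2), of k E0 k] 0(3,4) by blast
    have kn: "k \<le> DIM('e)"
      using 1(1,3) orthogonal_family_dim(1) by (auto simp: orthogonal_frame_def)
    obtain U F where F: "p \<in> U" "U \<subseteq> U1" "orthogonal_frame U DIM('e) F" "\<And>j. j < k \<Longrightarrow> F j = E1 j"
      using orthogonal_frame_extend[OF 1(3,1) kn] by blast
    have U: "open U" and orth: "\<And>q. q \<in> U \<Longrightarrow> orthogonal_family q DIM('e) (\<lambda>j. F j q)"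
      and F_smooth: "\<And>j. j < DIM('e) \<Longrightarrow> smooth_vfield_on A U (F j)"
      using F(3) by (auto simp: orthogonal_frame_def)
    have FT: "F j q \<in> T q" if "j < DIM('e)" "q \<in> U" for j q
      using F_smooth smooth_vfield_on_tangent that by blast
    have D_span: "D q = span ((\<lambda>j. F j q) ` {..<k})" if "q \<in> U" for q
    proof -
      have "(\<lambda>j. F j q) ` {..<k} = (\<lambda>j. E1 j q) ` {..<k}"
        using F(4) by auto
      moreover have "q \<in> U1" "q \<in> U0"
        using that F(2) 1(2) by auto
      ultimately show ?thesis
        using 1(4)[of q] 0(5)[of q] by simp
    qed
    obtain \<phi> K where \<phi>: "smooth_fun_on A UNIV \<phi>" "\<phi> p > 0" "\<And>q. \<phi> q \<ge> 0"
      "closed K" "K \<subseteq> U" "\<And>q. q \<notin> K \<Longrightarrow> \<phi> q = 0"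
      using bump_exists[OF U F(1)] by blast
    define E where "E j q = (if q \<in> U then \<phi> q *\<^sub>R F j q else 0)" for j q
    \<comment> \<open>Where \<open>\<phi>\<close> is positive, scaling by it changes neither
      orthogonality nor spans, so the frame property survives exactly on such a set.\<close>
    define V where "V = \<phi> -` {0<..}"
    have VU: "V \<subseteq> U"
      using \<phi>(5,6) by (force simp: V_def)
    have "open V"
      unfolding V_def using smooth_fun_on_continuous_on[OF open_UNIV \<phi>(1)]
      by (simp add: continuous_on_open_vimage)
    moreover have "E j \<in> vfields A" if "j < DIM('e)" for j
      unfolding E_def by (rule smooth_vfield_on_cutoff[OF U \<phi>(4-6,1) F_smooth[OF that]])
    moreover have "E j q \<in> D q" if "j < k" for j q
    proof (cases "q \<in> U")
      case True
      then show ?thesis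
        unfolding D_span[OF True] E_def using that True by (simp add: span_scale span_base)
    next
      case False
      then show ?thesis
        using subspace_0[OF regular_distribution_subspace(1)[OF assms]] by (simp add: E_def)
    qed
    moreover have "g q u (E j q) = 0" if j: "k \<le> j" "j < DIM('e)" and u: "u \<in> D q" for j q u
    proof (cases "q \<in> U")
      case True
      obtain a where a: "u = (\<Sum>i<k. a i *\<^sub>R F i q)"
        using u D_span[OF True] by (auto simp: span_family)
      have "g q u (F j q) = (\<Sum>i<k. a i * g q (F i q) (F j q))"
        unfolding a by (rule g_sum_left) (use FT kn j True in auto)
      also have "\<dots> = 0"
        using orth[OF True] kn j by (intro sum.neutral) (auto simp: orthogonal_family_def)
      finally show ?thesis
        using True j u FT regular_distribution_subspace(2)[OF assms]
        by (simp add: E_def g_scale_right subset_iff)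
    next
      case False
      then show ?thesis
        using subsetD[OF regular_distribution_subspace(2)[OF assms] u] by (simp add: E_def)
    qed
    moreover have "orthogonal_family q DIM('e) (\<lambda>j. E j q)" if "q \<in> V" for q
      using orth[of q] FT that VU unfolding orthogonal_family_def
      by (auto simp: E_def V_def g_scale_left g_scale_right T_scale subset_iff)
    moreover have "D q = span ((\<lambda>j. E j q) ` {..<k})" if "q \<in> V" for q
    proof -
      have "(\<lambda>j. E j q) ` {..<k} = (\<lambda>v. \<phi> q *\<^sub>R v) ` ((\<lambda>j. F j q) ` {..<k})"
        using that VU by (auto simp: E_def)
      then show ?thesis
        using D_span[of q] that VU span_image_scale[of "(\<lambda>j. F j q) ` {..<k}" "\<lambda>_. \<phi> q"]
        by (auto simp: V_def)
    qed
    ultimately have "adapted_frame D k V E"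
      using kn unfolding adapted_frame_def by blast
    moreover have "p \<in> V"
      using \<phi>(2) by (simp add: V_def)
    ultimately show ?thesis
      by blast
  qed
  then show ?thesis
    using that by blast
qed

section \<open>Computing in a fixed adapted frame\<close>

context
  fixes D k U E
  assumes frame: "adapted_frame D k U E"
begin

lemma frame_open: "open U"
  and frame_rank: "k \<le> DIM('e)"
  and frame_vfields: "j < DIM('e) \<Longrightarrow> E j \<in> vfields A"
  and frame_in: "j < k \<Longrightarrow> E j q \<in> D q"
  and frame_normal: "k \<le> j \<Longrightarrow> j < DIM('e) \<Longrightarrow> u \<in> D q \<Longrightarrow> g q u (E j q) = 0"
  and frame_orthogonal: "q \<in> U \<Longrightarrow> orthogonal_family q DIM('e) (\<lambda>j. E j q)"
  and frame_span: "q \<in> U \<Longrightarrow> D q = span ((\<lambda>j. E j q) ` {..<k})"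
  using frame unfolding adapted_frame_def by blast+

lemma frame_tangent: "j < DIM('e) \<Longrightarrow> E j q \<in> T q"
  using frame_vfields vfields_tangent by blast

lemma frame_pos: "q \<in> U \<Longrightarrow> j < DIM('e) \<Longrightarrow> g q (E j q) (E j q) > 0"
  using orthogonal_family_pos[OF frame_orthogonal] by blast

lemma frame_expansion:
  assumes "q \<in> U" "v \<in> T q"
  shows "v = (\<Sum>j<DIM('e). coef q (\<lambda>j. E j q) v j *\<^sub>R E j q)"
  by (rule orthogonal_family_expansion[OF frame_orthogonal[OF assms(1)]])
    (use assms orthogonal_family_dim(2)[OF frame_orthogonal[OF assms(1)]] in simp)

lemma frame_eq_zero:
  assumes "q \<in> U" "v \<in> T q" "\<And>j. j < DIM('e) \<Longrightarrow> g q v (E j q) = 0"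
  shows "v = 0"
  by (subst frame_expansion[OF assms(1,2)]) (simp add: coef_def assms(3))

text \<open>Over \<open>U\<close>, membership in \<open>D\<close> becomes a finite system of scalar
  equations, the form needed for continuity and Gronwall arguments.\<close>

lemma frame_in_iff:
  assumes "q \<in> U"
  shows "v \<in> D q \<longleftrightarrow> v \<in> T q \<and> (\<forall>j. k \<le> j \<and> j < DIM('e) \<longrightarrow> g q v (E j q) = 0)"
proof safe
  assume v: "v \<in> D q"
  show "v \<in> T q"
    using v frame_span[OF assms] frame_tangent frame_rank span_minimal[OF _ subspace_tangent_space, of "(\<lambda>j. E j q) ` {..<k}" q]
    by force
  show "g q v (E j q) = 0" if "k \<le> j" "j < DIM('e)" for j
    using frame_normal that v by blast
next
  assume v: "v \<in> T q" "\<forall>j. k \<le> j \<and> j < DIM('e) \<longrightarrow> g q v (E j q) = 0"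
  have "v = (\<Sum>j<DIM('e). coef q (\<lambda>j. E j q) v j *\<^sub>R E j q)"
    by (rule frame_expansion[OF assms v(1)])
  also have "\<dots> = (\<Sum>j<k. coef q (\<lambda>j. E j q) v j *\<^sub>R E j q)"
    using frame_rank v(2) by (intro sum.mono_neutral_right) (auto simp: coef_def)
  finally show "v \<in> D q"
    using frame_span[OF assms] by (auto simp: span_family)
qed

text \<open>The coefficients of the velocity are computed from the smooth extension of the curve in
  a chart, so they are smooth on a whole ball even when \<open>t\<close> is an end point of
  \<open>I\<close>.\<close>

lemma frame_coordinates:
  assumes "curve I \<gamma>" "t \<in> I" "\<gamma> t \<in> U"
  obtains e f where "e > 0" "\<And>j. j < DIM('e) \<Longrightarrow> smooth_on (f j) (ball t e)"
    "\<And>s. s \<in> I \<inter> ball t e \<Longrightarrow> \<gamma> s \<in> U \<and> velocity A I \<gamma> s = (\<Sum>j<DIM('e). f j s *\<^sub>R E j (\<gamma> s))"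
proof -
  obtain c where c: "c \<in> A" "\<gamma> t \<in> cdom c"
    by (rule chart_exists)
  obtain e x where ex: "e > 0" "smooth_on x (ball t e)" "x ` ball t e \<subseteq> cmap c ` (U \<inter> cdom c)"
    "\<And>s. s \<in> I \<inter> ball t e \<Longrightarrow> \<gamma> s \<in> U \<and> \<gamma> s \<in> cdom c \<and> \<gamma> s = cinv c (x s) \<and>
      velocity A I \<gamma> s c = frechet_derivative x (at s) 1"
    using curve_coordinates_in[OF assms(1,2) c frame_open assms(3)] by metis
  \<comment> \<open>The frame coefficient, along \<open>E j\<close>, of the coordinate field
    belonging to \<open>b\<close>.\<close>
  define h where "h j b q = g q (lift c q b) (E j q) / g q (E j q) (E j q)" for j b q
  define f where "f j s = (\<Sum>b\<in>Basis. (frechet_derivative x (at s) 1 \<bullet> b) * h j b (cinv c (x s)))" for j s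
  have h: "smooth_fun_on A (U \<inter> cdom c) (h j b)" if j: "j < DIM('e)" for j b
  proof -
    have "open (U \<inter> cdom c)"
      using frame_open open_cdom[OF c(1)] by blast
    moreover have "smooth_vfield_on A (U \<inter> cdom c) (\<lambda>q. lift c q b)"
      using smooth_vfield_on_chartI[OF c(1) calculation _ smooth_on_const] by simp
    moreover have "smooth_vfield_on A (U \<inter> cdom c) (E j)"
      using frame_vfields[OF j] smooth_vfield_on_subset by blast
    ultimately show ?thesis
      unfolding h_def using frame_pos[OF _ j] by (intro smooth_fun_on_divide g_smooth) force+
  qed
  have "smooth_on (f j) (ball t e)" if "j < DIM('e)" for j
    unfolding f_def
  proof (intro smooth_on_sum smooth_on_mult open_ball)
    fix b :: 'e
    show "smooth_on (\<lambda>s. h j b (cinv c (x s))) (ball t e)"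
      by (rule smooth_on_compose[OF smooth_fun_onD[OF h[OF that] c(1)] open_ball ex(2)]) (use ex(3) in auto)
    show "smooth_on (\<lambda>s. frechet_derivative x (at s) 1 \<bullet> b) (ball t e)"
      by (intro smooth_on_inner smooth_on_frechet_derivative ex(2) smooth_on_const open_ball)
  qed
  moreover have "\<gamma> s \<in> U \<and> velocity A I \<gamma> s = (\<Sum>j<DIM('e). f j s *\<^sub>R E j (\<gamma> s))" if s: "s \<in> I \<inter> ball t e" for s
  proof -
    have q: "\<gamma> s \<in> U" "\<gamma> s \<in> cdom c" "\<gamma> s = cinv c (x s)" "velocity A I \<gamma> s c = frechet_derivative x (at s) 1"
      using ex(4)[OF s] by auto
    have v: "velocity A I \<gamma> s \<in> T (\<gamma> s)"
      using velocity_tangent[OF assms(1)] s by blast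
    have "coef (\<gamma> s) (\<lambda>j. E j (\<gamma> s)) (velocity A I \<gamma> s) j = f j s" if j: "j < DIM('e)" for j
    proof -
      have "velocity A I \<gamma> s = (\<Sum>b\<in>Basis. (frechet_derivative x (at s) 1 \<bullet> b) *\<^sub>R lift c (\<gamma> s) b)"
        using lift_of_component[OF v c(1) q(2)] lift_sum_Basis[OF c(1) q(2)] q(4) by metis
      then have "g (\<gamma> s) (velocity A I \<gamma> s) (E j (\<gamma> s)) =
          (\<Sum>b\<in>Basis. (frechet_derivative x (at s) 1 \<bullet> b) * g (\<gamma> s) (lift c (\<gamma> s) b) (E j (\<gamma> s)))"
        using c(1) q(2) lift_tangent frame_tangent[OF j] by (simp add: g_sum_left)
      then show ?thesis
        by (simp add: coef_def f_def h_def sum_divide_distrib flip: q(3))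
    qed
    then show ?thesis
      using frame_expansion[OF q(1) v] q(1) by simp
  qed
  ultimately show ?thesis
    using that ex(1) by blast
qed

end

section \<open>Orthogonal projections\<close>

text \<open>Uniqueness in the definite description: two candidates differ by a vector of
  \<open>S\<close> that is orthogonal to \<open>S\<close>, hence to itself.\<close>

lemma orth_proj_eqI:
  assumes "subspace S" "S \<subseteq> T p" "v \<in> T p" "u \<in> S" "\<And>w. w \<in> S \<Longrightarrow> g p (v - u) w = 0" "S = S' p"
  shows "orth_proj g S' p v = u"
  unfolding orth_proj_def assms(6)[symmetric]
proof (rule the_equality)
  show "u \<in> S \<and> (\<forall>w\<in>S. g p (v - u) w = 0)"
    using assms by blast
  fix u' assume u': "u' \<in> S \<and> (\<forall>w\<in>S. g p (v - u') w = 0)"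
  let ?w = "u' - u"
  have w: "?w \<in> S" "?w \<in> T p" "u \<in> T p" "u' \<in> T p"
    using u' assms subspace_diff by blast+
  have "g p ?w ?w = g p ((v - u) - (v - u')) ?w"
    by simp
  also have "\<dots> = g p (v - u) ?w - g p (v - u') ?w"
    using w assms(3) by (intro g_diff_left T_diff) auto
  also have "\<dots> = 0"
    using u' w assms by simp
  finally show "u' = u"
    using g_self_zero_iff[OF w(2)] by simp
qed

context
  fixes D
  assumes D: "regular_distribution A D"
begin

lemma orth_decomposition:
  assumes "v \<in> T p"
  obtains u where "u \<in> D p" "\<And>w. w \<in> D p \<Longrightarrow> g p (v - u) w = 0"
proof -
  obtain k U E where p: "p \<in> U" and fr: "adapted_frame D k U E"
    using adapted_frame_exists[OF D] by metis
  note rk = frame_rank[OF fr]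
  have fam: "orthogonal_family p k (\<lambda>j. E j p)"
    using frame_orthogonal[OF fr p] rk by (auto simp: orthogonal_family_def)
  define u where "u = (\<Sum>j<k. coef p (\<lambda>j. E j p) v j *\<^sub>R E j p)"
  have u: "u \<in> D p"
    using frame_span[OF fr p] by (auto simp: u_def span_family)
  have uT: "u \<in> T p"
    using u regular_distribution_subspace(2)[OF D] by blast
  have ET: "E j p \<in> T p" if "j < k" for j
    using frame_tangent[OF fr] rk that by simp
  have 0: "g p (v - u) (E j p) = 0" if j: "j < k" for j
  proof -
    have "g p u (E j p) = coef p (\<lambda>j. E j p) v j * g p (E j p) (E j p)"
      unfolding u_def by (rule orthogonal_family_inner[OF fam j])
    then show ?thesis
      using orthogonal_family_pos[OF fam j] by (simp add: g_diff_left[OF assms uT ET[OF j]] coef_def)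
  qed
  have "g p (v - u) w = 0" if "w \<in> D p" for w
  proof -
    obtain a where a: "w = (\<Sum>j<k. a j *\<^sub>R E j p)"
      using \<open>w \<in> D p\<close> frame_span[OF fr p] by (auto simp: span_family)
    show ?thesis
      unfolding a using ET T_diff[OF assms uT] 0 by (subst g_sum_right) auto
  qed
  then show ?thesis
    using that u by blast
qed

lemma orth_proj_eq_zero_iff:
  assumes "v \<in> T p"
  shows "orth_proj g D p v = 0 \<longleftrightarrow> (\<forall>w\<in>D p. g p v w = 0)"
proof -
  obtain u where u: "u \<in> D p" "\<And>w. w \<in> D p \<Longrightarrow> g p (v - u) w = 0"
    using orth_decomposition[OF assms] by blast
  have pr: "orth_proj g D p v = u"
    by (rule orth_proj_eqI[OF regular_distribution_subspace[OF D] assms u]) auto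
  have "u = 0" if 1: "\<forall>w\<in>D p. g p v w = 0"
    using orth_proj_eqI[OF regular_distribution_subspace[OF D] assms, of 0 D] 1 pr
      subspace_0[OF regular_distribution_subspace(1)[OF D]] by simp
  then show ?thesis
    using pr u by auto
qed

lemma orth_compl_subspace: "subspace (orth_compl A g D p)" "orth_compl A g D p \<subseteq> T p"
proof -
  have "D p \<subseteq> T p"
    by (rule regular_distribution_subspace(2)[OF D])
  then show "subspace (orth_compl A g D p)"
    by (intro subspaceI) (auto simp: orth_compl_def T_add T_scale g_add_left g_scale_left subset_iff)
  show "orth_compl A g D p \<subseteq> T p"
    by (auto simp: orth_compl_def)
qed

lemma orth_proj_compl:
  assumes "v \<in> T p"
  shows "orth_proj g (orth_compl A g D) p v \<in> orth_compl A g D p"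
    and "v - orth_proj g (orth_compl A g D) p v \<in> D p"
proof -
  obtain u where u: "u \<in> D p" "\<And>w. w \<in> D p \<Longrightarrow> g p (v - u) w = 0"
    using orth_decomposition[OF assms] by blast
  have uT: "u \<in> T p"
    using u regular_distribution_subspace(2)[OF D] by blast
  have 1: "v - u \<in> orth_compl A g D p"
    using u T_diff[OF assms uT] by (simp add: orth_compl_def)
  have "orth_proj g (orth_compl A g D) p v = v - u"
  proof (rule orth_proj_eqI[where S = "orth_compl A g D p"])
    fix w assume "w \<in> orth_compl A g D p"
    then show "g p (v - (v - u)) w = 0"
      using u(1) uT g_sym[of w p u] by (auto simp: orth_compl_def)
  qed (use orth_compl_subspace assms 1 in auto)
  then show "orth_proj g (orth_compl A g D) p v \<in> orth_compl A g D p"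
    "v - orth_proj g (orth_compl A g D) p v \<in> D p"
    using 1 u by auto
qed

lemma orth_compl_Int: "v \<in> D p \<Longrightarrow> v \<in> orth_compl A g D p \<Longrightarrow> v = 0"
  using g_self_zero_iff[of v p] by (auto simp: orth_compl_def)

text \<open>Modulo \<open>D\<close>, the sum \<open>u + v\<close> equals the sum of the two normal
  parts, and that sum can lie in \<open>D\<close> only if it is 0.\<close>

lemma orth_proj_compl_add_eq_zero_iff:
  assumes "u \<in> T p" "v \<in> T p"
  shows "orth_proj g (orth_compl A g D) p u + orth_proj g (orth_compl A g D) p v = 0 \<longleftrightarrow> u + v \<in> D p"
proof -
  let ?P = "orth_proj g (orth_compl A g D) p"
  have 1: "(u - ?P u) + (v - ?P v) \<in> D p"
    by (intro subspace_add[OF regular_distribution_subspace(1)[OF D]] orth_proj_compl assms)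
  have 2: "?P u + ?P v \<in> orth_compl A g D p"
    by (intro subspace_add[OF orth_compl_subspace(1)] orth_proj_compl assms)
  have e: "u + v - ((u - ?P u) + (v - ?P v)) = ?P u + ?P v"
    by simp
  show ?thesis
  proof
    assume "?P u + ?P v = 0"
    then show "u + v \<in> D p"
      using 1 e by (metis eq_iff_diff_eq_0)
  next
    assume "u + v \<in> D p"
    then have "?P u + ?P v \<in> D p"
      using subspace_diff[OF regular_distribution_subspace(1)[OF D] _ 1] e by metis
    then show "?P u + ?P v = 0"
      using 2 orth_compl_Int by blast
  qed
qed

end

end

section \<open>The Levi-Civita connection\<close>

locale levi_civita_connection = riemannian A g
  for A :: "('a::{t2_space, second_countable_topology}, 'e::euclidean_space) chart set"
    and g :: "'a \<Rightarrow> ('a, 'e) tvec \<Rightarrow> ('a, 'e) tvec \<Rightarrow> real" +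
  fixes nab :: "('a, 'e) vfield \<Rightarrow> ('a, 'e) vfield \<Rightarrow> ('a, 'e) vfield"
  assumes levi_civita: "levi_civita A g nab"
begin

lemma nab_vfields: "X \<in> vfields A \<Longrightarrow> Y \<in> vfields A \<Longrightarrow> nab X Y \<in> vfields A"
  and nab_add_left: "X \<in> vfields A \<Longrightarrow> Y \<in> vfields A \<Longrightarrow> Z \<in> vfields A \<Longrightarrow> nab (X + Y) Z = nab X Z + nab Y Z"
  and nab_add_right: "X \<in> vfields A \<Longrightarrow> Y \<in> vfields A \<Longrightarrow> Z \<in> vfields A \<Longrightarrow> nab X (Y + Z) = nab X Y + nab X Z"
  and nab_scale_left: "X \<in> vfields A \<Longrightarrow> Y \<in> vfields A \<Longrightarrow> smooth_fun_on A UNIV f \<Longrightarrow>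
    nab (\<lambda>p. f p *\<^sub>R X p) Y = (\<lambda>p. f p *\<^sub>R nab X Y p)"
  and metric_compatible: "X \<in> vfields A \<Longrightarrow> Y \<in> vfields A \<Longrightarrow> Z \<in> vfields A \<Longrightarrow>
    dir_deriv A p (X p) (\<lambda>q. g q (Y q) (Z q)) = g p (nab X Y p) (Z p) + g p (Y p) (nab X Z p)"
  using levi_civita unfolding levi_civita_def affine_connection_def by blast+

lemma nab_tangent: "X \<in> vfields A \<Longrightarrow> Y \<in> vfields A \<Longrightarrow> nab X Y p \<in> T p"
  using nab_vfields vfields_tangent by blast

lemma nab_scaleR_left: "X \<in> vfields A \<Longrightarrow> Y \<in> vfields A \<Longrightarrow> nab (a *\<^sub>R X) Y = a *\<^sub>R nab X Y"
  using nab_scale_left[of X Y "\<lambda>_. a"] smooth_fun_on_const by (simp add: scaleR_fun_def)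

lemma vfields_zero: "0 \<in> vfields A"
  by (simp add: smooth_vfield_on_zero)

lemma nab_sum_left:
  "(\<And>i. i \<in> I \<Longrightarrow> X i \<in> vfields A) \<Longrightarrow> Y \<in> vfields A \<Longrightarrow> nab (\<Sum>i\<in>I. X i) Y = (\<Sum>i\<in>I. nab (X i) Y)"
proof (induction I rule: infinite_finite_induct)
  case (insert i I)
  have X: "X j \<in> vfields A" if "j \<in> insert i I" for j
    by (rule insert.prems(1)[OF that])
  have "nab (X i + (\<Sum>i\<in>I. X i)) Y = nab (X i) Y + nab (\<Sum>i\<in>I. X i) Y"
    by (rule nab_add_left[OF X vfields_sum[OF X] insert.prems(2)]) simp_all
  moreover have "nab (\<Sum>i\<in>I. X i) Y = (\<Sum>i\<in>I. nab (X i) Y)"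
    using insert by blast
  ultimately show ?case
    by (simp only: sum.insert[OF insert.hyps(1,2)])
\<comment> \<open>The empty sum needs \<open>nab 0 Y = 0\<close>, obtained by scaling a field with
  0.\<close>
qed (use nab_scaleR_left[OF vfields_zero, of Y 0] in simp_all)

lemma vfields_combination:
  fixes X :: "nat \<Rightarrow> ('a, 'e) vfield"
  shows "(\<And>i. i < n \<Longrightarrow> X i \<in> vfields A) \<Longrightarrow> (\<Sum>i<n. a i *\<^sub>R X i) \<in> vfields A"
  by (intro vfields_sum vfields_scaleR) auto

lemma combination_apply: "(\<Sum>i<n. a i *\<^sub>R X i) p = (\<Sum>i<n. a i *\<^sub>R X i p)"
  for X :: "nat \<Rightarrow> ('a, 'e) vfield"
  by (simp add: sum_fun_apply scaleR_fun_def[of _ "X _"])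

lemma nab_combination_left:
  fixes X :: "nat \<Rightarrow> ('a, 'e) vfield"
  assumes "\<And>i. i < n \<Longrightarrow> X i \<in> vfields A" "Y \<in> vfields A"
  shows "nab (\<Sum>i<n. a i *\<^sub>R X i) Y p = (\<Sum>i<n. a i *\<^sub>R nab (X i) Y p)"
proof -
  have "nab (\<Sum>i<n. a i *\<^sub>R X i) Y = (\<Sum>i<n. nab (a i *\<^sub>R X i) Y)"
    by (rule nab_sum_left) (use assms vfields_scaleR in auto)
  also have "\<dots> = (\<Sum>i<n. a i *\<^sub>R nab (X i) Y)"
    using assms by (intro sum.cong) (simp_all only: nab_scaleR_left lessThan_iff)
  finally have eq: "nab (\<Sum>i<n. a i *\<^sub>R X i) Y = (\<Sum>i<n. a i *\<^sub>R nab (X i) Y)" .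
  show ?thesis
    unfolding eq by (rule combination_apply)
qed

text \<open>For the zero distribution an adapted frame is just an orthogonal frame of the tangent
  spaces over \<open>U\<close> made of global fields.\<close>

lemma local_frame_exists:
  obtains U E where "p \<in> U" "adapted_frame (\<lambda>_. {0}) 0 U E"
proof -
  have reg: "regular_distribution A (\<lambda>_. {0})"
    unfolding regular_distribution_def
    by (intro exI[of _ 0] allI exI[of _ UNIV]) (simp add: independent_empty)
  obtain k U E where UE: "p \<in> U" "adapted_frame (\<lambda>_. {0}) k U E"
    using adapted_frame_exists[OF reg] by metis
  \<comment> \<open>The rank comes out of an existential statement; it is 0 because frame vectors
    over \<open>U\<close> are nonzero and those of index below \<open>k\<close> lie in
    \<open>{0}\<close>.\<close>
  have "k = 0"
  proof (rule ccontr)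
    assume "k \<noteq> 0"
    then have "E 0 p = 0" "0 < DIM('e)"
      using frame_in[OF UE(2), of 0 p] frame_rank[OF UE(2)] by auto
    then show False
      using frame_orthogonal[OF UE(2,1)] by (auto simp: orthogonal_family_def)
  qed
  then show ?thesis
    using that UE by blast
qed

text \<open>The difference \<open>Z\<close> vanishes at \<open>p\<close>. Multiplied by a bump
  function it is a combination of global frame fields whose global coefficients vanish at
  \<open>p\<close>, so linearity over smooth functions gives \<open>nab Z Y p = 0\<close>.\<close>

lemma nab_tensorial:
  assumes "X \<in> vfields A" "X' \<in> vfields A" "Y \<in> vfields A" "X p = X' p"
  shows "nab X Y p = nab X' Y p"
proof -
  obtain U E where p: "p \<in> U" and fr: "adapted_frame (\<lambda>_. {0}) 0 U E"
    by (rule local_frame_exists)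
  note U = frame_open[OF fr] and E = frame_vfields[OF fr]
  define Z where "Z = X + (- 1) *\<^sub>R X'"
  have Z: "Z \<in> vfields A"
    unfolding Z_def by (intro vfields_add vfields_scaleR assms)
  have Zp: "Z p = 0"
    by (simp add: Z_def scaleR_fun_def[of _ X'] assms(4))
  obtain \<phi> K where \<phi>: "smooth_fun_on A UNIV \<phi>" "\<phi> p > 0"
    "closed K" "K \<subseteq> U" "\<And>q. q \<notin> K \<Longrightarrow> \<phi> q = 0"
    using bump_exists[OF U p] by metis
  define h where "h j q = coef q (\<lambda>j. E j q) (Z q) j" for j q
  define k where "k j q = (if q \<in> U then \<phi> q * h j q else 0)" for j q
  have h: "smooth_fun_on A U (h j)" if j: "j < DIM('e)" for j
  proof -
    have "smooth_vfield_on A U Z" "smooth_vfield_on A U (E j)"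
      using Z E[OF j] smooth_vfield_on_subset by blast+
    then show ?thesis
      unfolding h_def coef_def using frame_pos[OF fr _ j]
      by (intro smooth_fun_on_divide g_smooth U) force+
  qed
  have k: "smooth_fun_on A UNIV (k j)" if "j < DIM('e)" for j
    unfolding k_def by (rule smooth_fun_on_cutoff[OF U \<phi>(3-5,1) h[OF that]])
  have eq: "(\<lambda>q. \<phi> q *\<^sub>R Z q) = (\<Sum>j<DIM('e). (\<lambda>q. k j q *\<^sub>R E j q))"
  proof
    fix q
    show "\<phi> q *\<^sub>R Z q = (\<Sum>j<DIM('e). (\<lambda>q. k j q *\<^sub>R E j q)) q"
    proof (cases "q \<in> U")
      case True
      have "Z q = (\<Sum>j<DIM('e). h j q *\<^sub>R E j q)"
        unfolding h_def by (rule frame_expansion[OF fr True vfields_tangent[OF Z]])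
      then have "\<phi> q *\<^sub>R Z q = (\<Sum>j<DIM('e). (\<phi> q * h j q) *\<^sub>R E j q)"
        by (simp add: scaleR_sum_right)
      then show ?thesis
        using True by (simp add: sum_fun_apply k_def)
    next
      case False
      then have "\<phi> q = 0"
        using \<phi>(4,5) by blast
      then show ?thesis
        using False by (simp add: sum_fun_apply k_def)
    qed
  qed
  have "\<phi> p *\<^sub>R nab Z Y p = nab (\<lambda>q. \<phi> q *\<^sub>R Z q) Y p"
    by (simp only: nab_scale_left[OF Z assms(3) \<phi>(1)])
  also have "\<dots> = (\<Sum>j<DIM('e). nab (\<lambda>q. k j q *\<^sub>R E j q) Y) p"
    unfolding eq by (subst nab_sum_left) (use E k vfields_scale assms(3) in auto)
  also have "\<dots> = (\<Sum>j<DIM('e). nab (\<lambda>q. k j q *\<^sub>R E j q) Y p)"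
    by (rule sum_fun_apply)
  also have "\<dots> = (\<Sum>j<DIM('e). k j p *\<^sub>R nab (E j) Y p)"
    by (intro sum.cong refl) (simp only: nab_scale_left[OF E assms(3) k] lessThan_iff)
  also have "\<dots> = 0"
    using frame_tangent[OF fr] by (intro sum.neutral) (simp add: k_def h_def coef_def Zp)
  finally have "nab Z Y p = 0"
    using \<phi>(2) by simp
  moreover have "nab Z Y = nab X Y + (- 1) *\<^sub>R nab X' Y"
    unfolding Z_def using assms vfields_scaleR[OF assms(2)] nab_add_left nab_scaleR_left by metis
  ultimately show ?thesis
    by (simp add: scaleR_fun_def[of _ "nab X' Y"])
qed

subsection \<open>Covariant derivatives along curves\<close>

text \<open>The predicate under the definite description in \<open>cov_deriv_along\<close>, so that
  existence and uniqueness of its value can be treated separately.\<close>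

definition cov_value ::
  "real set \<Rightarrow> (real \<Rightarrow> 'a) \<Rightarrow> (real \<Rightarrow> ('a, 'e) tvec) \<Rightarrow> real \<Rightarrow> ('a, 'e) tvec \<Rightarrow> bool"
  where "cov_value I \<gamma> V t w \<longleftrightarrow> (\<exists>(n::nat) f E X. \<exists>e>0.
       X \<in> vfields A \<and> X (\<gamma> t) = velocity A I \<gamma> t \<and>
       (\<forall>j<n. E j \<in> vfields A \<and> smooth_on (f j) (ball t e)) \<and>
       (\<forall>s\<in>I \<inter> ball t e. V s = (\<Sum>j<n. f j s *\<^sub>R E j (\<gamma> s))) \<and>
       w = (\<Sum>j<n. deriv (f j) t *\<^sub>R E j (\<gamma> t) + f j t *\<^sub>R nab X (E j) (\<gamma> t)))"

lemma smooth_on_DERIV: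
  fixes f :: "real \<Rightarrow> real"
  assumes "smooth_on f S" "x \<in> S"
  shows "(f has_real_derivative deriv f x) (at x)"
  using smooth_on_has_vector_derivative[OF assms] DERIV_deriv_iff_has_field_derivative
  by (metis has_real_derivative_iff_has_vector_derivative)

text \<open>Metric compatibility turns the defining rules of the covariant derivative into a formula for
  its inner products with vector fields; this is what makes it unique.\<close>

lemma cov_value_DERIV:
  assumes cur: "curve I \<gamma>" and t: "t \<in> I" and w: "cov_value I \<gamma> V t w"
    and Y: "Y \<in> vfields A" "Y (\<gamma> t) = velocity A I \<gamma> t"
  shows "w \<in> T (\<gamma> t)"
    and "Z \<in> vfields A \<Longrightarrow> ((\<lambda>s. g (\<gamma> s) (V s) (Z (\<gamma> s))) has_real_derivative
      g (\<gamma> t) w (Z (\<gamma> t)) + g (\<gamma> t) (V t) (nab Y Z (\<gamma> t))) (at t within I)"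
proof -
  from w[unfolded cov_value_def] obtain n :: nat and f E X e where *: "e > 0 \<and>
       X \<in> vfields A \<and> X (\<gamma> t) = velocity A I \<gamma> t \<and>
       (\<forall>j<n. E j \<in> vfields A \<and> smooth_on (f j) (ball t e)) \<and>
       (\<forall>s\<in>I \<inter> ball t e. V s = (\<Sum>j<n. f j s *\<^sub>R E j (\<gamma> s))) \<and>
       w = (\<Sum>j<n. deriv (f j) t *\<^sub>R E j (\<gamma> t) + f j t *\<^sub>R nab X (E j) (\<gamma> t))"
    by (elim exE)
  have e: "e > 0" and X: "X \<in> vfields A" "X (\<gamma> t) = velocity A I \<gamma> t"
    and E: "\<And>j. j < n \<Longrightarrow> E j \<in> vfields A" and f: "\<And>j. j < n \<Longrightarrow> smooth_on (f j) (ball t e)"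
    and V: "\<And>s. s \<in> I \<inter> ball t e \<Longrightarrow> V s = (\<Sum>j<n. f j s *\<^sub>R E j (\<gamma> s))"
    and w_eq: "w = (\<Sum>j<n. deriv (f j) t *\<^sub>R E j (\<gamma> t) + f j t *\<^sub>R nab X (E j) (\<gamma> t))"
    using * by blast+
  let ?p = "\<gamma> t"
  have ET: "E j q \<in> T q" if "j < n" for j q
    using E[OF that] vfields_tangent by blast
  have NT: "nab X (E j) q \<in> T q" if "j < n" for j q
    using nab_tangent[OF X(1) E[OF that]] .
  show "w \<in> T ?p"
    unfolding w_eq by (intro T_sum T_add T_scale ET NT) auto
  assume Z: "Z \<in> vfields A"
  have ZT: "Z q \<in> T q" for q
    using Z vfields_tangent by blast
  \<comment> \<open>\<open>Y\<close> and the witness \<open>X\<close> may be different extensions of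
    the same velocity vector.\<close>
  have NZ: "nab Y Z ?p = nab X Z ?p"
    by (rule nab_tensorial[OF Y(1) X(1) Z]) (simp add: X Y)
  have d1: "(f j has_real_derivative deriv (f j) t) (at t within I)" if "j < n" for j
    using has_field_derivative_at_within[OF smooth_on_DERIV[OF f[OF that]]] e by simp
  have d2: "((\<lambda>s. g (\<gamma> s) (E j (\<gamma> s)) (Z (\<gamma> s))) has_real_derivative
      g ?p (nab X (E j) ?p) (Z ?p) + g ?p (E j ?p) (nab X Z ?p)) (at t within I)" if j: "j < n" for j
  proof -
    have "smooth_fun_on A UNIV (\<lambda>q. g q (E j q) (Z q))"
      using E[OF j] Z by (intro g_smooth) auto
    from curve_chain_rule[OF cur t open_UNIV this UNIV_I] show ?thesis
      using metric_compatible[OF X(1) E[OF j] Z, of ?p] by (simp add: X(2))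
  qed
  have "((\<lambda>s. \<Sum>j<n. f j s * g (\<gamma> s) (E j (\<gamma> s)) (Z (\<gamma> s))) has_real_derivative
      (\<Sum>j<n. deriv (f j) t * g ?p (E j ?p) (Z ?p) +
        (g ?p (nab X (E j) ?p) (Z ?p) + g ?p (E j ?p) (nab X Z ?p)) * f j t)) (at t within I)"
    using d1 d2 by (intro DERIV_sum DERIV_mult) auto
  then have "((\<lambda>s. g (\<gamma> s) (V s) (Z (\<gamma> s))) has_real_derivative
      (\<Sum>j<n. deriv (f j) t * g ?p (E j ?p) (Z ?p) +
        (g ?p (nab X (E j) ?p) (Z ?p) + g ?p (E j ?p) (nab X Z ?p)) * f j t)) (at t within I)"
  proof (rule has_field_derivative_transform_within[OF _ e t])
    fix s assume s: "s \<in> I" "dist s t < e"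
    then have "V s = (\<Sum>j<n. f j s *\<^sub>R E j (\<gamma> s))"
      using V by (simp add: dist_commute)
    moreover have "g (\<gamma> s) (\<Sum>j<n. f j s *\<^sub>R E j (\<gamma> s)) (Z (\<gamma> s)) =
        (\<Sum>j<n. f j s * g (\<gamma> s) (E j (\<gamma> s)) (Z (\<gamma> s)))"
      by (rule g_sum_left) (use ET ZT in auto)
    ultimately show "(\<Sum>j<n. f j s * g (\<gamma> s) (E j (\<gamma> s)) (Z (\<gamma> s))) = g (\<gamma> s) (V s) (Z (\<gamma> s))"
      by simp
  qed
  moreover have "g ?p w (Z ?p) = (\<Sum>j<n. deriv (f j) t * g ?p (E j ?p) (Z ?p)) +
      (\<Sum>j<n. f j t * g ?p (nab X (E j) ?p) (Z ?p))"
  proof -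
    have "g ?p w (Z ?p) = g ?p (\<Sum>j<n. deriv (f j) t *\<^sub>R E j ?p) (Z ?p) +
        g ?p (\<Sum>j<n. f j t *\<^sub>R nab X (E j) ?p) (Z ?p)"
      unfolding w_eq sum.distrib using ET NT ZT by (intro g_add_left T_sum T_scale) auto
    moreover have "g ?p (\<Sum>j<n. deriv (f j) t *\<^sub>R E j ?p) (Z ?p) = (\<Sum>j<n. deriv (f j) t * g ?p (E j ?p) (Z ?p))"
      by (rule g_sum_left) (use ET ZT in auto)
    moreover have "g ?p (\<Sum>j<n. f j t *\<^sub>R nab X (E j) ?p) (Z ?p) = (\<Sum>j<n. f j t * g ?p (nab X (E j) ?p) (Z ?p))"
      by (rule g_sum_left) (use NT ZT in auto)
    ultimately show ?thesis
      by simp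
  qed
  moreover have "g ?p (V t) (nab X Z ?p) = (\<Sum>j<n. f j t * g ?p (E j ?p) (nab X Z ?p))"
  proof -
    have "V t = (\<Sum>j<n. f j t *\<^sub>R E j ?p)"
      using V[of t] t e by simp
    moreover have "g ?p (\<Sum>j<n. f j t *\<^sub>R E j ?p) (nab X Z ?p) = (\<Sum>j<n. f j t * g ?p (E j ?p) (nab X Z ?p))"
      by (rule g_sum_left) (use ET nab_tangent[OF X(1) Z] in auto)
    ultimately show ?thesis
      by simp
  qed
  ultimately show "((\<lambda>s. g (\<gamma> s) (V s) (Z (\<gamma> s))) has_real_derivative
      g ?p w (Z ?p) + g ?p (V t) (nab Y Z ?p)) (at t within I)"
    by (simp add: NZ sum.distrib algebra_simps)
qed

lemma DERIV_within_unique: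
  assumes "curve I \<gamma>" "t \<in> I" "(f has_real_derivative a) (at t within I)" "(f has_real_derivative b) (at t within I)"
  shows "a = b"
  using vector_derivative_unique_within[OF curve_at_within_neq_bot[OF assms(1,2)]] assms(3,4)
  by (simp add: has_real_derivative_iff_has_vector_derivative)

text \<open>The inner product of \<open>w\<close> with a frame field is the derivative of a fixed
  function minus a term free of \<open>w\<close>. Derivatives within \<open>I\<close> are unique,
  and a tangent vector orthogonal to the frame is 0.\<close>

lemma cov_value_unique:
  assumes cur: "curve I \<gamma>" and t: "t \<in> I" and w: "cov_value I \<gamma> V t w" "cov_value I \<gamma> V t w'"
  shows "w = w'"
proof -
  obtain Y where Y: "Y \<in> vfields A" "Y (\<gamma> t) = velocity A I \<gamma> t"
    using w(1) unfolding cov_value_def by metis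
  obtain U E where p: "\<gamma> t \<in> U" and fr: "adapted_frame (\<lambda>_. {0}) 0 U E"
    by (rule local_frame_exists)
  note wT = cov_value_DERIV(1)[OF cur t w(1) Y] cov_value_DERIV(1)[OF cur t w(2) Y]
  have "w - w' = 0"
  proof (rule frame_eq_zero[OF fr p T_diff[OF wT]])
    fix j assume j: "j < DIM('e)"
    from DERIV_within_unique[OF cur t cov_value_DERIV(2)[OF cur t w(1) Y frame_vfields[OF fr j]]
      cov_value_DERIV(2)[OF cur t w(2) Y frame_vfields[OF fr j]]]
    show "g (\<gamma> t) (w - w') (E j (\<gamma> t)) = 0"
      by (simp add: g_diff_left[OF wT frame_tangent[OF fr j]])
  qed
  then show ?thesis
    by simp
qed

lemma cov_deriv_along_eqI:
  assumes "curve I \<gamma>" "t \<in> I" "cov_value I \<gamma> V t w"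
  shows "cov_deriv_along A nab I \<gamma> V t = w"
proof -
  have "cov_deriv_along A nab I \<gamma> V t = (THE w. cov_value I \<gamma> V t w)"
    unfolding cov_deriv_along_def cov_value_def ..
  also have "\<dots> = w"
    by (rule the_equality) (use assms cov_value_unique in auto)
  finally show ?thesis .
qed

text \<open>Existence: expanding the velocity in a local frame with smooth coefficients gives a
  combination of the required kind.\<close>

lemma cov_value_velocity:
  assumes cur: "curve I \<gamma>" and t: "t \<in> I"
  shows "cov_value I \<gamma> (velocity A I \<gamma>) t (cov_deriv_along A nab I \<gamma> (velocity A I \<gamma>) t)"
proof -
  obtain U E where p: "\<gamma> t \<in> U" and fr: "adapted_frame (\<lambda>_. {0}) 0 U E"
    by (rule local_frame_exists)
  obtain e f where ef: "e > 0" "\<And>j. j < DIM('e) \<Longrightarrow> smooth_on (f j) (ball t e)"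
    "\<And>s. s \<in> I \<inter> ball t e \<Longrightarrow> \<gamma> s \<in> U \<and> velocity A I \<gamma> s = (\<Sum>j<DIM('e). f j s *\<^sub>R E j (\<gamma> s))"
    using frame_coordinates[OF fr cur t p] by blast
  \<comment> \<open>Freezing the coefficients at time \<open>t\<close> extends the velocity at
    \<open>t\<close> to a global field.\<close>
  define X where "X = (\<Sum>j<DIM('e). f j t *\<^sub>R E j)"
  have val: "cov_value I \<gamma> (velocity A I \<gamma>) t
    (\<Sum>j<DIM('e). deriv (f j) t *\<^sub>R E j (\<gamma> t) + f j t *\<^sub>R nab X (E j) (\<gamma> t))"
    unfolding cov_value_def
  proof (intro exI conjI)
    show "X \<in> vfields A"
      unfolding X_def by (rule vfields_combination[OF frame_vfields[OF fr]])
    show "X (\<gamma> t) = velocity A I \<gamma> t"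
      using ef(1,3) t by (simp add: X_def combination_apply)
    show "\<forall>j<DIM('e). E j \<in> vfields A \<and> smooth_on (f j) (ball t e)"
      using frame_vfields[OF fr] ef(2) by blast
    show "\<forall>s\<in>I \<inter> ball t e. velocity A I \<gamma> s = (\<Sum>j<DIM('e). f j s *\<^sub>R E j (\<gamma> s))"
      using ef(3) by blast
  qed (use ef(1) in auto)
  show ?thesis
    unfolding cov_deriv_along_eqI[OF cur t val] by (rule val)
qed

lemma cov_deriv_tangent:
  assumes "curve I \<gamma>" "t \<in> I"
  shows "cov_deriv_along A nab I \<gamma> (velocity A I \<gamma>) t \<in> T (\<gamma> t)"
proof -
  obtain Y where "Y \<in> vfields A" "Y (\<gamma> t) = velocity A I \<gamma> t"
    using cov_value_velocity[OF assms] unfolding cov_value_def by metis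
  then show ?thesis
    using cov_value_DERIV(1)[OF assms cov_value_velocity[OF assms]] by blast
qed

subsection \<open>Existence of geodesics tangent to a frame\<close>

text \<open>With \<open>m\<close> the full dimension, the whole acceleration vanishes and the curve
  is a geodesic. With \<open>m\<close> the rank of \<open>D\<close>, the velocity lies in
  \<open>D\<close> and the acceleration is orthogonal to \<open>D\<close>, which makes an intrinsic
  geodesic. The numbers \<open>a j\<close> prescribe the initial velocity.\<close>

lemma frame_geodesic_exists:
  assumes fr: "adapted_frame D k U E" and p: "p \<in> U" and m: "m \<le> DIM('e)"
  obtains h \<gamma> f where "h > 0" "curve {-h<..<h} \<gamma>" "\<gamma> 0 = p" "\<And>j. j < m \<Longrightarrow> f j 0 = a j"
    "\<And>t. t \<in> {-h<..<h} \<Longrightarrow> \<gamma> t \<in> U"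
    "\<And>t. t \<in> {-h<..<h} \<Longrightarrow> velocity A {-h<..<h} \<gamma> t = (\<Sum>j<m. f j t *\<^sub>R E j (\<gamma> t))"
    "\<And>t l. t \<in> {-h<..<h} \<Longrightarrow> l < m \<Longrightarrow>
      g (\<gamma> t) (cov_deriv_along A nab {-h<..<h} \<gamma> (velocity A {-h<..<h} \<gamma>) t) (E l (\<gamma> t)) = 0"
proof -
  obtain c where c: "c \<in> A" "p \<in> cdom c"
    by (rule chart_exists)
  note U = frame_open[OF fr]
  have E: "E j \<in> vfields A" if "j < m" for j
    using frame_vfields[OF fr] m that by simp
  have ET: "E j q \<in> T q" if "j < m" for j q
    using E[OF that] vfields_tangent by blast
  have pos: "g q (E j q) (E j q) > 0" if "j < m" "q \<in> U" for j q
    using frame_pos[OF fr that(2)] m that(1) by simp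
  define S where "S = cmap c ` (U \<inter> cdom c)"
  have S: "open S"
    unfolding S_def by (rule open_chart_image[OF c(1) U])
  have S_sub: "S \<subseteq> cmap c ` cdom c" "\<And>x. x \<in> S \<Longrightarrow> cinv c x \<in> U"
    using in_chart_image_iff[OF c(1)] unfolding S_def by blast+
  \<comment> \<open>The existence theorem needs a euclidean phase space. The \<open>m\<close>
    velocity coefficients are stored in \<open>m\<close> of the coordinates of \<open>'e\<close>,
    for which there is room as \<open>m \<le> DIM('e)\<close>.\<close>
  obtain b where b: "bij_betw b {0..<DIM('e)} (Basis :: 'e set)"
    using ex_bij_betw_nat_finite[OF finite_Basis] by blast
  have b_inner: "b i \<bullet> b j = (if i = j then 1 else 0)" if "i < m" "j < m" for i j
  proof -
    have "b i \<in> Basis" "b j \<in> Basis"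
      using b that m by (auto simp: bij_betw_def)
    moreover have "b i = b j \<longleftrightarrow> i = j"
      using b that m by (auto simp: bij_betw_def inj_on_def)
    ultimately show ?thesis
      by (simp add: inner_Basis)
  qed
  have b_coord: "(\<Sum>i<m. r i *\<^sub>R b i) \<bullet> b j = r j" if "j < m" for r j
  proof -
    have "(\<Sum>i<m. r i *\<^sub>R b i) \<bullet> b j = (\<Sum>i<m. if i = j then r j else 0)"
      unfolding inner_sum_left using that by (intro sum.cong) (auto simp: b_inner)
    then show ?thesis
      using that by simp
  qed
  \<comment> \<open>The Christoffel symbols of the frame: the coefficient along \<open>E l\<close>
    of the derivative of \<open>E j\<close> in direction \<open>E i\<close>.\<close>
  define G where "G l i j q = g q (nab (E i) (E j) q) (E l q) / g q (E l q) (E l q)" for l i j q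
  have G: "smooth_on (\<lambda>x. G l i j (cinv c x)) S" if "l < m" "i < m" "j < m" for l i j
  proof -
    have "smooth_vfield_on A U (nab (E i) (E j))" "smooth_vfield_on A U (E l)"
      using nab_vfields[OF E[OF that(2)] E[OF that(3)]] E[OF that(1)] smooth_vfield_on_subset by blast+
    then have "smooth_fun_on A U (G l i j)"
      unfolding G_def using pos[OF that(1)] U by (intro smooth_fun_on_divide g_smooth) force+
    then show ?thesis
      unfolding S_def by (rule smooth_fun_onD[OF _ c(1)])
  qed
  have e: "smooth_on (\<lambda>x. E j (cinv c x) c) S" if "j < m" for j
    unfolding S_def using E[OF that] smooth_vfield_on_subset[of UNIV "E j" U]
    by (intro smooth_vfield_onD[OF _ c(1)]) auto
  text \<open>A point \<open>(x, y)\<close> of the phase space is the position in the chart together with the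
    coefficients \<open>y \<bullet> b j\<close> of the velocity in the frame.\<close>
  define F where "F z = ((\<Sum>j<m. (snd z \<bullet> b j) *\<^sub>R E j (cinv c (fst z)) c),
    (\<Sum>l<m. (- 1 * (\<Sum>i<m. \<Sum>j<m. G l i j (cinv c (fst z)) * ((snd z \<bullet> b i) * (snd z \<bullet> b j)))) *\<^sub>R b l))"
    for z :: "'e \<times> 'e"
  have F: "smooth_on F (S \<times> UNIV)"
  proof -
    have SU: "open (S \<times> (UNIV :: 'e set))"
      using S by (intro open_Times) auto
    have 1: "smooth_on (fst :: 'e \<times> 'e \<Rightarrow> 'e) (S \<times> UNIV)" "smooth_on (snd :: 'e \<times> 'e \<Rightarrow> 'e) (S \<times> UNIV)"
      using smooth_on_linear[OF bounded_linear_fst SU smooth_on_id[OF SU]]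
        smooth_on_linear[OF bounded_linear_snd SU smooth_on_id[OF SU]] by simp_all
    have 2: "smooth_on (\<lambda>z. u (fst z)) (S \<times> (UNIV :: 'e set))" if "smooth_on u S"
      for u :: "'e \<Rightarrow> 'x::real_normed_vector"
      by (rule smooth_on_compose[OF that SU 1(1)]) auto
    show ?thesis
      unfolding F_def
      by (intro smooth_on_Pair smooth_on_sum smooth_on_scaleR smooth_on_mult smooth_on_inner
        smooth_on_const SU 1 2[OF e] 2[OF G]) auto
  qed
  have start: "(cmap c p, \<Sum>j<m. a j *\<^sub>R b j) \<in> S \<times> UNIV"
    using c p by (auto simp: S_def)
  obtain h z where h: "h > 0" and z0: "z 0 = (cmap c p, \<Sum>j<m. a j *\<^sub>R b j)"
    and z: "smooth_on z {-h<..<h}" "\<And>t. t \<in> {-h<..<h} \<Longrightarrow> z t \<in> S \<times> UNIV"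
    "\<And>t. t \<in> {-h<..<h} \<Longrightarrow> (z has_vector_derivative F (z t)) (at t)"
    using smooth_ode_solution[OF open_Times[OF S open_UNIV] start F] by blast
  let ?I = "{-h<..<h}"
  define x where "x t = fst (z t)" for t
  define f where "f j t = snd (z t) \<bullet> b j" for j t
  define \<gamma> where "\<gamma> t = cinv c (x t)" for t
  have xS: "x t \<in> S" if "t \<in> ?I" for t
    using z(2)[OF that] by (auto simp: x_def)
  have x_smooth: "smooth_on x ?I"
    unfolding x_def by (rule smooth_on_linear[OF bounded_linear_fst]) (use z in auto)
  have f_smooth: "smooth_on (f j) ?I" for j
    unfolding f_def
    by (intro smooth_on_inner smooth_on_const smooth_on_linear[OF bounded_linear_snd] z) auto
  have x': "(x has_vector_derivative (\<Sum>j<m. f j t *\<^sub>R E j (\<gamma> t) c)) (at t)" if "t \<in> ?I" for t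
    using bounded_linear.has_vector_derivative[OF bounded_linear_fst z(3)[OF that]]
    by (simp add: F_def x_def[abs_def] f_def \<gamma>_def)
  have f': "(f l has_real_derivative - (\<Sum>i<m. \<Sum>j<m. G l i j (\<gamma> t) * (f i t * f j t))) (at t)"
    if "t \<in> ?I" "l < m" for t l
  proof -
    have "bounded_linear (\<lambda>y::'e \<times> 'e. snd y \<bullet> b l)"
      by (intro bounded_linear_compose[OF bounded_linear_inner_left bounded_linear_snd])
    from bounded_linear.has_vector_derivative[OF this z(3)[OF that(1)]]
    have "(f l has_vector_derivative snd (F (z t)) \<bullet> b l) (at t)"
      unfolding f_def[abs_def] .
    moreover have "snd (F (z t)) \<bullet> b l = - (\<Sum>i<m. \<Sum>j<m. G l i j (\<gamma> t) * (f i t * f j t))"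
      unfolding F_def snd_conv b_coord[OF that(2)] by (simp add: f_def x_def \<gamma>_def)
    ultimately show ?thesis
      by (simp add: has_real_derivative_iff_has_vector_derivative)
  qed
  have xC: "x t \<in> cmap c ` cdom c" if "t \<in> ?I" for t
    using xS[OF that] S_sub(1) by blast
  have cur: "curve ?I \<gamma>"
    unfolding \<gamma>_def by (rule chart_curve(1)[OF c(1) h x_smooth xC])
  have \<gamma>U: "\<gamma> t \<in> U" and \<gamma>c: "\<gamma> t \<in> cdom c" if "t \<in> ?I" for t
    unfolding \<gamma>_def using xS[OF that] S_sub(2) cinv_in_cdom[OF c(1) xC[OF that]] by auto
  have vel: "velocity A ?I \<gamma> t = (\<Sum>j<m. f j t *\<^sub>R E j (\<gamma> t))" if t: "t \<in> ?I" for t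
  proof (rule tangent_space_eqI[OF velocity_tangent[OF cur t] _ c(1) \<gamma>c[OF t]])
    show "(\<Sum>j<m. f j t *\<^sub>R E j (\<gamma> t)) \<in> T (\<gamma> t)"
      by (intro T_sum T_scale ET) auto
    have "velocity A ?I \<gamma> t = lift c (\<gamma> t) (\<Sum>j<m. f j t *\<^sub>R E j (\<gamma> t) c)"
      using chart_curve(2)[OF c(1) h x_smooth xC t x'[OF t]] unfolding \<gamma>_def .
    then show "velocity A ?I \<gamma> t c = (\<Sum>j<m. f j t *\<^sub>R E j (\<gamma> t)) c"
      using c(1) \<gamma>c[OF t] by (simp add: component_sum)
  qed
  have cov: "g (\<gamma> t) (cov_deriv_along A nab ?I \<gamma> (velocity A ?I \<gamma>) t) (E l (\<gamma> t)) = 0"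
    if t: "t \<in> ?I" and l: "l < m" for t l
  proof -
    let ?q = "\<gamma> t"
    define X where "X = (\<Sum>j<m. f j t *\<^sub>R E j)"
    let ?w = "\<Sum>j<m. deriv (f j) t *\<^sub>R E j ?q + f j t *\<^sub>R nab X (E j) ?q"
    have X: "X \<in> vfields A"
      unfolding X_def by (rule vfields_combination[OF E])
    obtain r where r: "r > 0" "ball t r \<subseteq> ?I"
      using t openE[OF open_greaterThanLessThan] by blast
    have "cov_value ?I \<gamma> (velocity A ?I \<gamma>) t ?w"
      unfolding cov_value_def
    proof (intro exI conjI)
      show "X ?q = velocity A ?I \<gamma> t"
        using vel[OF t] by (simp add: X_def combination_apply)
      show "\<forall>j<m. E j \<in> vfields A \<and> smooth_on (f j) (ball t r)"
        using E smooth_on_subset[OF f_smooth r(2)] by blast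
      show "\<forall>s\<in>?I \<inter> ball t r. velocity A ?I \<gamma> s = (\<Sum>j<m. f j s *\<^sub>R E j (\<gamma> s))"
        using vel by blast
    qed (use X r in auto)
    then have w: "cov_deriv_along A nab ?I \<gamma> (velocity A ?I \<gamma>) t = ?w"
      by (rule cov_deriv_along_eqI[OF cur t])
    have fam: "orthogonal_family ?q m (\<lambda>j. E j ?q)"
      using frame_orthogonal[OF fr \<gamma>U[OF t]] m by (auto simp: orthogonal_family_def)
    have NT: "nab X (E j) ?q \<in> T ?q" if "j < m" for j
      by (rule nab_tangent[OF X E[OF that]])
    have N: "g ?q (nab X (E j) ?q) (E l ?q) = (\<Sum>i<m. f i t * (G l i j ?q * g ?q (E l ?q) (E l ?q)))"
      if j: "j < m" for j
    proof -
      have "nab X (E j) ?q = (\<Sum>i<m. f i t *\<^sub>R nab (E i) (E j) ?q)"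
        unfolding X_def by (rule nab_combination_left[OF E E[OF j]])
      moreover have "g ?q (\<Sum>i<m. f i t *\<^sub>R nab (E i) (E j) ?q) (E l ?q) =
          (\<Sum>i<m. f i t * g ?q (nab (E i) (E j) ?q) (E l ?q))"
        by (rule g_sum_left) (use nab_tangent[OF E E[OF j]] ET[OF l] in auto)
      ultimately show ?thesis
        using pos[OF l \<gamma>U[OF t]] by (simp add: G_def)
    qed
    have "g ?q ?w (E l ?q) = g ?q (\<Sum>j<m. deriv (f j) t *\<^sub>R E j ?q) (E l ?q) +
        g ?q (\<Sum>j<m. f j t *\<^sub>R nab X (E j) ?q) (E l ?q)"
      unfolding sum.distrib using ET NT l by (intro g_add_left T_sum T_scale) auto
    also have "\<dots> = deriv (f l) t * g ?q (E l ?q) (E l ?q) +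
        (\<Sum>j<m. f j t * (\<Sum>i<m. f i t * (G l i j ?q * g ?q (E l ?q) (E l ?q))))"
    proof -
      have "g ?q (\<Sum>j<m. f j t *\<^sub>R nab X (E j) ?q) (E l ?q) = (\<Sum>j<m. f j t * g ?q (nab X (E j) ?q) (E l ?q))"
        by (rule g_sum_left) (use NT ET[OF l] in auto)
      then show ?thesis
        using orthogonal_family_inner[OF fam l] N by simp
    qed
    also have "(\<Sum>j<m. f j t * (\<Sum>i<m. f i t * (G l i j ?q * g ?q (E l ?q) (E l ?q)))) =
        (\<Sum>i<m. \<Sum>j<m. G l i j ?q * (f i t * f j t)) * g ?q (E l ?q) (E l ?q)"
      by (subst sum.swap) (simp add: sum_distrib_left sum_distrib_right mult_ac)
    finally have "g ?q ?w (E l ?q) = 0"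
      unfolding DERIV_imp_deriv[OF f'[OF t l]] by (simp only: mult_minus_left add.left_inverse)
    then show ?thesis
      unfolding w .
  qed
  show ?thesis
  proof (rule that[OF h cur _ _ \<gamma>U vel cov])
    show "\<gamma> 0 = p"
      using c by (simp add: \<gamma>_def x_def z0)
    show "f j 0 = a j" if "j < m" for j
      using b_coord[OF that] by (simp add: f_def z0)
  qed
qed

section \<open>Totally geodesic distributions\<close>

lemma dir_deriv_zero: "dir_deriv A p v (\<lambda>q. 0) = 0"
  by (simp add: dir_deriv_def Let_def comp_def frechet_derivative_const)

context
  fixes D :: "'a \<Rightarrow> ('a, 'e) tvec set"
  assumes D: "regular_distribution A D"
begin

lemma D_tangent: "v \<in> D p \<Longrightarrow> v \<in> T p"
  using regular_distribution_subspace(2)[OF D] by blast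

lemma sections_vfields: "X \<in> sections A D \<Longrightarrow> X \<in> vfields A"
  and sections_in: "X \<in> sections A D \<Longrightarrow> X p \<in> D p"
  by (auto simp: sections_def)

lemma sections_add: "X \<in> sections A D \<Longrightarrow> Y \<in> sections A D \<Longrightarrow> X + Y \<in> sections A D"
  unfolding sections_def
  using vfields_add subspace_add[OF regular_distribution_subspace(1)[OF D]] by fastforce

lemma sections_scaleR: "X \<in> sections A D \<Longrightarrow> a *\<^sub>R X \<in> sections A D"
  unfolding sections_def mem_Collect_eq
  using vfields_scaleR[of X a] subspace_scale[OF regular_distribution_subspace(1)[OF D]]
  by (auto simp: scaleR_fun_def[of _ X])

text \<open>Provides a section through any prescribed vector of \<open>D\<close> over
  \<open>U\<close>. Constant coefficients suffice since the frame fields are global and stay in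
  \<open>D\<close>.\<close>

lemma frame_sections:
  assumes "adapted_frame D k U E"
  shows "(\<Sum>j<k. a j *\<^sub>R E j) \<in> sections A D"
proof -
  have "(\<Sum>j<k. a j *\<^sub>R E j) \<in> vfields A"
    using frame_vfields[OF assms] frame_rank[OF assms] by (intro vfields_combination) simp
  moreover have "(\<Sum>j<k. a j *\<^sub>R E j) p \<in> D p" for p
    unfolding combination_apply using frame_in[OF assms]
    by (intro subspace_sum subspace_scale regular_distribution_subspace(1)[OF D]) auto
  ultimately show ?thesis
    by (simp add: sections_def)
qed

lemma nab_self_normal:
  assumes "X \<in> sections A D" "Z \<in> vfields A" "\<And>q u. u \<in> D q \<Longrightarrow> g q u (Z q) = 0"
  shows "g p (nab X X p) (Z p) = - g p (X p) (nab X Z p)"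
proof -
  have "(\<lambda>q. g q (X q) (Z q)) = (\<lambda>q. 0)"
    using assms(3) sections_in[OF assms(1)] by blast
  then show ?thesis
    using metric_compatible[OF sections_vfields[OF assms(1)] sections_vfields[OF assms(1)] assms(2), of p]
    by (simp add: dir_deriv_zero)
qed

lemma cov_deriv_normal:
  assumes cur: "curve I \<gamma>" and t: "t \<in> I" and vel: "\<And>s. s \<in> I \<Longrightarrow> velocity A I \<gamma> s \<in> D (\<gamma> s)"
    and X: "X \<in> sections A D" "X (\<gamma> t) = velocity A I \<gamma> t"
    and Z: "Z \<in> vfields A" "\<And>q u. u \<in> D q \<Longrightarrow> g q u (Z q) = 0"
  shows "g (\<gamma> t) (cov_deriv_along A nab I \<gamma> (velocity A I \<gamma>) t) (Z (\<gamma> t)) = g (\<gamma> t) (nab X X (\<gamma> t)) (Z (\<gamma> t))"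
proof -
  have "((\<lambda>s. g (\<gamma> s) (velocity A I \<gamma> s) (Z (\<gamma> s))) has_real_derivative 0) (at t within I)"
    by (rule has_field_derivative_transform_within[OF DERIV_const zero_less_one t]) (simp add: Z(2) vel)
  from DERIV_within_unique[OF cur t this
    cov_value_DERIV(2)[OF cur t cov_value_velocity[OF cur t] sections_vfields[OF X(1)] X(2) Z(1)]]
  show ?thesis
    using nab_self_normal[OF X(1) Z, of "\<gamma> t"] X(2) by simp
qed

lemma nab_self_in:
  assumes "curve I \<gamma>" "t \<in> I" "\<And>s. s \<in> I \<Longrightarrow> velocity A I \<gamma> s \<in> D (\<gamma> s)"
    and "X \<in> sections A D" "X (\<gamma> t) = velocity A I \<gamma> t"
    and "cov_deriv_along A nab I \<gamma> (velocity A I \<gamma>) t = 0"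
    and fr: "adapted_frame D k U E" "\<gamma> t \<in> U"
  shows "nab X X (\<gamma> t) \<in> D (\<gamma> t)"
  unfolding frame_in_iff[OF fr]
proof (intro conjI allI impI)
  show "nab X X (\<gamma> t) \<in> T (\<gamma> t)"
    using nab_tangent sections_vfields[OF assms(4)] by blast
  fix j assume j: "k \<le> j \<and> j < DIM('e)"
  then show "g (\<gamma> t) (nab X X (\<gamma> t)) (E j (\<gamma> t)) = 0"
    using cov_deriv_normal[OF assms(1-5), of "E j"] frame_vfields[OF fr(1)] frame_normal[OF fr(1)]
      frame_tangent[OF fr(1)] assms(6) by simp
qed

section \<open>From the conditions on geodesics to the condition on sections\<close>

lemma section_condition_of_totally_geodesic:
  assumes "totally_geodesic A nab D" "X \<in> sections A D"
  shows "nab X X p \<in> D p"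
proof -
  obtain k U E where p: "p \<in> U" and fr: "adapted_frame D k U E"
    using adapted_frame_exists[OF D] by metis
  obtain h \<gamma> f where h: "h > 0" and cur: "curve {-h<..<h} \<gamma>" and \<gamma>0: "\<gamma> 0 = p"
    and f0: "\<And>j. j < DIM('e) \<Longrightarrow> f j 0 = coef p (\<lambda>j. E j p) (X p) j"
    and \<gamma>U: "\<And>t. t \<in> {-h<..<h} \<Longrightarrow> \<gamma> t \<in> U"
    and vel: "\<And>t. t \<in> {-h<..<h} \<Longrightarrow> velocity A {-h<..<h} \<gamma> t = (\<Sum>j<DIM('e). f j t *\<^sub>R E j (\<gamma> t))"
    and cov: "\<And>t l. t \<in> {-h<..<h} \<Longrightarrow> l < DIM('e) \<Longrightarrow>
      g (\<gamma> t) (cov_deriv_along A nab {-h<..<h} \<gamma> (velocity A {-h<..<h} \<gamma>) t) (E l (\<gamma> t)) = 0"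
    \<comment> \<open>All \<open>DIM('e)\<close> fields are used, which gives a genuine geodesic
      starting with velocity \<open>X p\<close>.\<close>
    using frame_geodesic_exists[OF fr p order_refl, where a = "coef p (\<lambda>j. E j p) (X p)"] by blast
  let ?I = "{-h<..<h}"
  have 0: "0 \<in> ?I"
    using h by simp
  have cov0: "cov_deriv_along A nab ?I \<gamma> (velocity A ?I \<gamma>) t = 0" if t: "t \<in> ?I" for t
    by (rule frame_eq_zero[OF fr \<gamma>U[OF t] cov_deriv_tangent[OF cur t] cov[OF t]])
  then have geo: "geodesic A nab ?I \<gamma>"
    using cur by (simp add: geodesic_def curve_def)
  have "X p \<in> D p"
    by (rule sections_in[OF assms(2)])
  then have X: "X (\<gamma> 0) = velocity A ?I \<gamma> 0"
    using vel[OF 0] frame_expansion[OF fr p D_tangent] f0 \<gamma>0 by simp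
  have "velocity A ?I \<gamma> s \<in> D (\<gamma> s)" if "s \<in> ?I" for s
    using assms(1) geo 0 that X \<open>X p \<in> D p\<close> \<gamma>0 unfolding totally_geodesic_def by metis
  then show ?thesis
    using nab_self_in[OF cur 0 _ assms(2) X cov0[OF 0] fr] p \<gamma>0 by simp
qed

lemma section_condition_of_intrinsic:
  assumes "\<And>I \<gamma>. intrinsic_geodesic A g nab D I \<gamma> \<Longrightarrow> geodesic A nab I \<gamma>" "X \<in> sections A D"
  shows "nab X X p \<in> D p"
proof -
  obtain k U E where p: "p \<in> U" and fr: "adapted_frame D k U E"
    using adapted_frame_exists[OF D] by metis
  note rk = frame_rank[OF fr]
  obtain h \<gamma> f where h: "h > 0" and cur: "curve {-h<..<h} \<gamma>" and \<gamma>0: "\<gamma> 0 = p"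
    and f0: "\<And>j. j < k \<Longrightarrow> f j 0 = coef p (\<lambda>j. E j p) (X p) j"
    and \<gamma>U: "\<And>t. t \<in> {-h<..<h} \<Longrightarrow> \<gamma> t \<in> U"
    and vel: "\<And>t. t \<in> {-h<..<h} \<Longrightarrow> velocity A {-h<..<h} \<gamma> t = (\<Sum>j<k. f j t *\<^sub>R E j (\<gamma> t))"
    and cov: "\<And>t l. t \<in> {-h<..<h} \<Longrightarrow> l < k \<Longrightarrow>
      g (\<gamma> t) (cov_deriv_along A nab {-h<..<h} \<gamma> (velocity A {-h<..<h} \<gamma>) t) (E l (\<gamma> t)) = 0"
    \<comment> \<open>Only the \<open>k\<close> fields spanning \<open>D\<close> are used, which
      keeps the velocity in \<open>D\<close> by construction.\<close>
    using frame_geodesic_exists[OF fr p rk, where a = "coef p (\<lambda>j. E j p) (X p)"] by blast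
  let ?I = "{-h<..<h}"
  have 0: "0 \<in> ?I"
    using h by simp
  have velD: "velocity A ?I \<gamma> s \<in> D (\<gamma> s)" if "s \<in> ?I" for s
    unfolding vel[OF that] using frame_in[OF fr]
    by (intro subspace_sum subspace_scale regular_distribution_subspace(1)[OF D]) auto
  have "orth_proj g D (\<gamma> t) (cov_deriv_along A nab ?I \<gamma> (velocity A ?I \<gamma>) t) = 0" if t: "t \<in> ?I" for t
  proof -
    let ?w = "cov_deriv_along A nab ?I \<gamma> (velocity A ?I \<gamma>) t"
    have wT: "?w \<in> T (\<gamma> t)"
      by (rule cov_deriv_tangent[OF cur t])
    have "g (\<gamma> t) ?w u = 0" if u: "u \<in> D (\<gamma> t)" for u
    proof -
      obtain a where a: "u = (\<Sum>j<k. a j *\<^sub>R E j (\<gamma> t))"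
        using u frame_span[OF fr \<gamma>U[OF t]] by (auto simp: span_family)
      show ?thesis
        unfolding a using wT frame_tangent[OF fr] rk cov[OF t] by (subst g_sum_right) auto
    qed
    then show ?thesis
      using orth_proj_eq_zero_iff[OF D wT] by blast
  qed
  then have "intrinsic_geodesic A g nab D ?I \<gamma>"
    using cur velD by (simp add: intrinsic_geodesic_def curve_def)
  then have cov0: "cov_deriv_along A nab ?I \<gamma> (velocity A ?I \<gamma>) 0 = 0"
    using assms(1) 0 unfolding geodesic_def by blast
  have fam: "orthogonal_family p k (\<lambda>j. E j p)"
    using frame_orthogonal[OF fr p] rk by (auto simp: orthogonal_family_def)
  have "X p \<in> span ((\<lambda>j. E j p) ` {..<k})"
    using sections_in[OF assms(2)] frame_span[OF fr p] by blast
  from orthogonal_family_expansion[OF fam this] have X: "X (\<gamma> 0) = velocity A ?I \<gamma> 0"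
    using vel[OF 0] f0 \<gamma>0 by simp
  show ?thesis
    using nab_self_in[OF cur 0 velD assms(2) X cov0 fr] p \<gamma>0 by simp
qed

section \<open>From the condition on sections to the conditions on geodesics\<close>

lemma geodesic_of_intrinsic:
  assumes sec: "\<And>X. X \<in> sections A D \<Longrightarrow> nab X X \<in> sections A D"
    and geo: "intrinsic_geodesic A g nab D I \<gamma>"
  shows "geodesic A nab I \<gamma>"
proof -
  have cur: "curve I \<gamma>" and vel: "\<And>t. t \<in> I \<Longrightarrow> velocity A I \<gamma> t \<in> D (\<gamma> t)"
    and proj: "\<And>t. t \<in> I \<Longrightarrow> orth_proj g D (\<gamma> t) (cov_deriv_along A nab I \<gamma> (velocity A I \<gamma>) t) = 0"
    using geo by (auto simp: intrinsic_geodesic_def curve_def)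
  have "cov_deriv_along A nab I \<gamma> (velocity A I \<gamma>) t = 0" if t: "t \<in> I" for t
  proof -
    let ?p = "\<gamma> t" and ?w = "cov_deriv_along A nab I \<gamma> (velocity A I \<gamma>) t"
    obtain k U E where p: "?p \<in> U" and fr: "adapted_frame D k U E"
      using adapted_frame_exists[OF D] by metis
    obtain a where a: "velocity A I \<gamma> t = (\<Sum>j<k. a j *\<^sub>R E j ?p)"
      using vel[OF t] frame_span[OF fr p] by (auto simp: span_family)
    define X where "X = (\<Sum>j<k. a j *\<^sub>R E j)"
    have X: "X \<in> sections A D" "X ?p = velocity A I \<gamma> t"
      using frame_sections[OF fr] a by (simp_all add: X_def combination_apply)
    note wT = cov_deriv_tangent[OF cur t]
    show ?thesis
    proof (rule frame_eq_zero[OF fr p wT])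
      fix j assume j: "j < DIM('e)"
      show "g ?p ?w (E j ?p) = 0"
      \<comment> \<open>Tangential components vanish because the projection does; normal ones agree
        with those of \<open>nab X X\<close>, which lies in \<open>D\<close>.\<close>
      proof (cases "j < k")
        case True
        then show ?thesis
          using orth_proj_eq_zero_iff[OF D wT] proj[OF t] frame_in[OF fr] by blast
      next
        case False
        then have n: "g q u (E j q) = 0" if "u \<in> D q" for q u
          using frame_normal[OF fr] j that by simp
        show ?thesis
          using cov_deriv_normal[OF cur t vel X frame_vfields[OF fr j] n] n[OF sections_in[OF sec[OF X(1)]]]
          by simp
      qed
    qed
  qed
  then show ?thesis
    using geo by (simp add: intrinsic_geodesic_def geodesic_def)
qed

lemma geodesic_stays_locally:
  assumes sec: "\<And>X. X \<in> sections A D \<Longrightarrow> nab X X \<in> sections A D"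
    and geo: "geodesic A nab I \<gamma>" and t: "t \<in> I" and vt: "velocity A I \<gamma> t \<in> D (\<gamma> t)"
  shows "\<exists>r>0. \<forall>s\<in>I \<inter> ball t r. velocity A I \<gamma> s \<in> D (\<gamma> s)"
proof -
  have cur: "curve I \<gamma>" and cov: "\<And>s. s \<in> I \<Longrightarrow> cov_deriv_along A nab I \<gamma> (velocity A I \<gamma>) s = 0"
    using geo by (auto simp: geodesic_def curve_def)
  obtain k U E where p: "\<gamma> t \<in> U" and fr: "adapted_frame D k U E"
    using adapted_frame_exists[OF D] by metis
  let ?n = "DIM('e)"
  note rk = frame_rank[OF fr] and E = frame_vfields[OF fr] and ET = frame_tangent[OF fr]
  obtain e f where e: "e > 0" and f: "\<And>j. j < ?n \<Longrightarrow> smooth_on (f j) (ball t e)"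
    and v: "\<And>s. s \<in> I \<inter> ball t e \<Longrightarrow> \<gamma> s \<in> U \<and> velocity A I \<gamma> s = (\<Sum>j<?n. f j s *\<^sub>R E j (\<gamma> s))"
    using frame_coordinates[OF fr cur t p] by blast
  \<comment> \<open>For fixed \<open>l\<close>, the coefficients of the quadratic form in the
    velocity that gives the derivative of \<open>\<phi> l\<close> along the geodesic.\<close>
  define c where "c l i j q = g q (E i q) (nab (E j) (E l) q)" for l i j q
  define d where "d i q = g q (E i q) (E i q)" for i q
  define \<phi> where "\<phi> l s = g (\<gamma> s) (velocity A I \<gamma> s) (E l (\<gamma> s))" for l s
  define L where "L = {k..<?n}"
  \<comment> \<open>Pairs with at least one normal index. Every monomial of \<open>\<phi>'\<close>
    then contains a normal coefficient of the velocity, which makes the bound linear in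
    \<open>\<phi>\<close>.\<close>
  define P where "P = {..<?n} \<times> {..<?n} - {..<k} \<times> {..<k}"
  define \<phi>' where "\<phi>' l s = (\<Sum>(i, j)\<in>P. f i s * f j s * c l i j (\<gamma> s))" for l s
  have L: "finite L" "\<And>l. l \<in> L \<Longrightarrow> l < ?n \<and> k \<le> l"
    by (auto simp: L_def)
  have bilinear: "g q (\<Sum>i<m. a i *\<^sub>R E i q) (nab (\<Sum>i<m. a i *\<^sub>R E i) (E l) q) =
      (\<Sum>(i, j)\<in>{..<m} \<times> {..<m}. a i * a j * c l i j q)" if m: "m \<le> ?n" and l: "l < ?n" for m a l q
  proof -
    have EV: "E i \<in> vfields A" if "i < m" for i
      using E that m by simp
    have "nab (\<Sum>i<m. a i *\<^sub>R E i) (E l) q = (\<Sum>j<m. a j *\<^sub>R nab (E j) (E l) q)"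
      by (rule nab_combination_left[OF EV E[OF l]])
    moreover have "nab (E j) (E l) q \<in> T q" if "j < m" for j
      by (rule nab_tangent[OF EV[OF that] E[OF l]])
    moreover have "(\<Sum>j<m. a j *\<^sub>R nab (E j) (E l) q) \<in> T q"
      using calculation(2) by (intro T_sum T_scale) auto
    ultimately have "g q (\<Sum>i<m. a i *\<^sub>R E i q) (nab (\<Sum>i<m. a i *\<^sub>R E i) (E l) q) =
        (\<Sum>i<m. a i * g q (E i q) (\<Sum>j<m. a j *\<^sub>R nab (E j) (E l) q))"
      using ET m by (simp only:, intro g_sum_left) auto
    also have "\<dots> = (\<Sum>i<m. a i * (\<Sum>j<m. a j * c l i j q))"
      unfolding c_def
      by (intro sum.cong refl arg_cong[where f = "(*) _"] g_sum_right)
        (use ET m nab_tangent[OF EV E[OF l]] in auto)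
    finally have "g q (\<Sum>i<m. a i *\<^sub>R E i q) (nab (\<Sum>i<m. a i *\<^sub>R E i) (E l) q) =
        (\<Sum>i<m. a i * (\<Sum>j<m. a j * c l i j q))" .
    then show ?thesis
      by (simp add: sum.cartesian_product[symmetric] sum_distrib_left mult_ac)
  qed
  have tangential: "(\<Sum>(i, j)\<in>{..<k} \<times> {..<k}. a i * a j * c l i j q) = 0" if l: "l \<in> L" for a l q
  proof -
    \<comment> \<open>A section with constant coefficients is enough: \<open>a\<close> and
      \<open>q\<close> are arbitrary, so at each time the current coefficients of the velocity can
      be inserted and the identity read at \<open>\<gamma> s\<close>.\<close>
    let ?X = "\<Sum>i<k. a i *\<^sub>R E i"
    have X: "?X \<in> sections A D"
      by (rule frame_sections[OF fr])
    have n: "g q u (E l q) = 0" if "u \<in> D q" for q u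
      using frame_normal[OF fr] L(2)[OF l] that by blast
    have "g q (?X q) (nab ?X (E l) q) = 0"
      using nab_self_normal[OF X E n, of q] L(2)[OF l] n[OF sections_in[OF sec[OF X]], of q] by simp
    then show ?thesis
      using bilinear[OF rk, of l q a] L(2)[OF l] by (simp add: combination_apply)
  qed
  have der: "(\<phi> l has_real_derivative \<phi>' l s) (at s within I)" if l: "l \<in> L" and s: "s \<in> I \<inter> ball t e" for l s
  proof -
    let ?X = "\<Sum>j<?n. f j s *\<^sub>R E j"
    have sI: "s \<in> I"
      using s by blast
    have X: "?X \<in> vfields A" "?X (\<gamma> s) = velocity A I \<gamma> s"
      using v[OF s] combination_apply vfields_combination[OF E] by simp_all
    have "g (\<gamma> s) (velocity A I \<gamma> s) (nab ?X (E l) (\<gamma> s)) =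
        (\<Sum>(i, j)\<in>{..<?n} \<times> {..<?n}. f i s * f j s * c l i j (\<gamma> s))"
      using bilinear[OF order_refl, of l "\<gamma> s" "\<lambda>j. f j s"] L(2)[OF l] v[OF s] by simp
    also have "\<dots> = \<phi>' l s + (\<Sum>(i, j)\<in>{..<k} \<times> {..<k}. f i s * f j s * c l i j (\<gamma> s))"
      unfolding \<phi>'_def P_def using rk by (intro sum.subset_diff) auto
    finally have "g (\<gamma> s) (velocity A I \<gamma> s) (nab ?X (E l) (\<gamma> s)) = \<phi>' l s"
      using tangential[OF l] by simp
    moreover have "l < ?n"
      using L(2)[OF l] by blast
    ultimately show ?thesis
      using cov_value_DERIV(2)[OF cur sI cov_value_velocity[OF cur sI] X E[of l]] ET[of l "\<gamma> s"]
      unfolding \<phi>_def[abs_def] cov[OF sI] by simp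
  qed
  \<comment> \<open>The frame is not normalized, so coefficient and inner product differ by the
    squared length \<open>d i\<close>.\<close>
  have f_eq: "f i s = \<phi> i s / d i (\<gamma> s)" if i: "i < ?n" and s: "s \<in> I \<inter> ball t e" for i s
  proof -
    have q: "\<gamma> s \<in> U"
      using v[OF s] by blast
    show ?thesis
      using orthogonal_family_inner[OF frame_orthogonal[OF fr q] i, of "\<lambda>j. f j s"] v[OF s]
        frame_pos[OF fr q i] by (simp add: \<phi>_def d_def)
  qed
  \<comment> \<open>One continuous function dominates all coefficients at once, so a single radius
    and a single constant serve for all indices.\<close>
  define u where "u s = (\<Sum>i<?n. \<bar>f i s\<bar>) + (\<Sum>l<?n. \<Sum>i<?n. \<Sum>j<?n. \<bar>c l i j (\<gamma> s)\<bar>) +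
    (\<Sum>i<?n. \<bar>1 / d i (\<gamma> s)\<bar>)" for s
  have cont: "continuous (at t within I) (\<lambda>s. h (\<gamma> s))" if "smooth_fun_on A UNIV h" for h
    using continuous_on_compose2[OF smooth_fun_on_continuous_on[OF open_UNIV that] curve_continuous_on[OF cur]] t
    by (auto simp: continuous_on_eq_continuous_within)
  have "continuous (at t within I) (f i)" if "i < ?n" for i
    using smooth_on_continuous_on[OF f[OF that]] e
    by (simp add: continuous_on_eq_continuous_at continuous_at_imp_continuous_at_within)
  moreover have "continuous (at t within I) (\<lambda>s. c l i j (\<gamma> s))" if "l < ?n" "i < ?n" "j < ?n" for l i j
    using E nab_vfields that unfolding c_def by (intro cont g_smooth) auto
  moreover have "continuous (at t within I) (\<lambda>s. 1 / d i (\<gamma> s))" if "i < ?n" for i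
  proof -
    have "continuous (at t within I) (\<lambda>s. d i (\<gamma> s))"
      unfolding d_def using E[OF that] by (intro cont g_smooth) auto
    then show ?thesis
      using frame_pos[OF fr p that]
      by (intro continuous_at_within_divide continuous_const) (auto simp: d_def)
  qed
  ultimately have "continuous (at t within I) u"
    unfolding u_def by (intro continuous_add continuous_sum continuous_rabs) auto
  then obtain r0 where r0: "r0 > 0" "\<And>s. s \<in> I \<Longrightarrow> dist s t < r0 \<Longrightarrow> dist (u s) (u t) < 1"
    unfolding continuous_within_eps_delta by (meson zero_less_one)
  define r where "r = min r0 e"
  \<comment> \<open>The 1 is the tolerance chosen above for the continuity of \<open>u\<close> at
    \<open>t\<close>.\<close>
  define B where "B = u t + 1"
  have u_nonneg: "0 \<le> u s" for s
    unfolding u_def by (intro add_nonneg_nonneg sum_nonneg) auto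
  then have B0: "0 \<le> B"
    by (simp add: B_def add_nonneg_nonneg)
  let ?J = "I \<inter> ball t r"
  have J: "s \<in> I \<inter> ball t e" "u s \<le> B" if "s \<in> ?J" for s
    using that r0(2)[of s] by (auto simp: r_def B_def dist_commute dist_real_def)
  have bds: "\<bar>f i s\<bar> \<le> B" "\<bar>1 / d i (\<gamma> s)\<bar> \<le> B" if i: "i < ?n" and s: "s \<in> ?J" for i s
  proof -
    have "\<bar>f i s\<bar> \<le> (\<Sum>i<?n. \<bar>f i s\<bar>)" "\<bar>1 / d i (\<gamma> s)\<bar> \<le> (\<Sum>i<?n. \<bar>1 / d i (\<gamma> s)\<bar>)"
      using i member_le_sum[of i "{..<?n}" "\<lambda>i. \<bar>f i s\<bar>"] member_le_sum[of i "{..<?n}" "\<lambda>i. \<bar>1 / d i (\<gamma> s)\<bar>"] by auto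
    moreover have "0 \<le> (\<Sum>l<?n. \<Sum>i<?n. \<Sum>j<?n. \<bar>c l i j (\<gamma> s)\<bar>)" "0 \<le> (\<Sum>i<?n. \<bar>f i s\<bar>)"
      "0 \<le> (\<Sum>i<?n. \<bar>1 / d i (\<gamma> s)\<bar>)"
      by (intro sum_nonneg abs_ge_zero)+
    ultimately show "\<bar>f i s\<bar> \<le> B" "\<bar>1 / d i (\<gamma> s)\<bar> \<le> B"
      using J(2)[OF s] by (simp_all add: u_def)
  qed
  have bc: "\<bar>c l i j (\<gamma> s)\<bar> \<le> B" if i: "l < ?n" "i < ?n" "j < ?n" and s: "s \<in> ?J" for l i j s
  proof -
    have "\<bar>c l i j (\<gamma> s)\<bar> \<le> (\<Sum>j<?n. \<bar>c l i j (\<gamma> s)\<bar>)"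
      using i by (intro member_le_sum) auto
    also have "\<dots> \<le> (\<Sum>i<?n. \<Sum>j<?n. \<bar>c l i j (\<gamma> s)\<bar>)"
      using i by (intro member_le_sum[of i "{..<?n}" "\<lambda>i. \<Sum>j<?n. \<bar>c l i j (\<gamma> s)\<bar>"]) (auto intro: sum_nonneg)
    also have "\<dots> \<le> (\<Sum>l<?n. \<Sum>i<?n. \<Sum>j<?n. \<bar>c l i j (\<gamma> s)\<bar>)"
      using i by (intro member_le_sum[of l "{..<?n}" "\<lambda>l. \<Sum>i<?n. \<Sum>j<?n. \<bar>c l i j (\<gamma> s)\<bar>"]) (auto intro!: sum_nonneg)
    also have "\<dots> \<le> u s"
      unfolding u_def by (simp add: sum_nonneg)
    finally show ?thesis
      using J(2)[OF s] by simp
  qed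
  have vanish: "\<phi> l s = 0" if l: "l \<in> L" and s: "s \<in> ?J" for l s
  \<comment> \<open>Each term of \<open>\<phi>'\<close> is at most \<open>B ^ 3\<close> times the
    sum of the \<open>\<bar>\<phi> i s\<bar>\<close>: one \<open>B\<close> bounds the connection
    coefficient, one the second velocity coefficient, and one the factor \<open>1 / d\<close> that
    turns a normal coefficient into \<open>\<phi>\<close>.\<close>
  proof (rule gronwall_vanishing[where J = ?J and t = t and L = L and \<phi> = \<phi> and \<phi>' = \<phi>' and C = "real (card P) * B ^ 3"])
    show "is_interval ?J"
      using cur by (intro is_interval_Int) (auto simp: curve_def is_interval_ball_real)
    show "t \<in> ?J"
      using t r0(1) e by (simp add: r_def)
    show "(\<phi> l has_real_derivative \<phi>' l s) (at s within ?J)" if "l \<in> L" "s \<in> ?J" for l s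
      by (rule DERIV_subset[OF der[OF that(1) J(1)[OF that(2)]]]) auto
    show "\<phi> l t = 0" if "l \<in> L" for l
      using frame_normal[OF fr _ _ vt] L(2)[OF that] by (simp add: \<phi>_def)
    fix l s assume l: "l \<in> L" and s: "s \<in> ?J"
    let ?S = "\<Sum>i\<in>L. \<bar>\<phi> i s\<bar>"
    have S0: "0 \<le> ?S"
      by (intro sum_nonneg) auto
    have fL: "\<bar>f i s\<bar> \<le> B * ?S" if i: "i \<in> L" for i
    proof -
      have "\<bar>f i s\<bar> = \<bar>1 / d i (\<gamma> s)\<bar> * \<bar>\<phi> i s\<bar>"
        using f_eq[of i s] L(2)[OF i] J(1)[OF s] by (simp add: abs_mult)
      also have "\<dots> \<le> B * ?S"
        using bds(2)[of i s] L(2)[OF i] s member_le_sum[OF i, of "\<lambda>i. \<bar>\<phi> i s\<bar>"] L(1) B0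
        by (intro mult_mono) auto
      finally show ?thesis .
    qed
    have "\<bar>f i s * f j s * c l i j (\<gamma> s)\<bar> \<le> B ^ 3 * ?S" if ij: "(i, j) \<in> P" for i j
    proof -
      have ij_less: "i < ?n" "j < ?n" and "i \<in> L \<or> j \<in> L"
        using ij by (auto simp: P_def L_def)
      have ff: "\<bar>f i s\<bar> * \<bar>f j s\<bar> \<le> B * (B * ?S)"
        using \<open>i \<in> L \<or> j \<in> L\<close>
      proof
        assume "i \<in> L"
        then have "\<bar>f i s\<bar> * \<bar>f j s\<bar> \<le> (B * ?S) * B"
          using fL bds(1)[OF ij_less(2) s] B0 S0 by (intro mult_mono) auto
        then show ?thesis
          by (simp add: mult_ac)
      next
        assume "j \<in> L"
        then show ?thesis
          using fL bds(1)[OF ij_less(1) s] B0 S0 by (intro mult_mono) auto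
      qed
      have "\<bar>f i s\<bar> * \<bar>f j s\<bar> * \<bar>c l i j (\<gamma> s)\<bar> \<le> B * (B * ?S) * B"
        by (rule mult_mono[OF ff]) (use bc[of l i j s] L(2)[OF l] ij_less s B0 S0 in auto)
      then show ?thesis
        by (simp add: abs_mult power3_eq_cube mult_ac)
    qed
    then have "(\<Sum>x\<in>P. \<bar>case x of (i, j) \<Rightarrow> f i s * f j s * c l i j (\<gamma> s)\<bar>) \<le> real (card P) * (B ^ 3 * ?S)"
      by (intro sum_bounded_above) auto
    then show "\<bar>\<phi>' l s\<bar> \<le> real (card P) * B ^ 3 * ?S"
      unfolding \<phi>'_def by (intro order_trans[OF sum_abs]) (simp add: mult_ac)
  qed (use L l s in auto)
  show ?thesis
  proof (intro exI[of _ r] conjI ballI)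
    show "r > 0"
      using r0(1) e by (simp add: r_def)
    fix s assume s: "s \<in> ?J"
    have q: "\<gamma> s \<in> U" and sI: "s \<in> I"
      using v[OF J(1)[OF s]] s by auto
    show "velocity A I \<gamma> s \<in> D (\<gamma> s)"
      unfolding frame_in_iff[OF fr q] using velocity_tangent[OF cur sI] vanish[OF _ s]
      by (auto simp: \<phi>_def L_def)
  qed
qed

text \<open>Some normal component of the velocity is nonzero at \<open>t\<close>. It is
  differentiable along the curve by \<open>cov_value_DERIV\<close>, hence continuous, and stays
  nonzero nearby.\<close>

lemma curve_leaves_locally:
  assumes cur: "curve I \<gamma>" and t: "t \<in> I" and vt: "velocity A I \<gamma> t \<notin> D (\<gamma> t)"
  shows "\<exists>r>0. \<forall>s\<in>I \<inter> ball t r. velocity A I \<gamma> s \<notin> D (\<gamma> s)"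
proof -
  obtain k U E where p: "\<gamma> t \<in> U" and fr: "adapted_frame D k U E"
    using adapted_frame_exists[OF D] by metis
  obtain Y where Y: "Y \<in> vfields A" "Y (\<gamma> t) = velocity A I \<gamma> t"
    using cov_value_velocity[OF cur t] unfolding cov_value_def by metis
  obtain j where j: "k \<le> j" "j < DIM('e)" and nz: "g (\<gamma> t) (velocity A I \<gamma> t) (E j (\<gamma> t)) \<noteq> 0"
    using vt frame_in_iff[OF fr p] velocity_tangent[OF cur t] by blast
  let ?u = "\<lambda>s. g (\<gamma> s) (velocity A I \<gamma> s) (E j (\<gamma> s))"
  have "continuous (at t within I) ?u"
    by (rule DERIV_continuous[OF cov_value_DERIV(2)[OF cur t cov_value_velocity[OF cur t] Y frame_vfields[OF fr j(2)]]])
  then obtain r where r: "r > 0" "\<And>s. s \<in> I \<Longrightarrow> dist s t < r \<Longrightarrow> dist (?u s) (?u t) < \<bar>?u t\<bar>"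
    unfolding continuous_within_eps_delta using nz by (meson zero_less_abs_iff)
  have "velocity A I \<gamma> s \<notin> D (\<gamma> s)" if s: "s \<in> I \<inter> ball t r" for s
  proof
    assume "velocity A I \<gamma> s \<in> D (\<gamma> s)"
    then have "?u s = 0"
      by (rule frame_normal[OF fr j])
    then show False
      using r(2)[of s] s by (simp add: dist_real_def abs_minus_commute)
  qed
  then show ?thesis
    using r(1) by blast
qed

lemma totally_geodesic_of_section_condition:
  assumes sec: "\<And>X. X \<in> sections A D \<Longrightarrow> nab X X \<in> sections A D"
  shows "totally_geodesic A nab D"
  unfolding totally_geodesic_def
proof (intro allI impI ballI)
  fix I \<gamma> t0 t
  assume geo: "geodesic A nab I \<gamma>" and t0: "t0 \<in> I" "velocity A I \<gamma> t0 \<in> D (\<gamma> t0)" and t: "t \<in> I"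
  have cur: "curve I \<gamma>"
    using geo by (auto simp: geodesic_def curve_def)
  define R where "R = {s \<in> I. velocity A I \<gamma> s \<in> D (\<gamma> s)}"
  have "openin (top_of_set I) R"
    unfolding openin_contains_ball R_def using geodesic_stays_locally[OF sec geo] by fastforce
  moreover have "openin (top_of_set I) (I - R)"
    unfolding openin_contains_ball R_def using curve_leaves_locally[OF cur] by fastforce
  then have "closedin (top_of_set I) R"
    by (auto simp: closedin_def R_def)
  moreover have "connected I"
    using cur by (simp add: curve_def is_interval_connected)
  ultimately have "R = {} \<or> R = I"
    by (simp add: connected_clopen)
  then show "velocity A I \<gamma> t \<in> D (\<gamma> t)"
    using t0 t by (auto simp: R_def)
qed

section \<open>The algebraic equivalences\<close>

lemma sym_second_fund_form_eq_zero_iff: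
  assumes "X \<in> sections A D" "Y \<in> sections A D"
  shows "sym_second_fund_form A g nab D X Y = 0 \<longleftrightarrow> nab X Y + nab Y X \<in> sections A D"
proof -
  have X: "X \<in> vfields A" and Y: "Y \<in> vfields A"
    using assms sections_vfields by auto
  have "sym_second_fund_form A g nab D X Y = 0 \<longleftrightarrow>
      second_fund_form A g nab D X Y + second_fund_form A g nab D Y X = 0"
    by (simp add: sym_second_fund_form_def)
  also have "\<dots> \<longleftrightarrow> (\<forall>p. nab X Y p + nab Y X p \<in> D p)"
    unfolding fun_eq_iff[of _ "0 :: ('a, 'e) vfield"]
    by (simp add: second_fund_form_def orth_proj_compl_add_eq_zero_iff[OF D nab_tangent[OF X Y] nab_tangent[OF Y X]])
  also have "\<dots> \<longleftrightarrow> nab X Y + nab Y X \<in> sections A D"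
    using vfields_add[OF nab_vfields[OF X Y] nab_vfields[OF Y X]] by (simp add: sections_def)
  finally show ?thesis .
qed

lemma polarization:
  "(\<forall>X\<in>sections A D. \<forall>Y\<in>sections A D. nab X Y + nab Y X \<in> sections A D) \<longleftrightarrow>
    (\<forall>X\<in>sections A D. nab X X \<in> sections A D)"
proof safe
  fix X assume *: "\<forall>X\<in>sections A D. \<forall>Y\<in>sections A D. nab X Y + nab Y X \<in> sections A D" and X: "X \<in> sections A D"
  have "(1 / 2) *\<^sub>R (nab X X + nab X X) \<in> sections A D"
    using * X by (intro sections_scaleR) auto
  then show "nab X X \<in> sections A D"
    by (simp flip: scaleR_2)
next
  fix X Y
  assume *: "\<forall>X\<in>sections A D. nab X X \<in> sections A D" and X: "X \<in> sections A D" and Y: "Y \<in> sections A D"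
  have "nab (X + Y) (X + Y) + (- 1) *\<^sub>R (nab X X + nab Y Y) \<in> sections A D"
    using * X Y by (intro sections_add sections_scaleR) (auto intro: sections_add)
  moreover have "nab (X + Y) (X + Y) = (nab X X + nab Y X) + (nab X Y + nab Y Y)"
    using X Y sections_vfields vfields_add by (simp add: nab_add_left nab_add_right add_ac)
  ultimately show "nab X Y + nab Y X \<in> sections A D"
    by (simp add: algebra_simps)
qed

lemma sections_nab_self_iff:
  "X \<in> sections A D \<Longrightarrow> nab X X \<in> sections A D \<longleftrightarrow> (\<forall>p. nab X X p \<in> D p)"
  using nab_vfields[of X X] sections_vfields[of X] by (simp add: sections_def)

end

end

theorem theorem19:
  fixes A :: "('a::{t2_space, second_countable_topology}, 'e::euclidean_space) chart set"
    and g :: "'a \<Rightarrow> ('a, 'e) tvec \<Rightarrow> ('a, 'e) tvec \<Rightarrow> real"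
    and nab :: "('a, 'e) vfield \<Rightarrow> ('a, 'e) vfield \<Rightarrow> ('a, 'e) vfield"
    and D :: "'a \<Rightarrow> ('a, 'e) tvec set"
  assumes "smooth_manifold A"
    and "riemannian_metric A g"
    and "levi_civita A g nab"
    and "regular_distribution A D"
  defines "c1 \<equiv> totally_geodesic A nab D"
    and "c2 \<equiv> \<forall>I \<gamma>. intrinsic_geodesic A g nab D I \<gamma> \<longrightarrow> geodesic A nab I \<gamma>"
    and "c3 \<equiv> \<forall>X\<in>sections A D. \<forall>Y\<in>sections A D. sym_second_fund_form A g nab D X Y = 0"
    and "c4 \<equiv> \<forall>X\<in>sections A D. \<forall>Y\<in>sections A D. nab X Y + nab Y X \<in> sections A D"
    and "c5 \<equiv> \<forall>X\<in>sections A D. nab X X \<in> sections A D"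
  shows "(c1 \<longleftrightarrow> c2) \<and> (c2 \<longleftrightarrow> c3) \<and> (c3 \<longleftrightarrow> c4) \<and> (c4 \<longleftrightarrow> c5)"
proof -
  interpret levi_civita_connection A g nab
    by unfold_locales (rule assms)+
  note D = assms(4)
  have "c3 \<longleftrightarrow> c4"
    unfolding c3_def c4_def using sym_second_fund_form_eq_zero_iff[OF D] by blast
  moreover have "c4 \<longleftrightarrow> c5"
    unfolding c4_def c5_def by (rule polarization[OF D])
  moreover have "c1 \<longleftrightarrow> c5"
    unfolding c1_def c5_def
    using totally_geodesic_of_section_condition[OF D] section_condition_of_totally_geodesic[OF D]
      sections_nab_self_iff[OF D] by blast
  moreover have "c2 \<longleftrightarrow> c5"
    unfolding c2_def c5_def
    using geodesic_of_intrinsic[OF D] section_condition_of_intrinsic[OF D]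
      sections_nab_self_iff[OF D] by blast
  ultimately show ?thesis
    by blast
qed

end
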